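(* Let $G=(V,A)$ be a finite simple graph with at least one vertex. The graph Lie algebra $\mathfrak{g}_G$ over $\mathbb{C}$ is $2$-rigid if and only if $G$ is a complete graph $K_m$ (for some $m\ge 1$) or $G$ is isomorphic to one of the following five graphs: (i) the graph with two vertices and no edges; (ii) the graph with three vertices and exactly one edge; (iii) the graph with three vertices and exactly two edges (the path on three vertices); (iv) the graph with four vertices and exactly two edges, these edges being disjoint; (v) the cycle on four vertices (four vertices and four edges).
   Context: All Lie algebras are over $\mathbb{C}$. Let $\mathcal{N}_{n,2}$ be the variety of Lie brackets on $\mathbb{C}^n$ that are nilpotent of step at most 2, i.e. the alternating bilinear maps $\mu:\mathbb{C}^n\times\mathbb{C}^n\to\mathbb{C}^n$ with $\mu(\mu(x,y),z)=0$ for all $x,y,z$ (so $\mu$ is either abelian or 2-step nilpotent); it is an affine algebraic variety inside the space of bilinear maps. The group $GL_n(\mathbb{C})$ acts on $\mathcal{N}_{n,2}$ by change of basis, $(g\cdot\mu)(x,y)=g\,\mu(g^{-1}x,g^{-1}y)$. A bracket $\mu\in\mathcal{N}_{n,2}$ is called $2$-rigid if its $GL_n(\mathbb{C})$-orbit is Zariski open in $\mathcal{N}_{n,2}$. An $n$-dimensional at most 2-step nilpotent Lie algebra is called $2$-rigid if its bracket, written in some (equivalently any) basis as an element of $\mathcal{N}_{n,2}$, is $2$-rigid. Let $G=(V,A)$ be a graph with vertices $V=\{v_1,\dots,v_m\}$ and edges $A\subseteq\{a_{ij}:1\le i<j\le m\}$, where $a_{ij}$ is the edge joining $v_i$ and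 $v_j$. The graph Lie algebra $\mathfrak{g}_G$ is the $\mathbb{C}$-vector space with basis $V\cup A$ (of dimension $n=|V|+|A|$) and Lie bracket determined by $[v_i,v_j]=a_{ij}$ if $a_{ij}\in A$ and $[v_i,v_j]=0$ otherwise, for $1\le i<j\le m$, extended by antisymmetry, with all elements of $A$ central. *)

theory Defs
  imports "HOL-Analysis.Analysis"
begin

type_synonym 'n bracket = "complex^'n \<Rightarrow> complex^'n \<Rightarrow> complex^'n"

text \<open>The constant \<open>bilinear\<close> of the library is real bilinearity, so complex
  bilinearity is spelled out with the complex scalar multiplication \<open>*s\<close>.\<close>

definition bilinear_brackets :: "'n::finite bracket set" where
  "bilinear_brackets = {\<mu>.
     (\<forall>x. Vector_Spaces.linear (*s) (*s) (\<lambda>y. \<mu> x y)) \<and>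
     (\<forall>y. Vector_Spaces.linear (*s) (*s) (\<lambda>x. \<mu> x y))}"

definition nil2_brackets :: "'n::finite bracket set" where
  "nil2_brackets = {\<mu> \<in> bilinear_brackets.
     (\<forall>x. \<mu> x x = 0) \<and> (\<forall>x y z. \<mu> (\<mu> x y) z = 0)}"

definition GL_act :: "complex^'n^'n \<Rightarrow> 'n::finite bracket \<Rightarrow> 'n bracket" where
  "GL_act g \<mu> = (\<lambda>x y. g *v \<mu> (matrix_inv g *v x) (matrix_inv g *v y))"

definition GL_orbit :: "'n::finite bracket \<Rightarrow> 'n bracket set" where
  "GL_orbit \<mu> = {GL_act g \<mu> | g. invertible g}"

text \<open>Polynomial functions on the affine space of bilinear maps: the complex algebra of
  functions generated by the coordinates (structure constants)
  \<open>\<mu>(e\<^sub>i, e\<^sub>j)\<^sub>k\<close>.\<close>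

inductive_set polynomial_functions :: "('n::finite bracket \<Rightarrow> complex) set" where
  const: "(\<lambda>\<mu>. c) \<in> polynomial_functions"
| coord: "(\<lambda>\<mu>. \<mu> (axis i 1) (axis j 1) $ k) \<in> polynomial_functions"
| add: "\<lbrakk>p \<in> polynomial_functions; q \<in> polynomial_functions\<rbrakk>
          \<Longrightarrow> (\<lambda>\<mu>. p \<mu> + q \<mu>) \<in> polynomial_functions"
| mult: "\<lbrakk>p \<in> polynomial_functions; q \<in> polynomial_functions\<rbrakk>
          \<Longrightarrow> (\<lambda>\<mu>. p \<mu> * q \<mu>) \<in> polynomial_functions"

definition zariski_closed :: "'n::finite bracket set \<Rightarrow> bool" where
  "zariski_closed C \<longleftrightarrow>
     (\<exists>P \<subseteq> polynomial_functions. C = {\<mu> \<in> bilinear_brackets. \<forall>p\<in>P. p \<mu> = 0})"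

definition zariski_open_in :: "'n::finite bracket set \<Rightarrow> 'n bracket set \<Rightarrow> bool" where
  "zariski_open_in N U \<longleftrightarrow> (\<exists>C. zariski_closed C \<and> U = N - C)"

definition two_rigid :: "'n::finite bracket \<Rightarrow> bool" where
  "two_rigid \<mu> \<longleftrightarrow> \<mu> \<in> nil2_brackets \<and> zariski_open_in nil2_brackets (GL_orbit \<mu>)"

text \<open>Here a finite-dimensional Lie algebra is a set \<open>L\<close> of complex-valued functions
  on an index type, with pointwise operations, and a bracket on it. A family \<open>B\<close> indexed by
  \<open>'n\<close> is a basis of \<open>L\<close> if every element of \<open>L\<close> is
  \<open>lincomb B x\<close> for a unique coordinate vector \<open>x\<close>.\<close>

definition lincomb :: "('n::finite \<Rightarrow> 'b \<Rightarrow> complex) \<Rightarrow> complex^'n \<Rightarrow> 'b \<Rightarrow> complex" where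
  "lincomb B x = (\<lambda>p. \<Sum>i\<in>UNIV. x $ i * B i p)"

definition is_basis :: "('b \<Rightarrow> complex) set \<Rightarrow> ('n::finite \<Rightarrow> 'b \<Rightarrow> complex) \<Rightarrow> bool" where
  "is_basis L B \<longleftrightarrow> bij_betw (lincomb B) UNIV L"

definition bracket_in_basis ::
  "('n::finite \<Rightarrow> 'b \<Rightarrow> complex)
     \<Rightarrow> (('b \<Rightarrow> complex) \<Rightarrow> ('b \<Rightarrow> complex) \<Rightarrow> ('b \<Rightarrow> complex)) \<Rightarrow> 'n bracket" where
  "bracket_in_basis B br =
     (\<lambda>x y. inv (lincomb B) (br (lincomb B x) (lincomb B y)))"

text \<open>The type argument carries the dimension \<open>n = CARD('n)\<close> of the algebra.\<close>

definition two_rigid_algebra ::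
  "'n::finite itself \<Rightarrow> ('b \<Rightarrow> complex) set
     \<Rightarrow> (('b \<Rightarrow> complex) \<Rightarrow> ('b \<Rightarrow> complex) \<Rightarrow> ('b \<Rightarrow> complex)) \<Rightarrow> bool" where
  "two_rigid_algebra _ L br \<longleftrightarrow>
     (\<exists>B :: 'n \<Rightarrow> 'b \<Rightarrow> complex. is_basis L B \<and> two_rigid (bracket_in_basis B br))"

type_synonym 'v graph = "'v set \<times> 'v set set"

definition all_edges :: "'v set \<Rightarrow> 'v set set" where
  "all_edges V = {{x, y} | x y. x \<in> V \<and> y \<in> V \<and> x \<noteq> y}"

definition finite_simple_graph :: "'v graph \<Rightarrow> bool" where
  "finite_simple_graph G \<longleftrightarrow> finite (fst G) \<and> snd G \<subseteq> all_edges (fst G)"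

definition graph_iso :: "'v graph \<Rightarrow> 'w graph \<Rightarrow> bool" where
  "graph_iso G H \<longleftrightarrow>
     (\<exists>f. bij_betw f (fst G) (fst H) \<and> (\<lambda>e. f ` e) ` snd G = snd H)"

definition complete_graph :: "nat \<Rightarrow> nat graph" where
  "complete_graph m = ({1..m}, all_edges {1..m})"

text \<open>The Lie algebra of \<open>(V, A)\<close> consists of the functions supported on the disjoint
  union \<open>V <+> A\<close>; the basis vector belonging to a vertex \<open>u\<close> (an edge \<open>a\<close>) is the
  indicator of \<open>Inl u\<close> (of \<open>Inr a\<close>).\<close>

definition graph_space :: "'v graph \<Rightarrow> ('v + 'v set \<Rightarrow> complex) set" where
  "graph_space G = {x. \<forall>p. p \<notin> fst G <+> snd G \<longrightarrow> x p = 0}"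

text \<open>The function \<open>v\<close> is the enumeration \<open>v\<^sub>1, \<dots>, v\<^sub>m\<close> of the vertices, which
  determines the signs of the brackets of vertices.\<close>

definition precedes :: "'v graph \<Rightarrow> (nat \<Rightarrow> 'v) \<Rightarrow> 'v \<Rightarrow> 'v \<Rightarrow> bool" where
  "precedes G v u w \<longleftrightarrow>
     (\<exists>i j. 1 \<le> i \<and> i < j \<and> j \<le> card (fst G) \<and> u = v i \<and> w = v j)"

text \<open>\<open>basis_bracket G v p q r\<close> is the coefficient at the basis vector \<open>r\<close> of the bracket
  of the basis vectors \<open>p\<close> and \<open>q\<close>.\<close>

fun basis_bracket ::
  "'v graph \<Rightarrow> (nat \<Rightarrow> 'v) \<Rightarrow> 'v + 'v set \<Rightarrow> 'v + 'v set \<Rightarrow> 'v + 'v set \<Rightarrow> complex" where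
  "basis_bracket G v (Inl u) (Inl w) r =
     (if {u, w} \<in> snd G \<and> r = Inr {u, w}
      then if precedes G v u w then 1 else if precedes G v w u then -1 else 0
      else 0)"
| "basis_bracket G v _ _ r = 0"

definition graph_bracket ::
  "'v graph \<Rightarrow> (nat \<Rightarrow> 'v) \<Rightarrow> ('v + 'v set \<Rightarrow> complex) \<Rightarrow> ('v + 'v set \<Rightarrow> complex)
     \<Rightarrow> ('v + 'v set \<Rightarrow> complex)" where
  "graph_bracket G v x y = (\<lambda>r.
     \<Sum>p \<in> fst G <+> snd G. \<Sum>q \<in> fst G <+> snd G. x p * y q * basis_bracket G v p q r)"

end

theory Submission
  imports Defs
begin

text \<open>
  The orbit of a bracket of the graph Lie algebra of \<open>G = (V, A)\<close> consists of the brackets that are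
  presented by \<open>G\<close>: there are vectors \<open>w x\<close>, one for each vertex, such that nonadjacent ones commute
  and such that the \<open>w x\<close> together with their brackets along the edges span the space. Since the
  dimension is \<open>card V + card A\<close>, a spanning family of this kind is a basis, and on it the structure
  constants are those of the graph (\<open>GL_orbit_eq_presented\<close>). So \<open>G\<close> is rigid if and only if the
  set \<open>presented_brackets G\<close> is Zariski open (\<open>two_rigid_algebra_iff_open\<close>). The two directions
  then have nothing in common.

  Rigid graphs. Let \<open>d\<close> be the dimension of the derived algebra of a two-step nilpotent bracket in
  dimension \<open>n\<close>. The derived algebra is central, so a complement of it, of dimension \<open>n - d\<close>, generates
  the algebra and \<open>d \<le> (n - d) choose 2\<close>. The condition \<open>card A \<le> d\<close> is open, and it holds for all
  brackets presented by \<open>G\<close>. For a complete graph, for two isolated vertices, for an edge with an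
  isolated vertex and for the path it forces \<open>d = card A\<close>, and then linear algebra in a
  complement of dimension \<open>card V\<close> gives a presentation by \<open>G\<close>. For two disjoint edges and for the
  four-cycle this complement has dimension four, and the bracket is determined by a two-dimensional
  space of bivectors on it: up to duality the image in the first case, the kernel in the second.
  These graphs correspond to the spaces on which the Plucker quadratic form is nondegenerate.
  Such a space contains, up to scalars, exactly two decomposable bivectors, whose planes are complementary, and this
  yields the vertices of the graph (\<open>pencil_decomposable_basis\<close>). Nondegeneracy is the nonvanishing
  of a discriminant, which is a polynomial in the bracket.

  Other graphs. If \<open>presented_brackets G\<close> is open, then a line through the bracket of \<open>G\<close> inside the
  variety meets it in all but finitely many points (\<open>zariski_open_line_cofinite\<close>), so \<open>G\<close> cannot
  be deformed into something with a different invariant. A graph with at most one edge that is not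
  listed has an isolated vertex and two more vertices that are not adjacent; making the isolated vertex
  their bracket enlarges the derived algebra. With two edges or more let \<open>r\<close> be one more than the
  least degree. In every bracket presented by \<open>G\<close> some vector outside of the span of the edges has an
  adjoint of rank less than \<open>r\<close>. On the other hand, number the vertices by \<open>1, \<dots>, m\<close> and let the
  bracket of \<open>e i\<close> and \<open>e j\<close>, for \<open>i < j\<close>, be a basis vector that depends on \<open>i + j\<close> only, or zero
  if \<open>i + j\<close> is not in a suitable window of \<open>card A\<close> consecutive values. By looking at highest
  indices one sees that all vectors outside of the span of the edges have adjoints of rank at least
  \<open>r\<close>, provided that \<open>2 * r \<le> card A + 1\<close> and \<open>G\<close> is not complete (\<open>band_bracket_injective\<close>). By
  compactness of the unit sphere this cannot be a limit of brackets presented by \<open>G\<close>, but on the line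
  joining the two brackets it is (\<open>small_degree_not_open\<close>). Finally, the degree sum \<open>2 * card A\<close> is
  at least \<open>m\<close> times the least degree; so if \<open>2 * r \<le> card A + 1\<close> fails, then \<open>m \<le> 4\<close>, and only
  the listed graphs remain (\<open>few_edges_graphs\<close>).
\<close>

section \<open>Linear algebra over the complex numbers\<close>

lemma spanning_family:
  fixes b :: "'i \<Rightarrow> complex^'n"
  assumes "finite I" "card I = CARD('n)" "vec.span (b ` I) = UNIV"
  shows "inj_on b I" "vec.independent (b ` I)"
proof -
  have dimU: "vec.dim (UNIV :: (complex^'n) set) = CARD('n)"
    by (rule vec_dim_card)
  have "CARD('n) \<le> card (b ` I)"
    using vec.dim_le_card[of UNIV "b ` I"] assms dimU by simp
  then have c: "card (b ` I) = card I"
    using card_image_le[OF assms(1), of b] assms(2) by simp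
  then show "inj_on b I"
    using assms(1) by (simp add: eq_card_imp_inj_on)
  show "vec.independent (b ` I)"
    using vec.card_le_dim_spanning[of "b ` I" UNIV] assms c dimU by simp
qed

lemma family_linear_extension:
  fixes b :: "'i \<Rightarrow> complex^'n" and f :: "'i \<Rightarrow> complex^'m"
  assumes "finite I" "inj_on b I" "vec.independent (b ` I)"
  obtains g where "Vector_Spaces.linear (*s) (*s) g" "\<And>i. i \<in> I \<Longrightarrow> g (b i) = f i"
proof -
  obtain g where g: "Vector_Spaces.linear (*s) (*s) g"
    "\<forall>x\<in>b ` I. g x = (f \<circ> inv_into I b) x"
    using vec.linear_independent_extend[OF assms(3)] by blast
  show thesis
    by (rule that[OF g(1)]) (use g(2) assms(2) in auto)
qed

lemma det_nonzero_iff_rows_span: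
  fixes A :: "complex^'n^'n"
  shows "det A \<noteq> 0 \<longleftrightarrow> vec.span (range (\<lambda>i. A $ i)) = UNIV"
proof -
  have "rows A = range (\<lambda>i. A $ i)"
    by (auto simp: rows_def row_def)
  then show ?thesis
    using invertible_det_nz[of A] invertible_left_inverse[of A]
      matrix_left_invertible_span_rows_gen[of A] by metis
qed

lemma span_le:
  "S \<subseteq> vec.span T \<Longrightarrow> vec.span S \<subseteq> vec.span T"
  by (simp add: vec.span_minimal)

section \<open>Bilinear and two-step nilpotent brackets\<close>

lemma bilinear_bracketsD:
  assumes "\<mu> \<in> bilinear_brackets"
  shows "Vector_Spaces.linear (*s) (*s) (\<mu> x)"
    and "Vector_Spaces.linear (*s) (*s) (\<lambda>x. \<mu> x y)"
  using assms by (auto simp: bilinear_brackets_def)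

lemma bilinear_simps:
  assumes "\<mu> \<in> bilinear_brackets"
  shows "\<mu> (x + x') y = \<mu> x y + \<mu> x' y" "\<mu> x (y + y') = \<mu> x y + \<mu> x y'"
    "\<mu> (x - x') y = \<mu> x y - \<mu> x' y" "\<mu> x (y - y') = \<mu> x y - \<mu> x y'"
    "\<mu> (c *s x) y = c *s \<mu> x y" "\<mu> x (c *s y) = c *s \<mu> x y"
    "\<mu> 0 y = 0" "\<mu> x 0 = 0" "\<mu> (- x) y = - \<mu> x y" "\<mu> x (- y) = - \<mu> x y"
proof -
  interpret l: Vector_Spaces.linear "(*s)" "(*s)" "\<lambda>x. \<mu> x y"
    using assms by (rule bilinear_bracketsD)
  interpret r: Vector_Spaces.linear "(*s)" "(*s)" "\<mu> x"
    using assms by (rule bilinear_bracketsD)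
  interpret r': Vector_Spaces.linear "(*s)" "(*s)" "\<mu> x'"
    using assms by (rule bilinear_bracketsD)
  show "\<mu> (x + x') y = \<mu> x y + \<mu> x' y" "\<mu> x (y + y') = \<mu> x y + \<mu> x y'"
    "\<mu> (x - x') y = \<mu> x y - \<mu> x' y" "\<mu> x (y - y') = \<mu> x y - \<mu> x y'"
    "\<mu> (c *s x) y = c *s \<mu> x y" "\<mu> x (c *s y) = c *s \<mu> x y"
    "\<mu> 0 y = 0" "\<mu> x 0 = 0" "\<mu> (- x) y = - \<mu> x y" "\<mu> x (- y) = - \<mu> x y"
    by (simp_all only: l.add l.diff l.scale l.zero l.neg r.add r.diff r.scale r.zero r.neg)
qed

lemma bilinear_sum:
  assumes "\<mu> \<in> bilinear_brackets"
  shows "\<mu> (\<Sum>i\<in>S. f i) y = (\<Sum>i\<in>S. \<mu> (f i) y)" "\<mu> x (\<Sum>i\<in>S. f i) = (\<Sum>i\<in>S. \<mu> x (f i))"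
proof -
  interpret l: Vector_Spaces.linear "(*s)" "(*s)" "\<lambda>x. \<mu> x y"
    using assms by (rule bilinear_bracketsD)
  interpret r: Vector_Spaces.linear "(*s)" "(*s)" "\<mu> x"
    using assms by (rule bilinear_bracketsD)
  show "\<mu> (\<Sum>i\<in>S. f i) y = (\<Sum>i\<in>S. \<mu> (f i) y)" "\<mu> x (\<Sum>i\<in>S. f i) = (\<Sum>i\<in>S. \<mu> x (f i))"
    by (simp_all only: l.sum r.sum)
qed

lemma bilinear_expand:
  assumes "\<mu> \<in> bilinear_brackets"
  shows "\<mu> x y = (\<Sum>i\<in>UNIV. \<Sum>j\<in>UNIV. (x $ i * y $ j) *s \<mu> (axis i 1) (axis j 1))"
proof -
  have "\<mu> x y = \<mu> (\<Sum>i\<in>UNIV. x $ i *s axis i 1) (\<Sum>j\<in>UNIV. y $ j *s axis j 1)"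
    by (simp only: basis_expansion)
  also have "\<dots> = (\<Sum>i\<in>UNIV. \<Sum>j\<in>UNIV. (x $ i * y $ j) *s \<mu> (axis i 1) (axis j 1))"
    by (simp only: bilinear_sum(1)[OF assms])
      (simp add: bilinear_sum(2)[OF assms] bilinear_simps[OF assms] vec.scale_sum_right mult.commute)
  finally show ?thesis .
qed

lemma bilinear_eq_on_spanning:
  assumes "Vector_Spaces.linear (*s) (*s) g" "Vector_Spaces.linear (*s) (*s) h"
    and "\<mu> \<in> bilinear_brackets" "\<nu> \<in> bilinear_brackets" "vec.span S = UNIV"
    and eq: "\<And>x y. x \<in> S \<Longrightarrow> y \<in> S \<Longrightarrow> g (\<mu> x y) = \<nu> (h x) (h y)"
  shows "g (\<mu> x y) = \<nu> (h x) (h y)"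
proof -
  interpret g: Vector_Spaces.linear "(*s)" "(*s)" g by fact
  interpret h: Vector_Spaces.linear "(*s)" "(*s)" h by fact
  note s = bilinear_simps[OF assms(3)] bilinear_simps[OF assms(4)] g.add h.add g.scale h.scale g.zero h.zero
  have 1: "g (\<mu> x y) = \<nu> (h x) (h y)" if "x \<in> S" for x y
  proof -
    have "y \<in> vec.span S" using assms(5) by simp
    then show ?thesis
      by (induction rule: vec.span_induct_alt) (simp_all add: s eq that)
  qed
  have "x \<in> vec.span S" using assms(5) by simp
  then show ?thesis
    by (induction rule: vec.span_induct_alt) (simp_all add: s 1)
qed

lemma nil2_bracketsD:
  assumes "\<mu> \<in> nil2_brackets"
  shows "\<mu> \<in> bilinear_brackets" "\<mu> x x = 0" "\<mu> (\<mu> x y) z = 0" "\<mu> y x = - \<mu> x y" "\<mu> z (\<mu> x y) = 0"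
proof -
  show b: "\<mu> \<in> bilinear_brackets" and a: "\<mu> x x = 0" and n: "\<mu> (\<mu> x y) z = 0"
    for x y z using assms by (auto simp: nil2_brackets_def)
  have s: "\<mu> y x = - \<mu> x y" for x y
    using a[of "x + y"] a[of x] a[of y]
    by (simp add: bilinear_simps(1,2)[OF b] eq_neg_iff_add_eq_0 add.commute)
  then show "\<mu> y x = - \<mu> x y" .
  show "\<mu> z (\<mu> x y) = 0"
    using s[of z "\<mu> x y"] n by simp
qed

definition derived :: "'n::finite bracket \<Rightarrow> (complex^'n) set" where
  "derived \<mu> = vec.span {\<mu> x y | x y. True}"

lemma bracket_in_derived: "\<mu> x y \<in> derived \<mu>"
  unfolding derived_def by (rule vec.span_base) blast

lemma derived_subspace: "vec.subspace (derived \<mu>)"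
  by (simp add: derived_def)

lemma derived_central:
  assumes "\<mu> \<in> nil2_brackets" "z \<in> derived \<mu>"
  shows "\<mu> z x = 0" "\<mu> x z = 0"
proof -
  note b = bilinear_simps[OF nil2_bracketsD(1)[OF assms(1)]]
  have "\<mu> z x = 0"
    using assms(2) unfolding derived_def
    by (induction rule: vec.span_induct_alt) (auto simp: b nil2_bracketsD(3)[OF assms(1)])
  then show "\<mu> z x = 0" "\<mu> x z = 0"
    using nil2_bracketsD(4)[OF assms(1), of x z] by (simp_all only: minus_zero)
qed

definition tensor_bracket :: "('n \<Rightarrow> 'n \<Rightarrow> 'n \<Rightarrow> complex) \<Rightarrow> 'n::finite bracket" where
  "tensor_bracket c = (\<lambda>x y. \<chi> k. \<Sum>i\<in>UNIV. \<Sum>j\<in>UNIV. c i j k * x $ i * y $ j)"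

lemma tensor_bracket_bilinear: "tensor_bracket c \<in> bilinear_brackets"
proof -
  have "tensor_bracket c x (y + y') = tensor_bracket c x y + tensor_bracket c x y'"
    "tensor_bracket c (x + x') y = tensor_bracket c x y + tensor_bracket c x' y"
    "tensor_bracket c x (s *s y) = s *s tensor_bracket c x y"
    "tensor_bracket c (s *s x) y = s *s tensor_bracket c x y" for x x' y y' s
    by (simp_all add: tensor_bracket_def vec_eq_iff distrib_left distrib_right sum.distrib
        sum_distrib_left mult.assoc mult.left_commute)
  then show ?thesis
    by (simp add: bilinear_brackets_def Vector_Spaces.linear_iff vec.vector_space_axioms)
qed

lemma tensor_bracket_axis: "tensor_bracket c (axis i 1) (axis j 1) = (\<chi> k. c i j k)"
proof -
  have "(\<Sum>i'\<in>UNIV. \<Sum>j'\<in>UNIV. c i' j' k * axis i 1 $ i' * axis j 1 $ j') = c i j k" for k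
  proof -
    have "(\<Sum>i'\<in>UNIV. \<Sum>j'\<in>UNIV. c i' j' k * axis i 1 $ i' * axis j 1 $ j')
      = (\<Sum>i'\<in>UNIV. if i' = i then (\<Sum>j'\<in>UNIV. if j' = j then c i j k else 0) else 0)"
      by (intro sum.cong refl) (auto simp: axis_def if_distrib cong: if_cong)
    then show ?thesis by simp
  qed
  then show ?thesis by (simp add: tensor_bracket_def vec_eq_iff)
qed

text \<open>If brackets of coordinates in the block \<open>J\<close> lie outside of the block, and coordinates outside of
  the block are central, then all values are central. Such structure constants form a linear subspace,
  so the line through two of them stays in the variety of two-step nilpotent brackets.\<close>

definition alternating_tensor :: "'n set \<Rightarrow> ('n \<Rightarrow> 'n \<Rightarrow> 'n \<Rightarrow> complex) \<Rightarrow> bool" where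
  "alternating_tensor J c \<longleftrightarrow>
     (\<forall>i j k. c j i k = - c i j k) \<and> (\<forall>i j k. c i j k \<noteq> 0 \<longrightarrow> i \<in> J \<and> j \<in> J \<and> k \<notin> J)"

lemma tensor_bracket_nil2:
  assumes "alternating_tensor J c"
  shows "tensor_bracket c \<in> nil2_brackets"
proof -
  have skew: "c j i k = - c i j k" and supp: "c i j k \<noteq> 0 \<Longrightarrow> i \<in> J \<and> j \<in> J \<and> k \<notin> J" for i j k
    using assms unfolding alternating_tensor_def by blast+
  have "tensor_bracket c x x = 0" for x
  proof -
    have "tensor_bracket c x x $ k = 0" for k
    proof -
      have "tensor_bracket c x x $ k = (\<Sum>j\<in>UNIV. \<Sum>i\<in>UNIV. c i j k * x $ i * x $ j)"
        unfolding tensor_bracket_def by (simp, rule sum.swap)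
      also have "\<dots> = (\<Sum>j\<in>UNIV. \<Sum>i\<in>UNIV. - (c j i k * x $ j * x $ i))"
        by (intro sum.cong refl) (use skew in \<open>metis mult.assoc mult.commute mult_minus_left\<close>)
      also have "\<dots> = - tensor_bracket c x x $ k"
        by (simp add: tensor_bracket_def sum_negf)
      finally show ?thesis by simp
    qed
    then show ?thesis by (simp add: vec_eq_iff)
  qed
  moreover have "tensor_bracket c (tensor_bracket c x y) z = 0" for x y z
  proof -
    have "tensor_bracket c x y $ i = 0" if "i \<in> J" for i
      unfolding tensor_bracket_def using supp that by (auto intro!: sum.neutral)
    then have "c i j k * tensor_bracket c x y $ i * z $ j = 0" for i j k
      using supp[of i j k] by (cases "c i j k = 0") auto
    then show ?thesis
      by (subst tensor_bracket_def) (auto simp: vec_eq_iff intro!: sum.neutral)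
  qed
  ultimately show ?thesis
    by (simp add: nil2_brackets_def tensor_bracket_bilinear)
qed

section \<open>Polynomial functions and Zariski open sets\<close>

definition polynomial_on_bilinear :: "('n::finite bracket \<Rightarrow> complex) \<Rightarrow> bool" where
  "polynomial_on_bilinear f \<longleftrightarrow> (\<exists>p\<in>polynomial_functions. \<forall>\<mu>\<in>bilinear_brackets. f \<mu> = p \<mu>)"

lemma polynomial_const [intro, simp]: "polynomial_on_bilinear (\<lambda>\<mu>. c)"
  unfolding polynomial_on_bilinear_def
  by (rule bexI[OF _ polynomial_functions.const[of c]]) simp

lemma polynomial_add [intro]:
  assumes "polynomial_on_bilinear f" "polynomial_on_bilinear g"
  shows "polynomial_on_bilinear (\<lambda>\<mu>. f \<mu> + g \<mu>)"
proof -
  obtain p q where "p \<in> polynomial_functions" "\<forall>\<mu>\<in>bilinear_brackets. f \<mu> = p \<mu>"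
    "q \<in> polynomial_functions" "\<forall>\<mu>\<in>bilinear_brackets. g \<mu> = q \<mu>"
    using assms unfolding polynomial_on_bilinear_def by blast
  then show ?thesis
    unfolding polynomial_on_bilinear_def
    by (intro bexI[of _ "\<lambda>\<mu>. p \<mu> + q \<mu>"]) (auto intro: polynomial_functions.add)
qed

lemma polynomial_mult [intro]:
  assumes "polynomial_on_bilinear f" "polynomial_on_bilinear g"
  shows "polynomial_on_bilinear (\<lambda>\<mu>. f \<mu> * g \<mu>)"
proof -
  obtain p q where "p \<in> polynomial_functions" "\<forall>\<mu>\<in>bilinear_brackets. f \<mu> = p \<mu>"
    "q \<in> polynomial_functions" "\<forall>\<mu>\<in>bilinear_brackets. g \<mu> = q \<mu>"
    using assms unfolding polynomial_on_bilinear_def by blast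
  then show ?thesis
    unfolding polynomial_on_bilinear_def
    by (intro bexI[of _ "\<lambda>\<mu>. p \<mu> * q \<mu>"]) (auto intro: polynomial_functions.mult)
qed

lemma polynomial_uminus [intro]:
  assumes "polynomial_on_bilinear f"
  shows "polynomial_on_bilinear (\<lambda>\<mu>. - f \<mu>)"
  using polynomial_mult[OF polynomial_const[of "-1"] assms] by simp

lemma polynomial_diff [intro]:
  assumes "polynomial_on_bilinear f" "polynomial_on_bilinear g"
  shows "polynomial_on_bilinear (\<lambda>\<mu>. f \<mu> - g \<mu>)"
  using polynomial_add[OF assms(1) polynomial_uminus[OF assms(2)]] by simp

lemma polynomial_sum [intro]:
  assumes "\<And>i. i \<in> I \<Longrightarrow> polynomial_on_bilinear (f i)"
  shows "polynomial_on_bilinear (\<lambda>\<mu>. \<Sum>i\<in>I. f i \<mu>)"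
  using assms by (induction I rule: infinite_finite_induct) auto

lemma polynomial_prod [intro]:
  assumes "\<And>i. i \<in> I \<Longrightarrow> polynomial_on_bilinear (f i)"
  shows "polynomial_on_bilinear (\<lambda>\<mu>. \<Prod>i\<in>I. f i \<mu>)"
  using assms by (induction I rule: infinite_finite_induct) auto

lemma polynomial_coordinate [intro]: "polynomial_on_bilinear (\<lambda>\<mu>. \<mu> x y $ k)"
proof -
  have c: "polynomial_on_bilinear (\<lambda>\<mu>. \<mu> (axis i 1) (axis j 1) $ k)" for i j
    unfolding polynomial_on_bilinear_def
    by (rule bexI[OF _ polynomial_functions.coord[of i j k]]) simp
  have "polynomial_on_bilinear
      (\<lambda>\<mu>. \<Sum>i\<in>UNIV. \<Sum>j\<in>UNIV. (x $ i * y $ j) * \<mu> (axis i 1) (axis j 1) $ k)"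
    by (intro polynomial_sum polynomial_mult polynomial_const c)
  moreover have "\<mu> x y $ k = (\<Sum>i\<in>UNIV. \<Sum>j\<in>UNIV. (x $ i * y $ j) * \<mu> (axis i 1) (axis j 1) $ k)"
    if "\<mu> \<in> bilinear_brackets" for \<mu> :: "'a bracket"
    using arg_cong[OF bilinear_expand[OF that, of x y], of "\<lambda>z. z $ k"] by simp
  ultimately show ?thesis
    by (simp add: polynomial_on_bilinear_def)
qed

lemma polynomial_det [intro]:
  assumes "\<And>i j. polynomial_on_bilinear (\<lambda>\<mu>. M \<mu> $ i $ j)"
  shows "polynomial_on_bilinear (\<lambda>\<mu>. det (M \<mu> :: complex^'m^'m))"
  unfolding det_def by (intro polynomial_sum polynomial_mult polynomial_const polynomial_prod assms)

text \<open>The parameters \<open>a\<close> need not range over a finite set, because a Zariski closed set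
  may be cut out by arbitrarily many equations. So openness of an invariant subset can be shown by
  letting \<open>a\<close> run through all choices of auxiliary vectors.\<close>

lemma zariski_open_nonvanishing:
  assumes "\<And>a. polynomial_on_bilinear (F a)"
  shows "zariski_open_in nil2_brackets {\<mu> \<in> nil2_brackets. \<exists>a. F a \<mu> \<noteq> 0}"
proof -
  obtain p where p: "\<And>a. p a \<in> polynomial_functions"
    "\<And>a \<mu>. \<mu> \<in> bilinear_brackets \<Longrightarrow> F a \<mu> = p a \<mu>"
    using assms unfolding polynomial_on_bilinear_def by metis
  let ?C = "{\<mu> \<in> bilinear_brackets. \<forall>q\<in>range p. q \<mu> = 0}"
  have "zariski_closed ?C"
    unfolding zariski_closed_def using p(1) by blast
  moreover have "{\<mu> \<in> nil2_brackets. \<exists>a. F a \<mu> \<noteq> 0} = nil2_brackets - ?C"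
    using p(2) nil2_bracketsD(1) by fastforce
  ultimately show ?thesis
    unfolding zariski_open_in_def by blast
qed

text \<open>An affine line through a point of a Zariski open set leaves the set at finitely many
  parameters only: some equation of the complement does not vanish identically on the line.\<close>

definition tensor_line ::
  "('n \<Rightarrow> 'n \<Rightarrow> 'n \<Rightarrow> complex) \<Rightarrow> ('n \<Rightarrow> 'n \<Rightarrow> 'n \<Rightarrow> complex) \<Rightarrow> complex \<Rightarrow> 'n \<Rightarrow> 'n \<Rightarrow> 'n \<Rightarrow> complex"
  where "tensor_line c c' t = (\<lambda>i j k. (1 - t) * c i j k + t * c' i j k)"

lemma alternating_tensor_line:
  assumes "alternating_tensor J c" "alternating_tensor J c'"
  shows "alternating_tensor J (tensor_line c c' t)"
  unfolding alternating_tensor_def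
proof (intro conjI allI impI)
  fix i j k
  have "c j i k = - c i j k" "c' j i k = - c' i j k"
    using assms unfolding alternating_tensor_def by blast+
  then show "tensor_line c c' t j i k = - tensor_line c c' t i j k"
    by (simp add: tensor_line_def)
next
  fix i j k assume "tensor_line c c' t i j k \<noteq> 0"
  then have "c i j k \<noteq> 0 \<or> c' i j k \<noteq> 0"
    by (auto simp: tensor_line_def)
  then show "i \<in> J" "j \<in> J" "k \<notin> J"
    using assms unfolding alternating_tensor_def by blast+
qed

lemma polynomial_function_on_line:
  assumes "p \<in> polynomial_functions"
  shows "\<exists>q. \<forall>t. p (tensor_bracket (tensor_line c c' t)) = poly q t"
  using assms
proof induction
  case (const a)
  then show ?case by (intro exI[of _ "[:a:]"]) simp
next
  case (coord i j k)
  then show ?case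
    by (intro exI[of _ "[:c i j k, c' i j k - c i j k:]"])
      (simp add: tensor_bracket_axis tensor_line_def algebra_simps)
next
  case (add p q)
  then show ?case by (metis poly_add)
next
  case (mult p q)
  then show ?case by (metis poly_mult)
qed

lemma zariski_open_line_cofinite:
  assumes "zariski_open_in nil2_brackets P" "alternating_tensor J c" "alternating_tensor J c'"
    and "tensor_bracket c \<in> P"
  shows "finite {t. tensor_bracket (tensor_line c c' t) \<notin> P}"
proof -
  obtain S where S: "S \<subseteq> polynomial_functions"
    and P: "P = nil2_brackets - {\<mu> \<in> bilinear_brackets. \<forall>p\<in>S. p \<mu> = 0}"
    using assms(1) unfolding zariski_open_in_def zariski_closed_def by blast
  obtain p where p: "p \<in> S" "p (tensor_bracket c) \<noteq> 0"
    using assms(4) P tensor_bracket_bilinear by blast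
  obtain q where q: "\<And>t. p (tensor_bracket (tensor_line c c' t)) = poly q t"
    using polynomial_function_on_line p(1) S by blast
  have "tensor_line c c' 0 = c"
    by (simp add: tensor_line_def)
  then have "poly q 0 \<noteq> 0"
    using p(2) q[of 0] by simp
  then have "finite {t. poly q t = 0}"
    using poly_roots_finite[of q] by fastforce
  moreover have "{t. tensor_bracket (tensor_line c c' t) \<notin> P} \<subseteq> {t. poly q t = 0}"
    using tensor_bracket_nil2[OF alternating_tensor_line[OF assms(2,3)]] p(1) P q by auto
  ultimately show ?thesis
    by (rule finite_subset[rotated])
qed

section \<open>Brackets presented by a graph\<close>

text \<open>No vector is chosen for an edge; the bracket of its ends serves, up to a sign that depends on the
  orientation. Spanning instead of linear independence makes the condition insensitive to that sign.\<close>

definition presents :: "'v graph \<Rightarrow> ('v \<Rightarrow> complex^'n) \<Rightarrow> 'n::finite bracket \<Rightarrow> bool" where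
  "presents G w \<mu> \<longleftrightarrow>
     (\<forall>x\<in>fst G. \<forall>y\<in>fst G. {x, y} \<notin> snd G \<longrightarrow> \<mu> (w x) (w y) = 0) \<and>
     vec.span (w ` fst G \<union> {\<mu> (w x) (w y) | x y. {x, y} \<in> snd G}) = UNIV"

definition edge_ends :: "'v set \<Rightarrow> 'v \<times> 'v" where
  "edge_ends e = (SOME p. e = {fst p, snd p})"

lemma edge_ends_cases: "edge_ends {x, y} = (x, y) \<or> edge_ends {x, y} = (y, x)"
proof -
  have "{x, y} = {fst (edge_ends {x, y}), snd (edge_ends {x, y})}"
    unfolding edge_ends_def by (rule someI[of _ "(x, y)"]) simp
  then show ?thesis
    by (metis doubleton_eq_iff prod.collapse)
qed

text \<open>The basis that a presentation determines, once every edge is given an orientation.\<close>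

fun frame :: "('v \<Rightarrow> complex^'n) \<Rightarrow> 'n::finite bracket \<Rightarrow> 'v + 'v set \<Rightarrow> complex^'n" where
  "frame w \<mu> (Inl x) = w x"
| "frame w \<mu> (Inr e) = \<mu> (w (fst (edge_ends e))) (w (snd (edge_ends e)))"

lemma finite_simple_graphD:
  assumes "finite_simple_graph G"
  shows "finite (fst G)" "finite (snd G)" "{x, y} \<in> snd G \<Longrightarrow> x \<in> fst G \<and> y \<in> fst G \<and> x \<noteq> y"
    "e \<in> snd G \<Longrightarrow> \<exists>x y. e = {x, y} \<and> x \<in> fst G \<and> y \<in> fst G \<and> x \<noteq> y"
proof -
  show f: "finite (fst G)" using assms by (simp add: finite_simple_graph_def)
  have "all_edges (fst G) \<subseteq> Pow (fst G)" by (auto simp: all_edges_def)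
  then show "finite (snd G)"
    using assms f unfolding finite_simple_graph_def by (meson finite_Pow_iff finite_subset)
  show "e \<in> snd G \<Longrightarrow> \<exists>x y. e = {x, y} \<and> x \<in> fst G \<and> y \<in> fst G \<and> x \<noteq> y" for e
    using assms by (auto simp: finite_simple_graph_def all_edges_def)
  from this[of "{x, y}"] show "{x, y} \<in> snd G \<Longrightarrow> x \<in> fst G \<and> y \<in> fst G \<and> x \<noteq> y"
    by (auto simp: doubleton_eq_iff)
qed

lemma frame_basis:
  fixes \<mu> :: "'n::finite bracket"
  assumes "\<mu> \<in> nil2_brackets" "presents G w \<mu>" "finite_simple_graph G"
    and "CARD('n) = card (fst G) + card (snd G)"
  shows "finite (fst G <+> snd G)" "card (fst G <+> snd G) = CARD('n)"
    "vec.span (frame w \<mu> ` (fst G <+> snd G)) = UNIV"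
    "inj_on (frame w \<mu>) (fst G <+> snd G)" "vec.independent (frame w \<mu> ` (fst G <+> snd G))"
proof -
  let ?I = "fst G <+> snd G"
  note fin = finite_simple_graphD(1,2)[OF assms(3)]
  show f: "finite ?I" using fin by simp
  show c: "card ?I = CARD('n)" using fin assms(4) by (simp add: card_Plus)
  have "w ` fst G \<union> {\<mu> (w x) (w y) | x y. {x, y} \<in> snd G} \<subseteq> vec.span (frame w \<mu> ` ?I)"
  proof
    fix z assume "z \<in> w ` fst G \<union> {\<mu> (w x) (w y) | x y. {x, y} \<in> snd G}"
    then consider (vertex) x where "x \<in> fst G" "z = w x"
      | (edge) x y where "{x, y} \<in> snd G" "z = \<mu> (w x) (w y)" by blast
    then show "z \<in> vec.span (frame w \<mu> ` ?I)"
    proof cases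
      case vertex
      then have "z = frame w \<mu> (Inl x)" "Inl x \<in> ?I" by auto
      then show ?thesis by (metis vec.span_base imageI)
    next
      case edge
      have "frame w \<mu> (Inr {x, y}) \<in> vec.span (frame w \<mu> ` ?I)"
        using edge(1) by (intro vec.span_base imageI) auto
      moreover have "z = frame w \<mu> (Inr {x, y}) \<or> z = - frame w \<mu> (Inr {x, y})"
        using edge_ends_cases[of x y] edge(2) nil2_bracketsD(4)[OF assms(1), of "w x" "w y"] by auto
      ultimately show ?thesis by (metis vec.span_neg)
    qed
  qed
  then have "UNIV \<subseteq> vec.span (frame w \<mu> ` ?I)"
    using span_le[of "w ` fst G \<union> {\<mu> (w x) (w y) | x y. {x, y} \<in> snd G}" "frame w \<mu> ` ?I"]
      assms(2) by (simp only: presents_def)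
  then show s: "vec.span (frame w \<mu> ` ?I) = UNIV"
    by blast
  show "inj_on (frame w \<mu>) ?I" "vec.independent (frame w \<mu> ` ?I)"
    using spanning_family[OF f c s] by blast+
qed

lemma matrix_inv_cancel:
  fixes g :: "complex^'n^'n"
  assumes "invertible g"
  shows "matrix_inv g *v (g *v z) = z"
proof -
  have "\<exists>h. g ** h = mat 1 \<and> h ** g = mat 1"
    using assms by (simp add: invertible_def)
  then have "matrix_inv g ** g = mat 1"
    unfolding matrix_inv_def by (rule someI2_ex) blast
  then show ?thesis
    by (simp add: matrix_vector_mul_assoc)
qed

lemma GL_act_image:
  assumes "invertible g"
  shows "GL_act g \<mu> (g *v x) (g *v y) = g *v \<mu> x y"
  by (simp add: GL_act_def matrix_inv_cancel[OF assms])

lemma GL_act_nil2: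
  assumes "invertible g" "\<mu> \<in> nil2_brackets"
  shows "GL_act g \<mu> \<in> nil2_brackets"
proof -
  note b = bilinear_simps[OF nil2_bracketsD(1)[OF assms(2)]]
  show ?thesis
    by (simp add: nil2_brackets_def bilinear_brackets_def Vector_Spaces.linear_iff
        vec.vector_space_axioms GL_act_def vec.add vec.scale b matrix_inv_cancel[OF assms(1)]
        nil2_bracketsD(2,3)[OF assms(2)])
qed

lemma GL_act_presents:
  assumes "invertible g" "presents G w \<mu>"
  shows "presents G (\<lambda>x. g *v w x) (GL_act g \<mu>)"
proof -
  let ?S = "w ` fst G \<union> {\<mu> (w x) (w y) | x y. {x, y} \<in> snd G}"
  have im: "(\<lambda>x. g *v w x) ` fst G \<union> {g *v \<mu> (w x) (w y) | x y. {x, y} \<in> snd G} = (*v) g ` ?S"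
    by blast
  have "surj ((*v) g)"
    using assms(1) invertible_right_inverse matrix_right_invertible_surjective by blast
  then have "vec.span ((*v) g ` ?S) = UNIV"
    using assms(2) by (simp add: vec.span_image presents_def)
  then show ?thesis
    using assms(2) unfolding presents_def GL_act_image[OF assms(1)] im by auto
qed

text \<open>A frame is a basis, and on it both brackets have the same structure constants; the linear map
  that matches the two frames is therefore an isomorphism.\<close>

lemma presents_same_orbit:
  fixes \<mu> \<nu> :: "'n::finite bracket"
  assumes "\<mu> \<in> nil2_brackets" "\<nu> \<in> nil2_brackets" "presents G w \<mu>" "presents G u \<nu>"
    and "finite_simple_graph G" "CARD('n) = card (fst G) + card (snd G)"
  shows "\<nu> \<in> GL_orbit \<mu>"
proof -
  let ?I = "fst G <+> snd G"
  note F = frame_basis[OF assms(1,3,5,6)] and F' = frame_basis[OF assms(2,4,5,6)]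
  obtain g where g: "Vector_Spaces.linear (*s) (*s) g"
    and gI: "\<And>i. i \<in> ?I \<Longrightarrow> g (frame w \<mu> i) = frame u \<nu> i"
    using family_linear_extension[OF F(1,4,5), of "frame u \<nu>"] by blast
  interpret g: Vector_Spaces.linear "(*s)" "(*s)" g by fact
  have gw: "g (w x) = u x" if "x \<in> fst G" for x
    using gI[of "Inl x"] that by auto
  have same: "g (\<mu> (frame w \<mu> i) (frame w \<mu> j)) = \<nu> (frame u \<nu> i) (frame u \<nu> j)"
    if ij: "i \<in> ?I" "j \<in> ?I" for i j
  proof (cases "\<exists>x y. i = Inl x \<and> j = Inl y")
    case True
    then obtain x y where [simp]: "i = Inl x" "j = Inl y" by blast
    have xy: "x \<in> fst G" "y \<in> fst G" using ij by auto
    show ?thesis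
    proof (cases "{x, y} \<in> snd G")
      case True
      then have "g (frame w \<mu> (Inr {x, y})) = frame u \<nu> (Inr {x, y})"
        using gI[of "Inr {x, y}"] by blast
      moreover have "edge_ends {x, y} = (x, y) \<or> edge_ends {x, y} = (y, x)"
        by (rule edge_ends_cases)
      ultimately show ?thesis
        using nil2_bracketsD(4)[OF assms(1), of "w x" "w y"]
          nil2_bracketsD(4)[OF assms(2), of "u x" "u y"] by (auto simp: g.neg)
    next
      case False
      then show ?thesis
        using assms(3,4) xy by (auto simp: presents_def g.zero)
    qed
  next
    case False
    then consider e where "i = Inr e" | e where "j = Inr e"
      by (metis sum.exhaust)
    then show ?thesis
      by cases (simp_all add: nil2_bracketsD(3,5)[OF assms(1)] nil2_bracketsD(3,5)[OF assms(2)] g.zero)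
  qed
  have hom: "g (\<mu> x y) = \<nu> (g x) (g y)" for x y
  proof (rule bilinear_eq_on_spanning[OF g g nil2_bracketsD(1)[OF assms(1)]
          nil2_bracketsD(1)[OF assms(2)] F(3)])
    fix x y assume "x \<in> frame w \<mu> ` ?I" "y \<in> frame w \<mu> ` ?I"
    then obtain i j where "i \<in> ?I" "j \<in> ?I" "x = frame w \<mu> i" "y = frame w \<mu> j" by blast
    then show "g (\<mu> x y) = \<nu> (g x) (g y)"
      using same gI by simp
  qed
  have "vec.span (g ` frame w \<mu> ` ?I) = UNIV"
    using F'(3) gI by (simp add: image_image cong: image_cong)
  then have "surj g"
    using vec.linear_span_image[OF g, of "frame w \<mu> ` ?I"] F(3) by simp
  then have inv: "invertible (matrix g)"
    using invertible_right_inverse matrix_right_invertible_surjective matrix_works[OF g]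
    by (metis (no_types, lifting) ext)
  have "GL_act (matrix g) \<mu> = \<nu>"
  proof (intro ext)
    fix x y
    obtain x' y' where "x = g x'" "y = g y'" using \<open>surj g\<close> by (metis surj_def)
    then show "GL_act (matrix g) \<mu> x y = \<nu> x y"
      using GL_act_image[OF inv, of \<mu> x' y'] hom by (simp add: matrix_works[OF g])
  qed
  then show ?thesis
    unfolding GL_orbit_def using inv by blast
qed

lemma GL_orbit_eq_presented:
  fixes \<mu> :: "'n::finite bracket"
  assumes "\<mu> \<in> nil2_brackets" "presents G w \<mu>" "finite_simple_graph G"
    and "CARD('n) = card (fst G) + card (snd G)"
  shows "GL_orbit \<mu> = {\<nu> \<in> nil2_brackets. \<exists>u. presents G u \<nu>}"
proof
  show "GL_orbit \<mu> \<subseteq> {\<nu> \<in> nil2_brackets. \<exists>u. presents G u \<nu>}"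
    using GL_act_nil2 GL_act_presents assms(1,2) unfolding GL_orbit_def by blast
  show "{\<nu> \<in> nil2_brackets. \<exists>u. presents G u \<nu>} \<subseteq> GL_orbit \<mu>"
    using presents_same_orbit[OF assms(1) _ assms(2) _ assms(3,4)] by blast
qed

section \<open>Graph Lie algebras in coordinates\<close>

lemma graph_bracket_in_graph_space: "graph_bracket G v x y \<in> graph_space G"
proof -
  have "basis_bracket G v p q r = 0" if "r \<notin> fst G <+> snd G" for p q r
    using that by (cases "(G, v, p, q, r)" rule: basis_bracket.cases) auto
  then show ?thesis
    by (simp add: graph_space_def graph_bracket_def)
qed

lemma graph_bracket_linear:
  "graph_bracket G v (\<lambda>p. x p + x' p) y = (\<lambda>r. graph_bracket G v x y r + graph_bracket G v x' y r)"
  "graph_bracket G v x (\<lambda>p. y p + y' p) = (\<lambda>r. graph_bracket G v x y r + graph_bracket G v x y' r)"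
  "graph_bracket G v (\<lambda>p. c * x p) y = (\<lambda>r. c * graph_bracket G v x y r)"
  "graph_bracket G v x (\<lambda>p. c * y p) = (\<lambda>r. c * graph_bracket G v x y r)"
  by (simp_all add: graph_bracket_def fun_eq_iff distrib_left distrib_right sum.distrib
      sum_distrib_left mult.assoc mult.left_commute)

lemma precedes_asym:
  assumes "bij_betw v {1..card (fst G)} (fst G)" "precedes G v u w"
  shows "\<not> precedes G v w u"
proof
  assume "precedes G v w u"
  then obtain i j k l where ij: "1 \<le> i" "i < j" "j \<le> card (fst G)" "u = v i" "w = v j"
    and kl: "1 \<le> k" "k < l" "l \<le> card (fst G)" "w = v k" "u = v l"
    using assms(2) unfolding precedes_def by blast
  have "inj_on v {1..card (fst G)}" using assms(1) by (simp add: bij_betw_def)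
  then have "i = l" "j = k"
    using ij kl by (simp_all add: inj_on_eq_iff[of v "{1..card (fst G)}"])
  then show False using ij kl by simp
qed

lemma precedes_total:
  assumes "bij_betw v {1..card (fst G)} (fst G)" "u \<in> fst G" "w \<in> fst G" "u \<noteq> w"
  shows "precedes G v u w \<or> precedes G v w u"
proof -
  obtain i j where "i \<in> {1..card (fst G)}" "u = v i" "j \<in> {1..card (fst G)}" "w = v j"
    using assms unfolding bij_betw_def by blast
  then show ?thesis
    using assms(4) unfolding precedes_def by (metis atLeastAtMost_iff linorder_neqE_nat)
qed

lemma basis_bracket_skew:
  assumes "bij_betw v {1..card (fst G)} (fst G)"
  shows "basis_bracket G v q p r = - basis_bracket G v p q r"
  using precedes_asym[OF assms]
  by (cases "(G, v, p, q, r)" rule: basis_bracket.cases) (auto simp: insert_commute)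

lemma graph_bracket_self:
  assumes "bij_betw v {1..card (fst G)} (fst G)"
  shows "graph_bracket G v x x = (\<lambda>r. 0)"
proof
  fix r
  let ?I = "fst G <+> snd G"
  have "graph_bracket G v x x r = (\<Sum>q\<in>?I. \<Sum>p\<in>?I. x p * x q * basis_bracket G v p q r)"
    unfolding graph_bracket_def by (rule sum.swap)
  also have "\<dots> = (\<Sum>q\<in>?I. \<Sum>p\<in>?I. - (x q * x p * basis_bracket G v q p r))"
    by (intro sum.cong refl) (use basis_bracket_skew[OF assms] in \<open>metis mult.commute mult_minus_right minus_minus\<close>)
  also have "\<dots> = - graph_bracket G v x x r"
    by (simp add: graph_bracket_def sum_negf)
  finally show "graph_bracket G v x x r = 0" by simp
qed

lemma graph_bracket_nilpotent: "graph_bracket G v (graph_bracket G v x y) z = (\<lambda>r. 0)"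
proof -
  have 1: "graph_bracket G v x y (Inl u) = 0" for u
  proof -
    have "basis_bracket G v p q (Inl u) = 0" for p q
      by (cases "(G, v, p, q, Inl u :: 'a + 'a set)" rule: basis_bracket.cases) auto
    then show ?thesis by (simp add: graph_bracket_def)
  qed
  have "graph_bracket G v x y p * z q * basis_bracket G v p q r = 0" for p q r
    by (cases p) (simp_all add: 1)
  then show ?thesis
    unfolding graph_bracket_def[of G v "graph_bracket G v x y"] by (simp only: sum.neutral_const)
qed

abbreviation unit_vector :: "'b \<Rightarrow> 'b \<Rightarrow> complex" where
  "unit_vector p \<equiv> (\<lambda>q. if q = p then 1 else 0)"

lemma graph_bracket_unit_vectors:
  assumes "finite_simple_graph G" "p \<in> fst G <+> snd G" "q \<in> fst G <+> snd G"
  shows "graph_bracket G v (unit_vector p) (unit_vector q) = basis_bracket G v p q"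
proof
  fix r
  let ?I = "fst G <+> snd G"
  have f: "finite ?I" using finite_simple_graphD(1,2)[OF assms(1)] by simp
  have "graph_bracket G v (unit_vector p) (unit_vector q) r
    = (\<Sum>p'\<in>?I. if p' = p then (\<Sum>q'\<in>?I. if q' = q then basis_bracket G v p q r else 0) else 0)"
    unfolding graph_bracket_def by (intro sum.cong refl) (auto intro!: sum.cong)
  also have "\<dots> = basis_bracket G v p q r"
    using f assms by simp
  finally show "graph_bracket G v (unit_vector p) (unit_vector q) r = basis_bracket G v p q r" .
qed

lemma lincomb_linear:
  "lincomb B (x + y) = (\<lambda>p. lincomb B x p + lincomb B y p)"
  "lincomb B (c *s x) = (\<lambda>p. c * lincomb B x p)"
  "lincomb B 0 = (\<lambda>p. 0)"
  by (simp_all add: lincomb_def fun_eq_iff distrib_right sum.distrib sum_distrib_left mult.assoc)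

lemma lincomb_sum: "lincomb B (\<Sum>i\<in>I. c i *s u i) p = (\<Sum>i\<in>I. c i * lincomb B (u i) p)"
  by (induction I rule: infinite_finite_induct) (simp_all add: lincomb_linear)

lemma lincomb_bracket_in_basis:
  assumes "is_basis (graph_space G) B"
  shows "lincomb B (bracket_in_basis B (graph_bracket G v) x y)
    = graph_bracket G v (lincomb B x) (lincomb B y)"
  using assms graph_bracket_in_graph_space[of G v "lincomb B x" "lincomb B y"]
  unfolding is_basis_def bij_betw_def bracket_in_basis_def by (metis f_inv_into_f)

lemma bracket_in_basis_nil2:
  assumes "is_basis (graph_space G) B" "bij_betw v {1..card (fst G)} (fst G)"
  shows "bracket_in_basis B (graph_bracket G v) \<in> nil2_brackets"
proof -
  let ?\<mu> = "bracket_in_basis B (graph_bracket G v)"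
  note l = lincomb_bracket_in_basis[OF assms(1), of v]
  have inj: "lincomb B x = lincomb B y \<longleftrightarrow> x = y" for x y
    using assms(1) unfolding is_basis_def bij_betw_def by (metis injD)
  have "?\<mu> x (y + y') = ?\<mu> x y + ?\<mu> x y'" "?\<mu> (x + x') y = ?\<mu> x y + ?\<mu> x' y"
    "?\<mu> x (s *s y) = s *s ?\<mu> x y" "?\<mu> (s *s x) y = s *s ?\<mu> x y" for x x' y y' s
    by (simp_all add: inj[symmetric] l lincomb_linear graph_bracket_linear)
  moreover have "?\<mu> x x = 0" "?\<mu> (?\<mu> x y) z = 0" for x y z
    by (simp_all add: inj[symmetric] l lincomb_linear graph_bracket_self[OF assms(2)]
        graph_bracket_nilpotent)
  ultimately show ?thesis
    by (simp add: nil2_brackets_def bilinear_brackets_def Vector_Spaces.linear_iff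
        vec.vector_space_axioms)
qed

lemma bracket_in_basis_presented:
  assumes "finite_simple_graph G" "is_basis (graph_space G) B"
    and "bij_betw v {1..card (fst G)} (fst G)"
  shows "\<exists>w. presents G w (bracket_in_basis B (graph_bracket G v))"
proof -
  let ?\<mu> = "bracket_in_basis B (graph_bracket G v)"
  let ?I = "fst G <+> snd G"
  note l = lincomb_bracket_in_basis[OF assms(2), of v]
  have fin: "finite ?I" using finite_simple_graphD(1,2)[OF assms(1)] by simp
  have inj: "lincomb B x = lincomb B y \<longleftrightarrow> x = y" for x y
    using assms(2) unfolding is_basis_def bij_betw_def by (metis injD)
  define u where "u p = inv (lincomb B) (unit_vector p)" for p
  have lu: "lincomb B (u p) = unit_vector p" if "p \<in> ?I" for p
  proof -
    have "unit_vector p \<in> graph_space G" using that by (auto simp: graph_space_def)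
    then show ?thesis
      using assms(2) unfolding is_basis_def bij_betw_def u_def by (metis f_inv_into_f)
  qed
  define w where "w x = u (Inl x)" for x
  have bw: "lincomb B (?\<mu> (w x) (w y)) = basis_bracket G v (Inl x) (Inl y)"
    if "x \<in> fst G" "y \<in> fst G" for x y
    using graph_bracket_unit_vectors[OF assms(1) InlI InlI, OF that] lu[OF InlI] that
    by (simp add: l w_def)
  have 1: "?\<mu> (w x) (w y) = 0" if "x \<in> fst G" "y \<in> fst G" "{x, y} \<notin> snd G" for x y
  proof -
    have "lincomb B (?\<mu> (w x) (w y)) = lincomb B 0"
      using that by (simp add: bw lincomb_linear fun_eq_iff)
    then show ?thesis by (simp add: inj)
  qed
  let ?S = "w ` fst G \<union> {?\<mu> (w x) (w y) | x y. {x, y} \<in> snd G}"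
  have uS: "u p \<in> vec.span ?S" if "p \<in> ?I" for p
  proof (cases p)
    case (Inl x)
    then show ?thesis using that by (auto simp: w_def intro!: vec.span_base)
  next
    case (Inr e)
    then have "e \<in> snd G" using that by blast
    then obtain x y where xy: "e = {x, y}" "x \<in> fst G" "y \<in> fst G" "x \<noteq> y"
      using finite_simple_graphD(4)[OF assms(1)] by blast
    obtain x' y' where xy': "e = {x', y'}" "x' \<in> fst G" "y' \<in> fst G" "precedes G v x' y'"
      using precedes_total[OF assms(3) xy(2-4)] xy by (metis insert_commute)
    from \<open>e \<in> snd G\<close> have "lincomb B (?\<mu> (w x') (w y')) = lincomb B (u p)"
      using xy' that by (subst bw) (simp_all add: lu fun_eq_iff Inr)
    then have "u p = ?\<mu> (w x') (w y')" by (simp only: inj)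
    then show ?thesis using xy'(1) \<open>e \<in> snd G\<close> by (auto intro!: vec.span_base)
  qed
  have "x \<in> vec.span ?S" for x
  proof -
    have "lincomb B x \<in> graph_space G"
      using assms(2) unfolding is_basis_def bij_betw_def by blast
    then have "q \<notin> ?I \<Longrightarrow> lincomb B x q = 0" for q
      unfolding graph_space_def by blast
    moreover have "(\<Sum>p\<in>?I. lincomb B x p * unit_vector p q)
      = (if q \<in> ?I then lincomb B x q else 0)" for q
      using sum.delta'[OF fin, of q "lincomb B x"] by (simp add: if_distrib cong: if_cong)
    ultimately have expand: "lincomb B x q = (\<Sum>p\<in>?I. lincomb B x p * unit_vector p q)" for q
      by presburger
    have "lincomb B x = lincomb B (\<Sum>p\<in>?I. lincomb B x p *s u p)"
    proof
      fix q
      have "lincomb B (\<Sum>p\<in>?I. lincomb B x p *s u p) q = (\<Sum>p\<in>?I. lincomb B x p * unit_vector p q)"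
        unfolding lincomb_sum by (intro sum.cong refl) (simp only: lu)
      then show "lincomb B x q = lincomb B (\<Sum>p\<in>?I. lincomb B x p *s u p) q"
        using expand by metis
    qed
    then have "x = (\<Sum>p\<in>?I. lincomb B x p *s u p)" by (simp only: inj)
    also have "\<dots> \<in> vec.span ?S"
      by (intro vec.span_sum vec.span_scale uS)
    finally show ?thesis .
  qed
  then have "presents G w ?\<mu>"
    unfolding presents_def using 1 by blast
  then show ?thesis by (rule exI[of _ w])
qed

lemma graph_space_basis_exists:
  assumes "finite_simple_graph G" "CARD('n::finite) = card (fst G) + card (snd G)"
  shows "\<exists>B :: 'n \<Rightarrow> _. is_basis (graph_space G) B"
proof -
  let ?I = "fst G <+> snd G"
  note fin = finite_simple_graphD(1,2)[OF assms(1)]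
  have "finite ?I" "card ?I = CARD('n)"
    using fin assms(2) by (simp_all add: card_Plus)
  then obtain s where s: "bij_betw s (UNIV :: 'n set) ?I"
    using finite_same_card_bij[of "UNIV :: 'n set" ?I] by auto
  have lc: "lincomb (\<lambda>i. unit_vector (s i)) x (s j) = x $ j" for x j
  proof -
    have "s j = s i \<longleftrightarrow> i = j" for i
      using s unfolding bij_betw_def by (metis injD)
    then show ?thesis by (simp add: lincomb_def if_distrib cong: if_cong)
  qed
  have "bij_betw (lincomb (\<lambda>i. unit_vector (s i))) UNIV (graph_space G)"
  proof (rule bij_betw_byWitness[where f' = "\<lambda>z. \<chi> i. z (s i)"])
    show "\<forall>x\<in>UNIV. (\<chi> i. lincomb (\<lambda>i. unit_vector (s i)) x (s i)) = x"
      by (simp add: lc)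
    show "\<forall>z\<in>graph_space G. lincomb (\<lambda>i. unit_vector (s i)) (\<chi> i. z (s i)) = z"
    proof
      fix z assume z: "z \<in> graph_space G"
      show "lincomb (\<lambda>i. unit_vector (s i)) (\<chi> i. z (s i)) = z"
      proof
        fix p
        show "lincomb (\<lambda>i. unit_vector (s i)) (\<chi> i. z (s i)) p = z p"
        proof (cases "p \<in> ?I")
          case True
          then obtain j where "p = s j" using s by (auto simp: bij_betw_def)
          then show ?thesis by (simp only: lc) simp
        next
          case False
          then have "p \<noteq> s i" for i using s by (auto simp: bij_betw_def)
          then show ?thesis using z False by (simp add: lincomb_def graph_space_def)
        qed
      qed
    qed
    show "range (lincomb (\<lambda>i. unit_vector (s i))) \<subseteq> graph_space G"
    proof -
      have "p \<noteq> s i" if "p \<notin> ?I" for p i using s that by (auto simp: bij_betw_def)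
      then show ?thesis by (auto simp: graph_space_def lincomb_def intro!: sum.neutral)
    qed
    show "(\<lambda>z. \<chi> i. z (s i)) ` graph_space G \<subseteq> UNIV" by simp
  qed
  then show ?thesis unfolding is_basis_def by blast
qed

definition presented_brackets :: "'v graph \<Rightarrow> 'n::finite bracket set" where
  "presented_brackets G = {\<mu> \<in> nil2_brackets. \<exists>w. presents G w \<mu>}"

text \<open>The right-hand side does not depend on a basis, which is why rigidity in one basis and in every
  basis are the same.\<close>

theorem two_rigid_algebra_iff_open:
  assumes "finite_simple_graph G" "bij_betw v {1..card (fst G)} (fst G)"
    and "CARD('n::finite) = card (fst G) + card (snd G)"
  shows "two_rigid_algebra TYPE('n) (graph_space G) (graph_bracket G v) \<longleftrightarrow>
    zariski_open_in nil2_brackets (presented_brackets G :: 'n bracket set)"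
proof -
  have orbit: "GL_orbit (bracket_in_basis B (graph_bracket G v)) = presented_brackets G"
    and nil: "bracket_in_basis B (graph_bracket G v) \<in> nil2_brackets"
    if B: "is_basis (graph_space G) B" for B :: "'n \<Rightarrow> _"
  proof -
    show nil: "bracket_in_basis B (graph_bracket G v) \<in> nil2_brackets"
      by (rule bracket_in_basis_nil2[OF B assms(2)])
    obtain w where "presents G w (bracket_in_basis B (graph_bracket G v))"
      using bracket_in_basis_presented[OF assms(1) B assms(2)] by blast
    then show "GL_orbit (bracket_in_basis B (graph_bracket G v)) = presented_brackets G"
      unfolding presented_brackets_def by (rule GL_orbit_eq_presented[OF nil _ assms(1,3)])
  qed
  obtain B :: "'n \<Rightarrow> _" where "is_basis (graph_space G) B"
    using graph_space_basis_exists[OF assms(1,3)] by blast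
  then show ?thesis
    unfolding two_rigid_algebra_def two_rigid_def using orbit nil by metis
qed

section \<open>The dimension of the derived algebra\<close>

lemma family_dependent:
  fixes f :: "'i \<Rightarrow> complex^'n"
  assumes "finite I" "f ` I \<subseteq> T" "vec.dim T < card I"
  obtains c where "\<exists>i\<in>I. c i \<noteq> 0" "(\<Sum>i\<in>I. c i *s f i) = 0"
proof (cases "inj_on f I")
  case True
  have "vec.dependent (f ` I)"
  proof (rule ccontr)
    assume "vec.independent (f ` I)"
    then have "card (f ` I) \<le> vec.dim T"
      using vec.independent_card_le_dim[OF assms(2)] by blast
    then show False using assms(3) card_image[OF True] by simp
  qed
  then obtain u where u: "\<exists>v\<in>f ` I. u v \<noteq> 0" "(\<Sum>v\<in>f ` I. u v *s v) = 0"
    using vec.dependent_finite[of "f ` I"] assms(1) by auto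
  show thesis
    by (rule that[of "u \<circ> f"]) (use u in \<open>auto simp: sum.reindex[OF True]\<close>)
next
  case False
  then obtain i j where ij: "i \<in> I" "j \<in> I" "i \<noteq> j" "f i = f j"
    by (auto simp: inj_on_def)
  define c where "c k = (if k = i then 1 else if k = j then -1 else 0 :: complex)" for k
  have "(\<Sum>k\<in>I. c k *s f k) = (\<Sum>k\<in>{i, j}. c k *s f k)"
    using ij assms(1) by (intro sum.mono_neutral_right) (auto simp: c_def)
  also have "\<dots> = 0" using ij by (simp add: c_def)
  finally show thesis
    using ij(1) by (intro that[of c]) (auto simp: c_def)
qed

lemma extend_to_basis:
  fixes C :: "(complex^'n) set"
  assumes "vec.independent C"
  obtains E where "C \<subseteq> E" "vec.independent E" "vec.span E = UNIV" "finite E" "card E = CARD('n)"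
proof -
  obtain E where E: "C \<subseteq> E" "vec.independent E" "UNIV \<subseteq> vec.span E"
    by (rule vec.maximal_independent_subset_extend[OF subset_UNIV assms])
  have c: "card E = CARD('n)"
    using vec.basis_card_eq_dim[OF subset_UNIV E(3,2)] by (simp only: vec_dim_card)
  show thesis
    by (rule that[OF E(1,2) _ vec.finiteI_independent[OF E(2)] c]) (use E(3) in blast)
qed

text \<open>Brackets with an element of the derived algebra vanish, so only the brackets of the \<open>w a\<close> count.\<close>

lemma derived_generated:
  assumes "\<mu> \<in> nil2_brackets" "vec.span (w ` S \<union> derived \<mu>) = UNIV"
  shows "derived \<mu> = vec.span {\<mu> (w a) (w b) | a b. a \<in> S \<and> b \<in> S}" (is "_ = ?T")
proof -
  note b = bilinear_simps[OF nil2_bracketsD(1)[OF assms(1)]]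
  have 1: "\<mu> x y \<in> ?T" if "x \<in> w ` S \<union> derived \<mu>" for x y
  proof -
    have "y \<in> vec.span (w ` S \<union> derived \<mu>)" using assms(2) by simp
    then show ?thesis
    proof (induction rule: vec.span_induct_alt)
      case base then show ?case by (simp add: b vec.span_zero)
    next
      case (step c y z)
      have "\<mu> x y \<in> ?T"
      proof (cases "x \<in> derived \<mu> \<or> y \<in> derived \<mu>")
        case True
        then have "\<mu> x y = 0" using derived_central[OF assms(1)] by blast
        then show ?thesis by (simp add: vec.span_zero)
      next
        case False
        then show ?thesis using that step(1) by (intro vec.span_base) blast
      qed
      then show ?case using step(2) by (simp add: b vec.span_add vec.span_scale)
    qed
  qed
  have "\<mu> x y \<in> ?T" for x y
  proof -
    have "x \<in> vec.span (w ` S \<union> derived \<mu>)" using assms(2) by simp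
    then show ?thesis
      by (induction rule: vec.span_induct_alt) (simp_all add: b 1 vec.span_zero vec.span_add vec.span_scale)
  qed
  then have "derived \<mu> \<subseteq> ?T"
    unfolding derived_def by (intro span_le) blast
  moreover have "?T \<subseteq> derived \<mu>"
    unfolding derived_def by (intro vec.span_mono) blast
  ultimately show ?thesis by blast
qed

lemma presents_if_spans_modulo_derived:
  assumes "\<mu> \<in> nil2_brackets" "vec.span (w ` V \<union> derived \<mu>) = UNIV"
    and van: "\<And>x y. x \<in> V \<Longrightarrow> y \<in> V \<Longrightarrow> {x, y} \<notin> A \<Longrightarrow> \<mu> (w x) (w y) = 0"
  shows "presents (V, A) w \<mu>"
proof -
  let ?S = "w ` V \<union> {\<mu> (w x) (w y) | x y. {x, y} \<in> A}"
  have "{\<mu> (w a) (w b) | a b. a \<in> V \<and> b \<in> V} \<subseteq> vec.span ?S"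
  proof
    fix z assume "z \<in> {\<mu> (w a) (w b) | a b. a \<in> V \<and> b \<in> V}"
    then obtain a b where ab: "z = \<mu> (w a) (w b)" "a \<in> V" "b \<in> V" by blast
    show "z \<in> vec.span ?S"
    proof (cases "{a, b} \<in> A")
      case True
      then show ?thesis using ab by (intro vec.span_base) blast
    next
      case False
      then show ?thesis using van[OF ab(2,3)] ab(1) by (simp add: vec.span_zero)
    qed
  qed
  then have "derived \<mu> \<subseteq> vec.span ?S"
    unfolding derived_generated[OF assms(1,2)] by (rule span_le)
  moreover have "w ` V \<subseteq> vec.span ?S" by (auto intro: vec.span_base)
  ultimately have "vec.span (w ` V \<union> derived \<mu>) \<subseteq> vec.span ?S"
    by (intro span_le) blast
  then have "vec.span ?S = UNIV"
    using assms(2) by (simp only: top.extremum_unique)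
  then show ?thesis
    unfolding presents_def using van by simp
qed

lemma complement_of_derived:
  fixes \<mu> :: "'n::finite bracket"
  assumes "finite S" "card S = CARD('n) - vec.dim (derived \<mu>)"
  shows "\<exists>w. vec.span (w ` S \<union> derived \<mu>) = UNIV"
proof -
  obtain C where C: "C \<subseteq> derived \<mu>" "vec.independent C" "derived \<mu> \<subseteq> vec.span C"
    "card C = vec.dim (derived \<mu>)"
    using vec.basis_exists[of "derived \<mu>"] by metis
  obtain E where E: "C \<subseteq> E" "vec.span E = UNIV" "finite E" "card E = CARD('n)"
    using extend_to_basis[OF C(2)] by metis
  have "card (E - C) = card S"
    using E C assms by (simp add: card_Diff_subset finite_subset)
  then obtain w where "bij_betw w S (E - C)"
    using finite_same_card_bij[OF assms(1)] E(3) by (metis finite_Diff)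
  then have "E \<subseteq> w ` S \<union> derived \<mu>"
    using C(1) by (auto simp: bij_betw_def)
  then have "vec.span E \<subseteq> vec.span (w ` S \<union> derived \<mu>)"
    by (rule vec.span_mono)
  then show ?thesis using E(2) by blast
qed

text \<open>The brackets of a basis of a complement span the derived algebra, since it is central.\<close>

lemma dim_derived_le_choose:
  fixes \<mu> :: "'n::finite bracket"
  assumes "\<mu> \<in> nil2_brackets"
  shows "vec.dim (derived \<mu>) \<le> (CARD('n) - vec.dim (derived \<mu>)) choose 2"
proof -
  let ?s = "CARD('n) - vec.dim (derived \<mu>)"
  let ?P = "{e. e \<subseteq> {..<?s} \<and> card e = 2}"
  obtain w where w: "vec.span (w ` {..<?s} \<union> derived \<mu>) = UNIV"
    using complement_of_derived[of "{..<?s}" \<mu>] by auto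
  have gen: "{\<mu> (w a) (w b) | a b. a \<in> {..<?s} \<and> b \<in> {..<?s}} \<subseteq> vec.span (frame w \<mu> ` Inr ` ?P)"
  proof
    fix z assume "z \<in> {\<mu> (w a) (w b) | a b. a \<in> {..<?s} \<and> b \<in> {..<?s}}"
    then obtain a b where ab: "z = \<mu> (w a) (w b)" "a < ?s" "b < ?s" by auto
    show "z \<in> vec.span (frame w \<mu> ` Inr ` ?P)"
    proof (cases "a = b")
      case True
      then show ?thesis using ab nil2_bracketsD(2)[OF assms] by (simp add: vec.span_zero)
    next
      case False
      then have "frame w \<mu> (Inr {a, b}) \<in> vec.span (frame w \<mu> ` Inr ` ?P)"
        using ab by (intro vec.span_base imageI) simp
      moreover have "z = frame w \<mu> (Inr {a, b}) \<or> z = - frame w \<mu> (Inr {a, b})"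
        using edge_ends_cases[of a b] ab(1) nil2_bracketsD(4)[OF assms, of "w a" "w b"] by auto
      ultimately show ?thesis
        by (elim disjE) (simp_all only: vec.span_neg)
    qed
  qed
  have "derived \<mu> \<subseteq> vec.span (frame w \<mu> ` Inr ` ?P)"
    by (rule ord_eq_le_trans[OF derived_generated[OF assms w] span_le[OF gen]])
  then have "vec.dim (derived \<mu>) \<le> card (frame w \<mu> ` Inr ` ?P)"
    by (intro vec.dim_le_card) auto
  also have "\<dots> \<le> card ?P"
    unfolding image_image by (rule card_image_le) simp
  also have "card ?P = ?s choose 2"
    by (simp add: n_subsets)
  finally show ?thesis .
qed

lemma dim_derived_presented_ge:
  fixes \<mu> :: "'n::finite bracket"
  assumes "\<mu> \<in> nil2_brackets" "presents G w \<mu>" "finite_simple_graph G"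
    and "CARD('n) = card (fst G) + card (snd G)"
  shows "card (snd G) \<le> vec.dim (derived \<mu>)"
proof -
  note F = frame_basis[OF assms]
  let ?E = "frame w \<mu> ` Inr ` snd G"
  have "vec.independent ?E"
    using F(5) by (rule vec.independent_mono) auto
  moreover have "?E \<subseteq> derived \<mu>"
    by (auto intro: bracket_in_derived)
  ultimately have "card ?E \<le> vec.dim (derived \<mu>)"
    using vec.independent_card_le_dim by blast
  moreover have "inj_on (frame w \<mu>) (Inr ` snd G)"
    using F(4) by (rule inj_on_subset) auto
  ultimately show ?thesis
    by (simp add: card_image)
qed

text \<open>Having a derived algebra of dimension at least \<open>p\<close> means that \<open>p\<close> brackets of
  suitable vectors can be completed to a basis, which is the nonvanishing of a determinant.\<close>

lemma zariski_open_dim_derived_ge: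
  assumes "p \<le> CARD('n::finite)"
  shows "zariski_open_in nil2_brackets {\<mu> :: 'n bracket. \<mu> \<in> nil2_brackets \<and> p \<le> vec.dim (derived \<mu>)}"
proof -
  obtain J where J: "J \<subseteq> (UNIV :: 'n set)" "card J = p"
    using obtain_subset_with_card_n[OF assms] by metis
  define M :: "('n \<Rightarrow> complex^'n) \<times> ('n \<Rightarrow> complex^'n) \<times> ('n \<Rightarrow> complex^'n) \<Rightarrow> 'n bracket \<Rightarrow> complex^'n^'n"
    where "M = (\<lambda>(X, Y, T) \<mu>. \<chi> j. if j \<in> J then \<mu> (X j) (Y j) else T j)"
  have poly: "polynomial_on_bilinear (\<lambda>\<mu>. det (M a \<mu>))" for a
  proof (rule polynomial_det)
    fix i j
    obtain X Y T where "a = (X, Y, T)" by (metis prod.collapse)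
    then show "polynomial_on_bilinear (\<lambda>\<mu>. M a \<mu> $ i $ j)"
      by (cases "i \<in> J") (auto simp: M_def)
  qed
  have "(\<exists>a. det (M a \<mu>) \<noteq> 0) \<longleftrightarrow> p \<le> vec.dim (derived \<mu>)" for \<mu> :: "'n bracket"
  proof
    assume "\<exists>a. det (M a \<mu>) \<noteq> 0"
    then obtain X Y T where "det (M (X, Y, T) \<mu>) \<noteq> 0" by (metis prod.collapse)
    then have span: "vec.span ((\<lambda>i. M (X, Y, T) \<mu> $ i) ` UNIV) = UNIV"
      by (simp add: det_nonzero_iff_rows_span)
    note sf = spanning_family[OF finite refl span]
    let ?R = "(\<lambda>i. M (X, Y, T) \<mu> $ i) ` J"
    have "vec.independent ?R"
      using sf(2) by (rule vec.independent_mono) auto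
    moreover have "?R \<subseteq> derived \<mu>"
      by (auto simp: M_def intro: bracket_in_derived)
    moreover have "card ?R = p"
      using inj_on_subset[OF sf(1), of J] J by (simp add: card_image)
    ultimately show "p \<le> vec.dim (derived \<mu>)"
      using vec.independent_card_le_dim by metis
  next
    assume p: "p \<le> vec.dim (derived \<mu>)"
    obtain C where C: "C \<subseteq> {\<mu> x y | x y. True}" "vec.independent C"
      "{\<mu> x y | x y. True} \<subseteq> vec.span C" "card C = vec.dim {\<mu> x y | x y. True}"
      by (rule vec.basis_exists)
    have card_C: "card C = vec.dim (derived \<mu>)"
      unfolding derived_def vec.dim_span by (rule C(4))
    obtain C' where C': "C' \<subseteq> C" "card C' = p" "finite C'"
      using obtain_subset_with_card_n[of p C] p card_C by metis
    obtain E where E: "C' \<subseteq> E" "vec.span E = UNIV" "finite E" "card E = CARD('n)"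
      using extend_to_basis[of C'] vec.independent_mono[OF C(2) C'(1)] by metis
    obtain f where f: "bij_betw f J C'"
      using finite_same_card_bij[of J C'] J C' by auto
    have "card (UNIV - J) = card (E - C')"
      using E C' J by (simp add: card_Diff_subset finite_subset[OF J(1)])
    then obtain g where g: "bij_betw g (UNIV - J) (E - C')"
      using finite_same_card_bij[of "UNIV - J" "E - C'"] E(3) by auto
    have "\<exists>x y. f j = \<mu> x y" if "j \<in> J" for j
      using f that C(1) C'(1) by (auto simp: bij_betw_def)
    then obtain X Y where XY: "\<And>j. j \<in> J \<Longrightarrow> f j = \<mu> (X j) (Y j)"
      by metis
    have "range (\<lambda>i. M (X, Y, g) \<mu> $ i) = (\<lambda>i. M (X, Y, g) \<mu> $ i) ` J \<union> (\<lambda>i. M (X, Y, g) \<mu> $ i) ` (UNIV - J)"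
      by blast
    also have "\<dots> = f ` J \<union> g ` (UNIV - J)"
      by (intro arg_cong2[where f = "(\<union>)"] image_cong refl) (auto simp: M_def XY)
    also have "\<dots> = E"
      using f g E(1) by (auto simp: bij_betw_def)
    finally have "det (M (X, Y, g) \<mu>) \<noteq> 0"
      using E(2) by (simp add: det_nonzero_iff_rows_span)
    then show "\<exists>a. det (M a \<mu>) \<noteq> 0" by blast
  qed
  then show ?thesis
    using zariski_open_nonvanishing[of "\<lambda>a \<mu>. det (M a \<mu>)"] poly by simp
qed

corollary open_if_presented_by_rank:
  assumes "finite_simple_graph G" "CARD('n::finite) = card (fst G) + card (snd G)"
    and "\<And>\<mu> :: 'n bracket. \<mu> \<in> nil2_brackets \<Longrightarrow> card (snd G) \<le> vec.dim (derived \<mu>) \<Longrightarrow>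
      \<exists>w. presents G w \<mu>"
  shows "zariski_open_in nil2_brackets (presented_brackets G :: 'n bracket set)"
proof -
  have "presented_brackets G
    = {\<mu> :: 'n bracket. \<mu> \<in> nil2_brackets \<and> card (snd G) \<le> vec.dim (derived \<mu>)}"
    unfolding presented_brackets_def
    using assms(3) dim_derived_presented_ge[OF _ _ assms(1,2)] by blast
  then show ?thesis
    using zariski_open_dim_derived_ge[of "card (snd G)", where 'n = 'n] assms(2) by simp
qed

section \<open>Rigidity of graphs with maximal derived algebra\<close>

lemma all_edgesI: "x \<in> V \<Longrightarrow> y \<in> V \<Longrightarrow> x \<noteq> y \<Longrightarrow> {x, y} \<in> all_edges V"
  by (auto simp: all_edges_def)

text \<open>Let \<open>m = card V\<close>. If \<open>m choose 2 \<le> d\<close>, then a complement of the derived algebra has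
  dimension at most \<open>m\<close>, hence \<open>d \<le> m choose 2\<close>. So \<open>d = m choose 2\<close>, and any basis of a
  complement presents the bracket, as there is no vanishing to achieve.\<close>

lemma complete_graph_open:
  assumes "finite V" "CARD('n::finite) = card V + card (all_edges V)"
  shows "zariski_open_in nil2_brackets (presented_brackets (V, all_edges V) :: 'n bracket set)"
proof (rule open_if_presented_by_rank)
  show "finite_simple_graph (V, all_edges V)"
    using assms by (simp add: finite_simple_graph_def)
  show "CARD('n) = card (fst (V, all_edges V)) + card (snd (V, all_edges V))"
    using assms(2) by simp
  fix \<mu> :: "'n bracket"
  assume nil: "\<mu> \<in> nil2_brackets" and "card (snd (V, all_edges V)) \<le> vec.dim (derived \<mu>)"
  have "all_edges V = {e. e \<subseteq> V \<and> card e = 2}"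
    by (auto simp: all_edges_def card_2_iff)
  then have c: "card (all_edges V) = card V choose 2"
    using assms(1) by (simp add: n_subsets)
  let ?d = "vec.dim (derived \<mu>)"
  have ge: "card V choose 2 \<le> ?d"
    using \<open>card (snd (V, all_edges V)) \<le> ?d\<close> c by simp
  have le: "?d \<le> (CARD('n) - ?d) choose 2"
    by (rule dim_derived_le_choose[OF nil])
  also have "\<dots> \<le> card V choose 2"
    using ge assms(2) c by (intro binomial_right_mono) simp
  finally have "card V = CARD('n) - ?d"
    using ge assms(2) c by simp
  then obtain w where w: "vec.span (w ` V \<union> derived \<mu>) = UNIV"
    using complement_of_derived[OF assms(1)] by blast
  have "\<mu> (w x) (w y) = 0" if "x \<in> V" "y \<in> V" "{x, y} \<notin> all_edges V" for x y
    using that nil2_bracketsD(2)[OF nil] by (cases "x = y") (auto simp: all_edges_def)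
  then show "\<exists>w. presents (V, all_edges V) w \<mu>"
    by (intro exI[of _ w] presents_if_spans_modulo_derived[OF nil w]) simp
qed

text \<open>In dimension two every two-step nilpotent bracket is zero.\<close>

lemma two_vertices_open:
  assumes "CARD('n::finite) = 2"
  shows "zariski_open_in nil2_brackets (presented_brackets ({1, 2 :: nat}, {}) :: 'n bracket set)"
proof (rule open_if_presented_by_rank)
  show "finite_simple_graph ({1, 2 :: nat}, {})"
    by (simp add: finite_simple_graph_def)
  show "CARD('n) = card (fst ({1, 2 :: nat}, {})) + card (snd ({1, 2 :: nat}, {}))"
    using assms by simp
  fix \<mu> :: "'n bracket"
  assume nil: "\<mu> \<in> nil2_brackets"
  let ?d = "vec.dim (derived \<mu>)"
  have "?d \<le> 2" using dim_subset_UNIV_cart_gen[of "derived \<mu>"] assms by simp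
  moreover have "?d \<le> (2 - ?d) choose 2"
    using dim_derived_le_choose[OF nil] assms by simp
  ultimately have d: "?d = 0"
    by (cases "?d = 0"; cases "?d = 1"; cases "?d = 2") (auto simp: numeral_eq_Suc)
  then obtain w :: "nat \<Rightarrow> _" where w: "vec.span (w ` {1, 2} \<union> derived \<mu>) = UNIV"
    using complement_of_derived[of "{1, 2 :: nat}" \<mu>] assms by (auto simp del: vec.dim_eq_0)
  have zero: "\<mu> x y = 0" for x y
    using d bracket_in_derived[of \<mu> x y] by auto
  show "\<exists>w. presents ({1, 2 :: nat}, {}) w \<mu>"
    by (rule exI, rule presents_if_spans_modulo_derived[OF nil w], rule zero)
qed

text \<open>A nonzero bracket in dimension four has a derived algebra of dimension one, so on a complement of
  dimension three it is an alternating form, which has a radical.\<close>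

lemma edge_and_vertex_open:
  assumes "CARD('n::finite) = 4"
  shows "zariski_open_in nil2_brackets
    (presented_brackets ({1, 2, 3 :: nat}, {{1, 2}}) :: 'n bracket set)"
proof (rule open_if_presented_by_rank)
  show "finite_simple_graph ({1, 2, 3 :: nat}, {{1, 2}})"
    by (simp add: finite_simple_graph_def all_edgesI)
  show "CARD('n) = card (fst ({1, 2, 3 :: nat}, {{1, 2 :: nat}})) + card (snd ({1, 2, 3 :: nat}, {{1, 2 :: nat}}))"
    using assms by simp
  fix \<mu> :: "'n bracket"
  assume nil: "\<mu> \<in> nil2_brackets"
    and ge: "card (snd ({1, 2, 3 :: nat}, {{1, 2 :: nat}})) \<le> vec.dim (derived \<mu>)"
  note b = bilinear_simps[OF nil2_bracketsD(1)[OF nil]]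
  let ?d = "vec.dim (derived \<mu>)"
  have "?d \<le> 4" using dim_subset_UNIV_cart_gen[of "derived \<mu>"] assms by simp
  moreover have "?d \<le> (4 - ?d) choose 2"
    using dim_derived_le_choose[OF nil] assms by simp
  ultimately have d: "?d = 1"
    using ge by (cases "?d = 1"; cases "?d = 2"; cases "?d = 3"; cases "?d = 4")
      (auto simp: numeral_eq_Suc)
  then obtain w :: "nat \<Rightarrow> _" where w: "vec.span (w ` {1, 2, 3} \<union> derived \<mu>) = UNIV"
    using complement_of_derived[of "{1, 2, 3 :: nat}" \<mu>] assms by auto
  have "\<exists>i j. i \<in> {1, 2, 3} \<and> j \<in> {1, 2, 3} \<and> \<mu> (w i) (w j) \<noteq> 0"
  proof (rule ccontr)
    assume "\<not> ?thesis"
    then have "{\<mu> (w a) (w b) | a b. a \<in> {1, 2, 3} \<and> b \<in> {1, 2, 3}} \<subseteq> vec.span {}" by auto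
    then have "derived \<mu> \<subseteq> vec.span {}"
      by (rule ord_eq_le_trans[OF derived_generated[OF nil w] span_le])
    then have "derived \<mu> \<subseteq> {0}" by simp
    then have "?d = 0" by (simp only: vec.dim_eq_0)
    then show False using d by presburger
  qed
  then obtain i j where ij: "i \<in> {1, 2, 3}" "j \<in> {1, 2, 3}" "\<mu> (w i) (w j) \<noteq> 0" by blast
  then have "i \<noteq> j" using nil2_bracketsD(2)[OF nil] by auto
  then obtain k where k: "{1, 2, 3} = {i, j, k}"
    using ij(1,2) by auto
  let ?a = "\<mu> (w i) (w j)"
  have "derived \<mu> = vec.span {?a}"
    using vec.subspace_dim_equal[of "vec.span {?a}" "derived \<mu>"] bracket_in_derived[of \<mu>]
      derived_subspace d ij(3) by (simp add: span_le derived_def vec.span_minimal)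
  then have "\<exists>t. z = t *s ?a" if "z \<in> derived \<mu>" for z
    using that by (auto simp: vec.span_singleton)
  then obtain s t where st: "\<mu> (w k) (w i) = s *s ?a" "\<mu> (w k) (w j) = t *s ?a"
    using bracket_in_derived by metis
  let ?u = "w k + s *s w j - t *s w i"
  define w' where "w' n = (if n = 1 then w i else if n = 2 then w j else ?u)" for n :: nat
  have u: "\<mu> ?u (w i) = 0" "\<mu> ?u (w j) = 0"
    using st nil2_bracketsD(2)[OF nil] nil2_bracketsD(4)[OF nil, of "w i" "w j"] by (simp_all add: b)
  then have u': "\<mu> (w i) ?u = 0" "\<mu> (w j) ?u = 0"
    using nil2_bracketsD(4)[OF nil, of ?u "w i"] nil2_bracketsD(4)[OF nil, of ?u "w j"] by simp_all
  let ?S = "w' ` {1, 2, 3} \<union> derived \<mu>"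
  have ijS: "w i \<in> vec.span ?S" "w j \<in> vec.span ?S" "?u \<in> vec.span ?S"
    by (auto simp: w'_def intro!: vec.span_base)
  have "w k = ?u - s *s w j + t *s w i" by simp
  also have "\<dots> \<in> vec.span ?S"
    by (intro vec.span_add vec.span_diff vec.span_scale ijS)
  finally have "w ` {i, j, k} \<subseteq> vec.span ?S"
    using ijS by blast
  moreover have "derived \<mu> \<subseteq> vec.span ?S"
    by (auto intro: vec.span_base)
  ultimately have "w ` {1, 2, 3} \<union> derived \<mu> \<subseteq> vec.span ?S"
    unfolding k by blast
  then have "vec.span ?S = UNIV"
    using span_le w by blast
  then have "presents ({1, 2, 3 :: nat}, {{1, 2}}) w' \<mu>"
    by (rule presents_if_spans_modulo_derived[OF nil])
      (auto simp: w'_def u u' nil2_bracketsD(2)[OF nil])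
  then show "\<exists>w. presents ({1, 2, 3 :: nat}, {{1, 2}}) w \<mu>" by (rule exI[of _ w'])
qed

lemma path_open:
  assumes "CARD('n::finite) = 5"
  shows "zariski_open_in nil2_brackets
    (presented_brackets ({1, 2, 3 :: nat}, {{1, 2}, {2, 3}}) :: 'n bracket set)"
proof (rule open_if_presented_by_rank)
  have c: "card {{1, 2 :: nat}, {2, 3}} = 2"
    by (simp add: doubleton_eq_iff)
  show "finite_simple_graph ({1, 2, 3 :: nat}, {{1, 2}, {2, 3}})"
    by (simp add: finite_simple_graph_def all_edgesI)
  show "CARD('n) = card (fst ({1, 2, 3 :: nat}, {{1, 2 :: nat}, {2, 3}}))
      + card (snd ({1, 2, 3 :: nat}, {{1, 2 :: nat}, {2, 3}}))"
    using assms c by simp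
  fix \<mu> :: "'n bracket"
  assume nil: "\<mu> \<in> nil2_brackets"
    and ge: "card (snd ({1, 2, 3 :: nat}, {{1, 2 :: nat}, {2, 3}})) \<le> vec.dim (derived \<mu>)"
  note b = bilinear_simps[OF nil2_bracketsD(1)[OF nil]]
  have skew: "\<mu> x y = - \<mu> y x" for x y by (rule nil2_bracketsD(4)[OF nil])
  let ?d = "vec.dim (derived \<mu>)"
  have "?d \<le> 5" using dim_subset_UNIV_cart_gen[of "derived \<mu>"] assms by simp
  moreover have "?d \<le> (5 - ?d) choose 2"
    using dim_derived_le_choose[OF nil] assms by simp
  ultimately have d: "?d = 2"
    using ge c by (cases "?d = 2"; cases "?d = 3"; cases "?d = 4"; cases "?d = 5")
      (auto simp: numeral_eq_Suc)
  then obtain w :: "nat \<Rightarrow> _" where w: "vec.span (w ` {1, 2, 3} \<union> derived \<mu>) = UNIV"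
    using complement_of_derived[of "{1, 2, 3 :: nat}" \<mu>] assms by auto
  \<comment> \<open>Three brackets in a plane satisfy a linear relation, and a bivector in dimension three is
    decomposable: the relation says that two independent vectors commute.\<close>
  have path: "\<exists>w. presents ({1, 2, 3 :: nat}, {{1, 2}, {2, 3}}) w \<mu>"
    if rel: "r *s \<mu> x y + s *s \<mu> x z + t *s \<mu> y z = 0" and s: "s \<noteq> 0"
      and span: "vec.span ({x, y, z} \<union> derived \<mu>) = UNIV" for r s t x y z
  proof -
    let ?p = "s *s x + t *s y" and ?q = "r *s y + s *s z"
    define u where "u n = (if n = 1 then ?p else if n = 2 then y else ?q)" for n :: nat
    have "\<mu> ?p ?q = s *s (r *s \<mu> x y + s *s \<mu> x z + t *s \<mu> y z)"
      by (simp add: b nil2_bracketsD(2)[OF nil] vec_eq_iff algebra_simps)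
    then have pq: "\<mu> ?p ?q = 0" "\<mu> ?q ?p = 0"
      using rel skew[of ?q ?p] by simp_all
    let ?S = "u ` {1, 2, 3} \<union> derived \<mu>"
    have m: "y \<in> vec.span ?S" "?p \<in> vec.span ?S" "?q \<in> vec.span ?S"
      by (auto simp: u_def intro!: vec.span_base)
    have "x = (1 / s) *s (?p - t *s y)" "z = (1 / s) *s (?q - r *s y)"
      using s by (simp_all add: vec_eq_iff)
    then have "x \<in> vec.span ?S" "z \<in> vec.span ?S"
      using m by (metis vec.span_diff vec.span_scale)+
    then have "{x, y, z} \<union> derived \<mu> \<subseteq> vec.span ?S"
      using m by (auto intro: vec.span_base)
    then have "vec.span ?S = UNIV"
      using span_le span by blast
    then have "presents ({1, 2, 3 :: nat}, {{1, 2}, {2, 3}}) u \<mu>"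
      by (rule presents_if_spans_modulo_derived[OF nil])
        (auto simp: u_def pq nil2_bracketsD(2)[OF nil] doubleton_eq_iff)
    then show ?thesis by (rule exI[of _ u])
  qed
  let ?I = "{(1, 2), (1, 3), (2, 3 :: nat)} :: (nat \<times> nat) set"
  have "vec.dim (derived \<mu>) < card ?I" using d by simp
  moreover have "(\<lambda>i. \<mu> (w (fst i)) (w (snd i))) ` ?I \<subseteq> derived \<mu>"
    by (auto intro: bracket_in_derived)
  ultimately obtain c where c: "\<exists>i\<in>?I. c i \<noteq> 0"
    "(\<Sum>i\<in>?I. c i *s \<mu> (w (fst i)) (w (snd i))) = 0"
    using family_dependent[of ?I "\<lambda>i. \<mu> (w (fst i)) (w (snd i))" "derived \<mu>"] by blast
  have rel: "c (1, 2) *s \<mu> (w 1) (w 2) + c (1, 3) *s \<mu> (w 1) (w 3) + c (2, 3) *s \<mu> (w 2) (w 3) = 0"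
    using c(2) by (simp add: add.assoc)
  have span: "vec.span ({w 1, w 2, w 3} \<union> derived \<mu>) = UNIV"
    using w by simp
  consider "c (1, 3) \<noteq> 0" | "c (1, 2) \<noteq> 0" | "c (2, 3) \<noteq> 0" using c(1) by auto
  then show "\<exists>w. presents ({1, 2, 3 :: nat}, {{1, 2}, {2, 3}}) w \<mu>"
  proof cases
    case 1
    then show ?thesis using path[OF rel _ span] by blast
  next
    case 2
    have "c (1, 3) *s \<mu> (w 1) (w 3) + c (1, 2) *s \<mu> (w 1) (w 2) + (- c (2, 3)) *s \<mu> (w 3) (w 2) = 0"
      using rel skew[of "w 3" "w 2"] by (simp add: vec_eq_iff algebra_simps)
    moreover have "{w 1, w 3, w 2} = {w 1, w 2, w 3}" by blast
    ultimately show ?thesis using path 2 span by metis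
  next
    case 3
    have "(- c (1, 2)) *s \<mu> (w 2) (w 1) + c (2, 3) *s \<mu> (w 2) (w 3) + c (1, 3) *s \<mu> (w 1) (w 3) = 0"
      using rel skew[of "w 2" "w 1"] by (simp add: vec_eq_iff algebra_simps)
    moreover have "{w 2, w 1, w 3} = {w 1, w 2, w 3}" by blast
    ultimately show ?thesis using path 3 span by metis
  qed
qed

section \<open>Pencils of bivectors in dimension four\<close>

definition wedge :: "(nat \<Rightarrow> complex) \<Rightarrow> (nat \<Rightarrow> complex) \<Rightarrow> nat \<Rightarrow> nat \<Rightarrow> complex" where
  "wedge y z = (\<lambda>i j. y i * z j - y j * z i)"

text \<open>The wedge product of two bivectors on a four-dimensional space. Only the entries above the diagonal
  of the skew matrices are used.\<close>

definition bivector_pairing :: "(nat \<Rightarrow> nat \<Rightarrow> complex) \<Rightarrow> (nat \<Rightarrow> nat \<Rightarrow> complex) \<Rightarrow> complex" where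
  "bivector_pairing p q = p 1 2 * q 3 4 - p 1 3 * q 2 4 + p 1 4 * q 2 3
     + p 3 4 * q 1 2 - p 2 4 * q 1 3 + p 2 3 * q 1 4"

definition pencil :: "complex \<Rightarrow> (nat \<Rightarrow> nat \<Rightarrow> complex) \<Rightarrow> complex \<Rightarrow> (nat \<Rightarrow> nat \<Rightarrow> complex) \<Rightarrow> nat \<Rightarrow> nat \<Rightarrow> complex"
  where "pencil s p t q = (\<lambda>i j. s * p i j + t * q i j)"

definition bivector_eq :: "(nat \<Rightarrow> nat \<Rightarrow> complex) \<Rightarrow> (nat \<Rightarrow> nat \<Rightarrow> complex) \<Rightarrow> bool" where
  "bivector_eq p q \<longleftrightarrow> p 1 2 = q 1 2 \<and> p 1 3 = q 1 3 \<and> p 1 4 = q 1 4 \<and>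
     p 2 3 = q 2 3 \<and> p 2 4 = q 2 4 \<and> p 3 4 = q 3 4"

lemma bivector_pairing_cong:
  "bivector_eq p p' \<Longrightarrow> bivector_eq q q' \<Longrightarrow> bivector_pairing p q = bivector_pairing p' q'"
  by (simp add: bivector_eq_def bivector_pairing_def)

lemma bivector_pairing_pencil:
  "bivector_pairing (pencil s p t q) r = s * bivector_pairing p r + t * bivector_pairing q r"
  "bivector_pairing r (pencil s p t q) = s * bivector_pairing r p + t * bivector_pairing r q"
  by (simp_all add: bivector_pairing_def pencil_def algebra_simps)

lemma bivector_pairing_commute: "bivector_pairing p q = bivector_pairing q p"
  by (simp add: bivector_pairing_def algebra_simps)

text \<open>The Plucker relation characterizes the bivectors of rank two.\<close>

lemma decomposable_bivector:
  assumes "bivector_pairing p p = 0" "\<not> bivector_eq p (\<lambda>i j. 0)"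
  obtains y z where "bivector_eq p (wedge y z)"
proof -
  have "2 * (p 1 2 * p 3 4 - p 1 3 * p 2 4 + p 1 4 * p 2 3) = 0"
    using assms(1) unfolding bivector_pairing_def by algebra
  then have P: "p 1 2 * p 3 4 - p 1 3 * p 2 4 + p 1 4 * p 2 3 = 0"
    by (metis mult_eq_0_iff zero_neq_numeral)
  define s where "s i j = (if i < j then p i j else if j < i then - p j i else 0)" for i j :: nat
  have s: "s 1 2 = p 1 2" "s 1 3 = p 1 3" "s 1 4 = p 1 4" "s 2 3 = p 2 3" "s 2 4 = p 2 4" "s 3 4 = p 3 4"
    "s 2 1 = - p 1 2" "s 3 1 = - p 1 3" "s 4 1 = - p 1 4" "s 3 2 = - p 2 3" "s 4 2 = - p 2 4" "s 4 3 = - p 3 4"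
    "s 1 1 = 0" "s 2 2 = 0" "s 3 3 = 0" "s 4 4 = 0"
    by (simp_all add: s_def)
  let ?E = "{(1, 2), (1, 3), (1, 4), (2, 3), (2, 4), (3, 4)} :: (nat \<times> nat) set"
  \<comment> \<open>If \<open>s a b\<close> is not zero, the rows \<open>a\<close> and \<open>b\<close> of the skew matrix span its plane.\<close>
  have plucker: "\<forall>(a, b) \<in> ?E. \<forall>(i, j) \<in> ?E. s i j * s a b = s a i * s b j - s a j * s b i"
    unfolding ball_simps prod.case s using P by (simp add: algebra_simps)
  have row: "s i j = s a i / s a b * s b j - s a j / s a b * s b i"
    if "(a, b) \<in> ?E" "(i, j) \<in> ?E" "s a b \<noteq> 0" for a b i j
  proof -
    have "s i j * s a b = s a i * s b j - s a j * s b i"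
      using plucker that(1,2) by blast
    then show ?thesis using that(3) by (simp add: field_simps)
  qed
  have dec: "bivector_eq p (wedge (\<lambda>i. s a i / s a b) (s b))" if "(a, b) \<in> ?E" "s a b \<noteq> 0" for a b
    unfolding bivector_eq_def wedge_def s(1-6)[symmetric]
    by (intro conjI row[OF that(1) _ that(2)]) simp_all
  have "\<exists>a b. (a, b) \<in> ?E \<and> s a b \<noteq> 0"
  proof (rule ccontr)
    assume "\<not> ?thesis"
    then have "\<forall>(a, b) \<in> ?E. s a b = 0" by blast
    then have "bivector_eq p (\<lambda>i j. 0)"
      unfolding bivector_eq_def s(1-6)[symmetric] by simp
    then show False using assms(2) by blast
  qed
  then show thesis using dec that by blast
qed

text \<open>On the pencil spanned by \<open>p\<close> and \<open>q\<close> the Plucker form is a binary quadratic form. If its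
  discriminant is not zero it has two distinct roots, that is, the pencil contains two decomposable
  bivectors, and the planes that these represent are complementary.\<close>

lemma pencil_isotropic_basis:
  assumes "bivector_pairing p q ^ 2 \<noteq> bivector_pairing p p * bivector_pairing q q"
  obtains s t s' t' where "s * t' - t * s' \<noteq> 0"
    "bivector_pairing (pencil s p t q) (pencil s p t q) = 0"
    "bivector_pairing (pencil s' p t' q) (pencil s' p t' q) = 0"
    "bivector_pairing (pencil s p t q) (pencil s' p t' q) \<noteq> 0"
proof (cases "bivector_pairing p p = 0")
  case True
  let ?b = "bivector_pairing p q" and ?c = "bivector_pairing q q"
  have "?b \<noteq> 0" using assms True by auto
  \<comment> \<open>One root is \<open>p\<close> itself, the other one is \<open>- c p + 2 b q\<close>.\<close>
  then show thesis
    using True bivector_pairing_commute[of q p]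
    by (intro that[of 1 "2 * ?b" 0 "- ?c"]) (simp_all add: bivector_pairing_pencil algebra_simps)
next
  case False
  let ?a = "bivector_pairing p p" and ?b = "bivector_pairing p q" and ?c = "bivector_pairing q q"
  \<comment> \<open>The roots \<open>x\<close> and \<open>y\<close> of \<open>a u^2 + 2 b u + c\<close>, with \<open>u p + q\<close> in the pencil.\<close>
  obtain e where e: "e ^ 2 = ?b ^ 2 - ?a * ?c"
    using power2_csqrt by blast
  have e0: "e \<noteq> 0" using assms e by auto
  define x where "x = (- ?b + e) / ?a"
  define y where "y = (- ?b - e) / ?a"
  have x: "x * ?a = - ?b + e" and y: "y * ?a = - ?b - e"
    using False by (simp_all add: x_def y_def)
  have form: "bivector_pairing (pencil u p 1 q) (pencil v p 1 q) = u * v * ?a + (u + v) * ?b + ?c" for u v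
    using bivector_pairing_commute[of q p]
    by (simp add: bivector_pairing_pencil algebra_simps)
  have "(x - y) * ?a = 2 * e" using x y by algebra
  then have xy: "x * 1 - 1 * y \<noteq> 0" using e0 by auto
  have "(x * x * ?a + (x + x) * ?b + ?c) * ?a = 0" "(y * y * ?a + (y + y) * ?b + ?c) * ?a = 0"
    "(x * y * ?a + (x + y) * ?b + ?c) * ?a = - 2 * e ^ 2"
    using x y e by algebra+
  then have "x * x * ?a + (x + x) * ?b + ?c = 0" "y * y * ?a + (y + y) * ?b + ?c = 0"
    "x * y * ?a + (x + y) * ?b + ?c \<noteq> 0"
    using False e0 by auto
  then show thesis
    by (intro that[of x 1 1 y]) (use xy in \<open>simp_all only: form mult_1 mult_1_right not_False_eq_True\<close>)
qed

lemma pencil_decomposable_basis: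
  assumes "bivector_pairing p q ^ 2 \<noteq> bivector_pairing p p * bivector_pairing q q"
  obtains s t s' t' a b c d where "s * t' - t * s' \<noteq> 0"
    "bivector_eq (pencil s p t q) (wedge a b)" "bivector_eq (pencil s' p t' q) (wedge c d)"
    "bivector_pairing (wedge a b) (wedge c d) \<noteq> 0"
proof -
  obtain s t s' t' where st: "s * t' - t * s' \<noteq> 0"
    and i: "bivector_pairing (pencil s p t q) (pencil s p t q) = 0"
      "bivector_pairing (pencil s' p t' q) (pencil s' p t' q) = 0"
    and n: "bivector_pairing (pencil s p t q) (pencil s' p t' q) \<noteq> 0"
    by (rule pencil_isotropic_basis[OF assms])
  have nz: "\<not> bivector_eq (pencil s p t q) (\<lambda>i j. 0)" "\<not> bivector_eq (pencil s' p t' q) (\<lambda>i j. 0)"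
    using n by (auto simp: bivector_eq_def bivector_pairing_def)
  obtain a b where ab: "bivector_eq (pencil s p t q) (wedge a b)"
    by (rule decomposable_bivector[OF i(1) nz(1)])
  obtain c d where cd: "bivector_eq (pencil s' p t' q) (wedge c d)"
    by (rule decomposable_bivector[OF i(2) nz(2)])
  note e = ab cd
  have "bivector_pairing (wedge a b) (wedge c d) \<noteq> 0"
    using n bivector_pairing_cong[OF e] by simp
  then show thesis by (rule that[OF st e])
qed

text \<open>Cramer's rule in dimension four: the pairing of \<open>a \<and> b\<close> with \<open>c \<and> d\<close> is the determinant of
  the four vectors.\<close>

lemma wedge_cramer:
  assumes "bivector_pairing (wedge a b) (wedge c d) \<noteq> 0" (is "?D \<noteq> 0") "i \<in> {1, 2, 3, 4}"
  shows "z i = bivector_pairing (wedge z b) (wedge c d) / ?D * a i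
    + bivector_pairing (wedge a z) (wedge c d) / ?D * b i
    + bivector_pairing (wedge a b) (wedge z d) / ?D * c i
    + bivector_pairing (wedge a b) (wedge c z) / ?D * d i"
proof -
  have "z i * ?D = bivector_pairing (wedge z b) (wedge c d) * a i
    + bivector_pairing (wedge a z) (wedge c d) * b i
    + bivector_pairing (wedge a b) (wedge z d) * c i
    + bivector_pairing (wedge a b) (wedge c z) * d i"
  proof -
    consider "i = 1" | "i = 2" | "i = 3" | "i = 4" using assms(2) by blast
    then show ?thesis
    proof cases
      case 1
      show ?thesis unfolding 1 bivector_pairing_def wedge_def by algebra
    next
      case 2
      show ?thesis unfolding 2 bivector_pairing_def wedge_def by algebra
    next
      case 3
      show ?thesis unfolding 3 bivector_pairing_def wedge_def by algebra
    next
      case 4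
      show ?thesis unfolding 4 bivector_pairing_def wedge_def by algebra
    qed
  qed
  then show ?thesis
    using assms(1) by (simp add: divide_simps)
qed

definition combine :: "(nat \<Rightarrow> complex^'n) \<Rightarrow> (nat \<Rightarrow> complex) \<Rightarrow> complex^'n" where
  "combine x y = y 1 *s x 1 + y 2 *s x 2 + y 3 *s x 3 + y 4 *s x 4"

lemma bracket_combine:
  assumes "\<mu> \<in> nil2_brackets"
  shows "\<mu> (combine x y) (combine x z)
    = wedge y z 1 2 *s \<mu> (x 1) (x 2) + wedge y z 1 3 *s \<mu> (x 1) (x 3) + wedge y z 1 4 *s \<mu> (x 1) (x 4)
    + wedge y z 2 3 *s \<mu> (x 2) (x 3) + wedge y z 2 4 *s \<mu> (x 2) (x 4) + wedge y z 3 4 *s \<mu> (x 3) (x 4)"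
proof -
  note b = bilinear_simps[OF nil2_bracketsD(1)[OF assms]]
  note s = nil2_bracketsD(4)[OF assms]
  have s': "\<mu> (x 2) (x 1) = - \<mu> (x 1) (x 2)" "\<mu> (x 3) (x 1) = - \<mu> (x 1) (x 3)"
    "\<mu> (x 4) (x 1) = - \<mu> (x 1) (x 4)" "\<mu> (x 3) (x 2) = - \<mu> (x 2) (x 3)"
    "\<mu> (x 4) (x 2) = - \<mu> (x 2) (x 4)" "\<mu> (x 4) (x 3) = - \<mu> (x 3) (x 4)"
    by (rule s)+
  show ?thesis
    unfolding combine_def b s' nil2_bracketsD(2)[OF assms] wedge_def
    by (simp add: vec_eq_iff algebra_simps)
qed

lemma combine_spans_modulo:
  assumes "vec.span (x ` {1, 2, 3, 4} \<union> D) = UNIV"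
    and n: "bivector_pairing (wedge a b) (wedge c d) \<noteq> 0"
    and S: "combine x a \<in> S" "combine x b \<in> S" "combine x c \<in> S" "combine x d \<in> S"
  shows "vec.span (S \<union> D) = UNIV"
proof -
  have comb: "combine x z \<in> vec.span (S \<union> D)" for z
  proof -
    define \<alpha> where "\<alpha> = bivector_pairing (wedge z b) (wedge c d) / bivector_pairing (wedge a b) (wedge c d)"
    define \<beta> where "\<beta> = bivector_pairing (wedge a z) (wedge c d) / bivector_pairing (wedge a b) (wedge c d)"
    define \<gamma> where "\<gamma> = bivector_pairing (wedge a b) (wedge z d) / bivector_pairing (wedge a b) (wedge c d)"
    define \<delta> where "\<delta> = bivector_pairing (wedge a b) (wedge c z) / bivector_pairing (wedge a b) (wedge c d)"
    have z: "z i = \<alpha> * a i + \<beta> * b i + \<gamma> * c i + \<delta> * d i" if "i \<in> {1, 2, 3, 4}" for i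
      unfolding \<alpha>_def \<beta>_def \<gamma>_def \<delta>_def by (rule wedge_cramer[OF n that])
    have "combine x z = \<alpha> *s combine x a + \<beta> *s combine x b + \<gamma> *s combine x c + \<delta> *s combine x d"
      using z[of 1] z[of 2] z[of 3] z[of 4]
      by (simp add: combine_def vec_eq_iff algebra_simps)
    also have "\<dots> \<in> vec.span (S \<union> D)"
      using S by (intro vec.span_add vec.span_scale vec.span_base) auto
    finally show ?thesis .
  qed
  have "x i \<in> vec.span (S \<union> D)" if "i \<in> {1, 2, 3, 4}" for i
    using comb[of "\<lambda>j. if j = i then 1 else 0"] that by (auto simp: combine_def)
  then have "x ` {1, 2, 3, 4} \<union> D \<subseteq> vec.span (S \<union> D)"
    by (auto intro: vec.span_base)
  then show ?thesis
    using span_le assms(1) by blast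
qed

section \<open>Rigidity of two disjoint edges and of the four-cycle\<close>

lemma spans_if_no_relation:
  fixes f :: "'i \<Rightarrow> complex^'n"
  assumes "finite I" and rel: "\<And>c. (\<Sum>i\<in>I. c i *s f i) = 0 \<Longrightarrow> \<forall>i\<in>I. c i = 0"
  shows "card I \<le> CARD('n)" "card I = CARD('n) \<Longrightarrow> vec.span (f ` I) = UNIV"
proof -
  have dimU: "vec.dim (UNIV :: (complex^'n) set) = CARD('n)" by (rule vec_dim_card)
  show "card I \<le> CARD('n)"
  proof (rule ccontr)
    assume "\<not> card I \<le> CARD('n)"
    then obtain c where "\<exists>i\<in>I. c i \<noteq> 0" "(\<Sum>i\<in>I. c i *s f i) = 0"
      using family_dependent[OF assms(1) subset_UNIV, of f] dimU by (metis not_le)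
    then show False using rel by blast
  qed
  assume card: "card I = CARD('n)"
  have "v \<in> vec.span (f ` I)" for v
  proof -
    let ?I = "insert None (Some ` I)" and ?f = "case_option v f"
    have "card ?I = Suc (card I)"
      using assms(1) by (simp add: card_image)
    then have "vec.dim (UNIV :: (complex^'n) set) < card ?I"
      using card dimU by simp
    then obtain c where c: "\<exists>i\<in>?I. c i \<noteq> 0" "(\<Sum>i\<in>?I. c i *s ?f i) = 0"
      using family_dependent[of ?I ?f UNIV] assms(1) by blast
    have sum: "c None *s v + (\<Sum>i\<in>I. c (Some i) *s f i) = 0"
      using c(2) assms(1) by (simp add: sum.reindex)
    have "c None \<noteq> 0"
    proof
      assume 0: "c None = 0"
      then have "\<forall>i\<in>I. c (Some i) = 0" using sum rel[of "\<lambda>i. c (Some i)"] by simp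
      then show False using c(1) 0 by auto
    qed
    then have "v = (- 1 / c None) *s (\<Sum>i\<in>I. c (Some i) *s f i)"
      using sum by (simp add: vec_eq_iff add_eq_0_iff divide_simps mult.commute)
    also have "\<dots> \<in> vec.span (f ` I)"
      by (intro vec.span_scale vec.span_sum vec.span_base) auto
    finally show ?thesis .
  qed
  then show "vec.span (f ` I) = UNIV" by blast
qed

text \<open>The identification of alternating forms with bivectors: pairing \<open>hodge p\<close> with \<open>wedge y z\<close> evaluates
  the form \<open>p\<close> on \<open>y\<close> and \<open>z\<close>.\<close>

definition hodge :: "(nat \<Rightarrow> nat \<Rightarrow> complex) \<Rightarrow> nat \<Rightarrow> nat \<Rightarrow> complex" where
  "hodge p = (\<lambda>i j. if (i, j) = (1, 2) then p 3 4 else if (i, j) = (1, 3) then - p 2 4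
     else if (i, j) = (1, 4) then p 2 3 else if (i, j) = (2, 3) then p 1 4
     else if (i, j) = (2, 4) then - p 1 3 else p 1 2)"

lemma bivector_pairing_hodge:
  "bivector_pairing (hodge p) (hodge q) = bivector_pairing p q"
  "bivector_pairing (hodge p) q = p 1 2 * q 1 2 + p 1 3 * q 1 3 + p 1 4 * q 1 4
     + p 2 3 * q 2 3 + p 2 4 * q 2 4 + p 3 4 * q 3 4"
  by (simp_all add: bivector_pairing_def hodge_def algebra_simps)

lemma wedge_self_pairing:
  "bivector_pairing (wedge a b) (wedge a c) = 0" "bivector_pairing (wedge a b) (wedge b c) = 0"
  "bivector_pairing (wedge a b) (wedge c a) = 0" "bivector_pairing (wedge a b) (wedge c b) = 0"
  by (simp_all add: bivector_pairing_def wedge_def algebra_simps)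

text \<open>Two coordinates of \<open>M \<mu>\<close>, restricted to the span of \<open>x 1, \<dots>, x 4\<close>, form a pencil of
  alternating forms; the discriminant of its Pfaffian is a polynomial in \<open>\<mu>\<close>.\<close>

definition bracket_form ::
  "complex^'n^'n \<Rightarrow> 'n \<Rightarrow> (nat \<Rightarrow> complex^'n) \<Rightarrow> 'n::finite bracket \<Rightarrow> nat \<Rightarrow> nat \<Rightarrow> complex" where
  "bracket_form M k x \<mu> = (\<lambda>i j. (M *v \<mu> (x i) (x j)) $ k)"

definition pfaffian_discriminant ::
  "(nat \<Rightarrow> nat \<Rightarrow> complex) \<Rightarrow> (nat \<Rightarrow> nat \<Rightarrow> complex) \<Rightarrow> complex" where
  "pfaffian_discriminant p q = bivector_pairing p q ^ 2 - bivector_pairing p p * bivector_pairing q q"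

lemma polynomial_pfaffian_discriminant:
  assumes "\<And>i j. polynomial_on_bilinear (\<lambda>\<mu>. p \<mu> i j)" "\<And>i j. polynomial_on_bilinear (\<lambda>\<mu>. q \<mu> i j)"
  shows "polynomial_on_bilinear (\<lambda>\<mu>. pfaffian_discriminant (p \<mu>) (q \<mu>))"
  unfolding pfaffian_discriminant_def bivector_pairing_def power2_eq_square
  by (intro polynomial_add polynomial_diff polynomial_mult assms)

text \<open>The two decomposable bivectors in the dual pencil represent complementary planes. A vector of one
  plane commutes with a vector of the other, because both coordinates of their bracket vanish. A
  nonzero discriminant also forces \<open>x 1, \<dots>, x 4\<close> to be independent modulo the derived algebra; in
  dimension six this leaves two dimensions for the derived algebra, on which the two coordinates are
  independent.\<close>

lemma two_edges_if_discriminant: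
  fixes \<mu> :: "'n::finite bracket"
  assumes nil: "\<mu> \<in> nil2_brackets" and n6: "CARD('n) = 6"
    and disc: "pfaffian_discriminant (bracket_form M k x \<mu>) (bracket_form M l x \<mu>) \<noteq> 0"
  shows "\<exists>w. presents ({1, 2, 3, 4 :: nat}, {{1, 2}, {3, 4}}) w \<mu>"
proof -
  let ?P = "bracket_form M k x \<mu>" and ?Q = "bracket_form M l x \<mu>"
  let ?d = "vec.dim (derived \<mu>)"
  have "bivector_pairing (hodge ?P) (hodge ?Q) ^ 2
    \<noteq> bivector_pairing (hodge ?P) (hodge ?P) * bivector_pairing (hodge ?Q) (hodge ?Q)"
    using disc by (simp add: pfaffian_discriminant_def bivector_pairing_hodge(1))
  then obtain s t s' t' a b c d where st: "s * t' - t * s' \<noteq> 0"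
    and r: "bivector_eq (pencil s (hodge ?P) t (hodge ?Q)) (wedge a b)"
      "bivector_eq (pencil s' (hodge ?P) t' (hodge ?Q)) (wedge c d)"
    and n: "bivector_pairing (wedge a b) (wedge c d) \<noteq> 0"
    by (rule pencil_decomposable_basis)
  have eqv: "bivector_eq q q" for q by (simp add: bivector_eq_def)
  have form: "(M *v \<mu> (combine x y) (combine x z)) $ k = bivector_pairing (hodge ?P) (wedge y z)"
    "(M *v \<mu> (combine x y) (combine x z)) $ l = bivector_pairing (hodge ?Q) (wedge y z)" for y z
    unfolding bracket_combine[OF nil] bivector_pairing_hodge(2)
    by (simp_all add: bracket_form_def vec.add vec.scale algebra_simps)
  have ab: "bivector_pairing (wedge a b) q
      = s * bivector_pairing (hodge ?P) q + t * bivector_pairing (hodge ?Q) q"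
    and cd: "bivector_pairing (wedge c d) q
      = s' * bivector_pairing (hodge ?P) q + t' * bivector_pairing (hodge ?Q) q" for q
    using bivector_pairing_cong[OF r(1) eqv[of q]] bivector_pairing_cong[OF r(2) eqv[of q]]
    by (simp_all add: bivector_pairing_pencil)
  \<comment> \<open>Vanishing against both decomposable bivectors kills both coordinates.\<close>
  have kill: "bivector_pairing (hodge ?P) q = 0" "bivector_pairing (hodge ?Q) q = 0"
    if "bivector_pairing (wedge a b) q = 0" "bivector_pairing (wedge c d) q = 0" for q
  proof -
    have "(s * t' - t * s') * bivector_pairing (hodge ?P) q = 0"
      "(s * t' - t * s') * bivector_pairing (hodge ?Q) q = 0"
      using that ab[of q] cd[of q] by algebra+
    then show "bivector_pairing (hodge ?P) q = 0" "bivector_pairing (hodge ?Q) q = 0"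
      using st by simp_all
  qed
  have indep: "y i = 0" if y: "combine x y \<in> derived \<mu>" and i: "i \<in> {1, 2, 3, 4}" for y i
  proof -
    have "bivector_pairing (hodge ?P) (wedge y z) = 0" "bivector_pairing (hodge ?Q) (wedge y z) = 0"
      for z
      using form[of y z] derived_central(1)[OF nil y, of "combine x z"] by simp_all
    then have z: "bivector_pairing (wedge a b) (wedge y z) = 0"
      "bivector_pairing (wedge c d) (wedge y z) = 0" for z
      using ab[of "wedge y z"] cd[of "wedge y z"] by simp_all
    have "bivector_pairing (wedge y b) (wedge c d) = 0"
      using z(2)[of b] bivector_pairing_commute by metis
    moreover have "bivector_pairing (wedge a y) (wedge c d) = 0"
      using z(2)[of a] by (simp add: bivector_pairing_def wedge_def) algebra
    moreover have "bivector_pairing (wedge a b) (wedge y d) = 0"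
      using z(1)[of d] .
    moreover have "bivector_pairing (wedge a b) (wedge c y) = 0"
      using z(1)[of c] by (simp add: bivector_pairing_def wedge_def) algebra
    ultimately show "y i = 0"
      using wedge_cramer[OF n i, of y] by simp
  qed
  obtain C where C: "C \<subseteq> derived \<mu>" "vec.independent C" "derived \<mu> \<subseteq> vec.span C" "card C = ?d"
    by (rule vec.basis_exists)
  have finC: "finite C" using vec.finiteI_independent[OF C(2)] .
  let ?I = "{1, 2, 3, 4 :: nat} <+> C" and ?f = "case_sum x (\<lambda>v. v)"
  have I: "?I = Inl ` {1, 2, 3, 4} \<union> Inr ` C" by auto
  have cardI: "card ?I = 4 + ?d" using finC C(4) by (simp add: card_Plus)
  have no_rel: "\<forall>i\<in>?I. e i = 0" if e: "(\<Sum>i\<in>?I. e i *s ?f i) = 0" for e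
  proof -
    have "(\<Sum>i\<in>?I. e i *s ?f i) = combine x (e \<circ> Inl) + (\<Sum>v\<in>C. e (Inr v) *s v)"
      using finC by (simp add: sum.Plus combine_def add.assoc)
    then have s: "combine x (e \<circ> Inl) = - (\<Sum>v\<in>C. e (Inr v) *s v)"
      using e by (simp add: eq_neg_iff_add_eq_0)
    have "- (\<Sum>v\<in>C. e (Inr v) *s v) \<in> derived \<mu>"
      using C(1) by (intro vec.subspace_neg vec.subspace_sum vec.subspace_scale derived_subspace) auto
    then have "(e \<circ> Inl) i = 0" if "i \<in> {1, 2, 3, 4}" for i
      using indep that s by metis
    then have 1: "e (Inl i) = 0" if "i \<in> {1, 2, 3, 4}" for i using that by simp
    then have "combine x (e \<circ> Inl) = 0" by (simp add: combine_def)
    then have "(\<Sum>v\<in>C. e (Inr v) *s v) = 0" using s by simp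
    then have "\<forall>v\<in>C. e (Inr v) = 0"
      using vec.independentD[OF C(2) finC subset_refl, of "\<lambda>v. e (Inr v)"] by blast
    then show ?thesis using 1 unfolding I by blast
  qed
  have finI: "finite ?I" using finC by simp
  note sp = spans_if_no_relation[of ?I ?f, OF finI no_rel]
  have d2: "?d \<le> 2" using sp(1) cardI n6 by simp
  \<comment> \<open>If both coordinates vanished somewhere on the derived algebra, or if it were a line, then the
    two forms would be proportional and the discriminant zero.\<close>
  have degenerate: "False" if z: "derived \<mu> \<subseteq> vec.span {z, u}" "(M *v z) $ k = 0" "(M *v z) $ l = 0"
    for z u
  proof -
    have "\<exists>\<tau>. \<forall>i j. \<exists>\<sigma>. \<mu> (x i) (x j) = \<sigma> *s z + \<tau> i j *s u"
    proof -
      have "\<exists>\<sigma> \<tau>. \<mu> (x i) (x j) = \<sigma> *s z + \<tau> *s u" for i j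
      proof -
        have "\<mu> (x i) (x j) \<in> vec.span {z, u}"
          using z(1) bracket_in_derived by blast
        then obtain \<sigma> where "\<mu> (x i) (x j) - \<sigma> *s z \<in> vec.span {u}"
          unfolding vec.span_insert by blast
        then obtain \<tau> where "\<mu> (x i) (x j) - \<sigma> *s z = \<tau> *s u"
          by (auto simp: vec.span_singleton)
        then show ?thesis by (metis add.commute diff_add_cancel)
      qed
      then show ?thesis by metis
    qed
    then obtain \<tau> \<sigma> where \<tau>: "\<And>i j. \<mu> (x i) (x j) = \<sigma> i j *s z + \<tau> i j *s u" by metis
    have "?P = (\<lambda>i j. (M *v u) $ k * \<tau> i j)" "?Q = (\<lambda>i j. (M *v u) $ l * \<tau> i j)"
      using z(2,3) by (simp_all add: bracket_form_def \<tau> vec.add vec.scale fun_eq_iff)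
    then have "bivector_pairing ?P ?P = (M *v u) $ k * (M *v u) $ k * bivector_pairing \<tau> \<tau>"
      "bivector_pairing ?P ?Q = (M *v u) $ k * (M *v u) $ l * bivector_pairing \<tau> \<tau>"
      "bivector_pairing ?Q ?Q = (M *v u) $ l * (M *v u) $ l * bivector_pairing \<tau> \<tau>"
      by (simp_all add: bivector_pairing_def algebra_simps)
    then show False
      using disc by (simp add: pfaffian_discriminant_def power2_eq_square)
  qed
  have "?d = 2"
  proof (rule ccontr)
    assume "?d \<noteq> 2"
    then have "card C \<le> 1" using d2 C(4) by simp
    then obtain u where "C \<subseteq> {u}"
      using finC by (metis card_le_Suc0_iff_eq One_nat_def empty_subsetI insert_subset subsetI singletonI equals0I)
    then have "derived \<mu> \<subseteq> vec.span {0, u}"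
      using C(3) vec.span_mono[of C "{0, u}"] by blast
    then show False using degenerate[of 0 u] by simp
  qed
  then have span: "vec.span (?f ` ?I) = UNIV" using sp(2) cardI n6 by simp
  have "?f ` ?I = x ` {1, 2, 3, 4} \<union> C" unfolding I by (simp add: image_Un image_image)
  then have "vec.span (x ` {1, 2, 3, 4} \<union> C) = UNIV" using span by simp
  then have spanD: "vec.span (x ` {1, 2, 3, 4} \<union> derived \<mu>) = UNIV"
    using vec.span_mono[of "x ` {1, 2, 3, 4} \<union> C" "x ` {1, 2, 3, 4} \<union> derived \<mu>"] C(1) by blast
  have separate: "z = 0" if z: "z \<in> derived \<mu>" "(M *v z) $ k = 0" "(M *v z) $ l = 0" for z
  proof (rule ccontr)
    assume "z \<noteq> 0"
    then have ind: "vec.independent {z}" by simp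
    obtain E where E: "{z} \<subseteq> E" "E \<subseteq> derived \<mu>" "vec.independent E" "derived \<mu> \<subseteq> vec.span E"
      by (rule vec.maximal_independent_subset_extend[of "{z}" "derived \<mu>"]) (use z(1) ind in auto)
    have "card E = 2" using vec.basis_card_eq_dim[OF E(2,4,3)] \<open>?d = 2\<close> by simp
    then obtain u where "E = {z, u}" using E(1) by (auto simp: card_2_iff)
    then show False using degenerate[of z u] E(4) z by simp
  qed
  have cross: "\<mu> (combine x y) (combine x z) = 0" if "y \<in> {a, b}" "z \<in> {c, d}" for y z
  proof (rule separate[OF bracket_in_derived])
    have "bivector_pairing (wedge a b) (wedge y z) = 0" "bivector_pairing (wedge c d) (wedge y z) = 0"
      using that by (auto simp: wedge_self_pairing)
    then show "(M *v \<mu> (combine x y) (combine x z)) $ k = 0"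
      "(M *v \<mu> (combine x y) (combine x z)) $ l = 0"
      unfolding form by (rule kill)+
  qed
  have cross': "\<mu> (combine x z) (combine x y) = 0" if "y \<in> {a, b}" "z \<in> {c, d}" for y z
    using cross[OF that] nil2_bracketsD(4)[OF nil, of "combine x z" "combine x y"] by simp
  define w where "w i = combine x (if i = 1 then a else if i = 2 then b else if i = 3 then c else d)"
    for i :: nat
  have "vec.span (w ` {1, 2, 3, 4} \<union> derived \<mu>) = UNIV"
    by (rule combine_spans_modulo[OF spanD n]) (auto simp: w_def)
  then have "presents ({1, 2, 3, 4 :: nat}, {{1, 2}, {3, 4}}) w \<mu>"
    by (rule presents_if_spans_modulo_derived[OF nil])
      (auto simp: w_def cross cross' nil2_bracketsD(2)[OF nil])
  then show ?thesis by (rule exI[of _ w])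
qed


lemma two_disjoint_edges_open:
  assumes n6: "CARD('n::finite) = 6"
  shows "zariski_open_in nil2_brackets
    (presented_brackets ({1, 2, 3, 4 :: nat}, {{1, 2}, {3, 4}}) :: 'n bracket set)"
proof -
  let ?G = "({1, 2, 3, 4 :: nat}, {{1, 2}, {3, 4}}) :: nat graph"
  have G: "finite_simple_graph ?G" "CARD('n) = card (fst ?G) + card (snd ?G)"
    using n6 by (simp_all add: finite_simple_graph_def all_edgesI doubleton_eq_iff)
  define F where "F = (\<lambda>(M, k, l, x) (\<mu> :: 'n bracket).
    pfaffian_discriminant (bracket_form M k x \<mu>) (bracket_form M l x \<mu>))"
  have form: "polynomial_on_bilinear (\<lambda>\<mu> :: 'n bracket. bracket_form M k x \<mu> i j)" for M k x i j
    unfolding bracket_form_def matrix_vector_mult_def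
    by (simp, intro polynomial_sum polynomial_mult polynomial_const polynomial_coordinate)
  have poly: "polynomial_on_bilinear (F a)" for a
    unfolding F_def by (cases a) (simp, intro polynomial_pfaffian_discriminant form)
  have "(\<exists>a. F a \<mu> \<noteq> 0) \<longleftrightarrow> (\<exists>w. presents ?G w \<mu>)" if nil: "\<mu> \<in> nil2_brackets" for \<mu> :: "'n bracket"
  proof
    assume "\<exists>a. F a \<mu> \<noteq> 0"
    then obtain M k l x where "F (M, k, l, x) \<mu> \<noteq> 0" by (metis prod.collapse)
    then show "\<exists>w. presents ?G w \<mu>"
      unfolding F_def by (intro two_edges_if_discriminant[OF nil n6, of M k x l]) simp
  next
    assume "\<exists>w. presents ?G w \<mu>"
    then obtain w where w: "presents ?G w \<mu>" by (rule exE)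
    note B = frame_basis[OF nil w G]
    obtain k l :: 'n where kl: "k \<noteq> l"
      using n6 card_le_Suc0_iff_eq[of "UNIV :: 'n set"] by auto
    define f where "f i = (if i = Inr {1, 2} then axis k 1 else axis l (1 :: complex))"
      for i :: "nat + nat set"
    obtain g where g: "Vector_Spaces.linear (*s) (*s) g"
      "\<And>i. i \<in> fst ?G <+> snd ?G \<Longrightarrow> g (frame w \<mu> i) = f i"
      by (rule family_linear_extension[OF B(1,4,5), of f], rule that, assumption, simp)
    interpret g: Vector_Spaces.linear "(*s)" "(*s)" g by fact
    have fr: "frame w \<mu> (Inr {i, j}) = \<mu> (w i) (w j) \<or> frame w \<mu> (Inr {i, j}) = - \<mu> (w i) (w j)" for i j
      using edge_ends_cases[of i j] nil2_bracketsD(4)[OF nil, of "w i" "w j"] by auto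
    have "Inr {1, 2} \<in> fst ?G <+> snd ?G" "Inr {3, 4} \<in> fst ?G <+> snd ?G" by auto
    then have gf: "g (frame w \<mu> (Inr {1, 2})) = axis k 1" "g (frame w \<mu> (Inr {3, 4})) = axis l 1"
      by (simp_all add: g(2) f_def doubleton_eq_iff del: frame.simps)
    have e12: "g (\<mu> (w 1) (w 2)) = axis k 1 \<or> g (\<mu> (w 1) (w 2)) = - axis k 1"
      using gf(1) fr[of 1 2] g.neg[of "\<mu> (w 1) (w 2)"] by (metis minus_minus)
    have e34: "g (\<mu> (w 3) (w 4)) = axis l 1 \<or> g (\<mu> (w 3) (w 4)) = - axis l 1"
      using gf(2) fr[of 3 4] g.neg[of "\<mu> (w 3) (w 4)"] by (metis minus_minus)
    have zero: "\<mu> (w i) (w j) = 0" if "(i, j) \<in> {(1, 3), (1, 4), (2, 3), (2, 4)}" for i j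
      using w that by (auto simp: presents_def doubleton_eq_iff)
    have P: "bracket_form (matrix g) m w \<mu> i j = g (\<mu> (w i) (w j)) $ m" for m i j
      by (simp add: bracket_form_def matrix_works[OF g(1)])
    have "F (matrix g, k, l, w) \<mu> \<noteq> 0"
      using e12 e34 kl
      by (auto simp: F_def pfaffian_discriminant_def bivector_pairing_def P zero g.zero axis_def)
    then show "\<exists>a. F a \<mu> \<noteq> 0" by blast
  qed
  then have "presented_brackets ?G = {\<mu> :: 'n bracket. \<mu> \<in> nil2_brackets \<and> (\<exists>a. F a \<mu> \<noteq> 0)}"
    unfolding presented_brackets_def by blast
  then show ?thesis
    using zariski_open_nonvanishing[of F, OF poly] by simp
qed

lemma det_replace_row:
  fixes A :: "complex^'n^'n"
  assumes "z = (\<Sum>i\<in>UNIV. \<alpha> i *s A $ i)"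
  shows "det (\<chi> i. if i = k then z else A $ i) = \<alpha> k * det A"
proof -
  have row: "row i A = A $ i" for i by (simp add: row_def vec_eq_iff)
  show ?thesis
    using cramer_lemma_transpose[of k "\<chi> i. \<alpha> i" A] unfolding row vec_lambda_beta assms[symmetric] .
qed

text \<open>For vectors \<open>x 1, \<dots>, x 4\<close> the rows are these vectors and their brackets along the edges of the
  four-cycle; \<open>s\<close> numbers the rows.\<close>

definition cycle_rows :: "(nat \<Rightarrow> complex^'n) \<Rightarrow> 'n::finite bracket \<Rightarrow> nat \<Rightarrow> complex^'n" where
  "cycle_rows x \<mu> r = (if r \<le> 4 then x r else if r = 5 then \<mu> (x 1) (x 2) else if r = 6 then \<mu> (x 2) (x 3)
     else if r = 7 then \<mu> (x 3) (x 4) else \<mu> (x 1) (x 4))"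

definition cycle_det :: "('n \<Rightarrow> nat) \<Rightarrow> (nat \<Rightarrow> complex^'n) \<Rightarrow> 'n::finite bracket \<Rightarrow> complex" where
  "cycle_det s x \<mu> = det (\<chi> i. cycle_rows x \<mu> (s i))"

definition cycle_minor :: "('n \<Rightarrow> nat) \<Rightarrow> (nat \<Rightarrow> complex^'n) \<Rightarrow> 'n::finite bracket \<Rightarrow> nat \<Rightarrow> nat \<Rightarrow> nat \<Rightarrow> complex" where
  "cycle_minor s x \<mu> a b r = det (\<chi> i. if s i = r then \<mu> (x a) (x b) else cycle_rows x \<mu> (s i))"

text \<open>By Cramer's rule these two bivectors, for \<open>(a, b)\<close> the diagonals \<open>(1, 3)\<close> and \<open>(2, 4)\<close>, span
  the kernel of the bracket when the derived algebra is spanned by the brackets along the cycle.\<close>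

definition cycle_relation :: "('n \<Rightarrow> nat) \<Rightarrow> (nat \<Rightarrow> complex^'n) \<Rightarrow> 'n::finite bracket \<Rightarrow> nat \<Rightarrow> nat \<Rightarrow> nat \<Rightarrow> nat \<Rightarrow> complex" where
  "cycle_relation s x \<mu> a b = (\<lambda>i j. if (i, j) = (a, b) then cycle_det s x \<mu>
     else if (i, j) = (1, 2) then - cycle_minor s x \<mu> a b 5 else if (i, j) = (2, 3) then - cycle_minor s x \<mu> a b 6
     else if (i, j) = (3, 4) then - cycle_minor s x \<mu> a b 7 else if (i, j) = (1, 4) then - cycle_minor s x \<mu> a b 8
     else 0)"

text \<open>A nonzero determinant makes the derived algebra at least four-dimensional, which in dimension eight
  is the largest possible. Then the kernel of the bracket on bivectors of a complement is
  spanned by the two relations. Its decomposable elements are pairs of commuting vectors, which are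
  the diagonals of the cycle.\<close>

lemma four_cycle_if_discriminant:
  fixes \<mu> :: "'n::finite bracket"
  assumes nil: "\<mu> \<in> nil2_brackets" and n8: "CARD('n) = 8" and s: "bij_betw s (UNIV :: 'n set) {1..8}"
    and det: "cycle_det s x \<mu> \<noteq> 0"
    and disc: "pfaffian_discriminant (cycle_relation s x \<mu> 1 3) (cycle_relation s x \<mu> 2 4) \<noteq> 0"
  shows "\<exists>w. presents ({1, 2, 3, 4 :: nat}, {{1, 2}, {2, 3}, {3, 4}, {4, 1}}) w \<mu>"
proof -
  let ?R = "cycle_rows x \<mu>" and ?d = "vec.dim (derived \<mu>)"
  let ?A = "\<chi> i. ?R (s i)"
  have "range (\<lambda>i. ?A $ i) = ?R ` {1..8}"
    using s by (simp add: bij_betw_def image_image[of ?R s UNIV, symmetric])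
  then have span: "vec.span (?R ` {1..8}) = UNIV"
    using det det_nonzero_iff_rows_span[of ?A] by (simp add: cycle_det_def)
  note sf = spanning_family[OF _ _ span]
  have inj: "inj_on ?R {1..8}" and ind: "vec.independent (?R ` {1..8})"
    using sf n8 by simp_all
  have inD: "?R ` {5..8} \<subseteq> derived \<mu>"
    by (auto simp: cycle_rows_def bracket_in_derived)
  have ind': "vec.independent (?R ` {5..8})"
    using ind by (rule vec.independent_mono) auto
  have card': "card (?R ` {5..8}) = 4"
    using inj_on_subset[OF inj, of "{5..8}"] by (simp add: card_image)
  have "4 \<le> ?d" using vec.independent_card_le_dim[OF inD ind'] card' by simp
  moreover have "?d \<le> 8" using dim_subset_UNIV_cart_gen[of "derived \<mu>"] n8 by simp
  moreover have "?d \<le> (8 - ?d) choose 2"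
    using dim_derived_le_choose[OF nil] n8 by simp
  ultimately have d: "?d = 4"
    by (cases "?d = 5"; cases "?d = 6"; cases "?d = 7"; cases "?d = 8") (auto simp: numeral_eq_Suc)
  have D: "derived \<mu> \<subseteq> vec.span (?R ` {5..8})"
    by (rule vec.card_ge_dim_independent[OF inD ind']) (simp add: card' d)
  have "{1..8} = {1, 2, 3, 4} \<union> {5..8 :: nat}" by auto
  moreover have "?R ` {1, 2, 3, 4} = x ` {1, 2, 3, 4}" by (simp add: cycle_rows_def)
  ultimately have "?R ` {1..8} \<subseteq> x ` {1, 2, 3, 4} \<union> derived \<mu>"
    using inD by (metis Un_mono image_Un subset_refl)
  then have spanD: "vec.span (x ` {1, 2, 3, 4} \<union> derived \<mu>) = UNIV"
    using span vec.span_mono by blast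
  have relation: "cycle_det s x \<mu> *s \<mu> (x a) (x b) = cycle_minor s x \<mu> a b 5 *s \<mu> (x 1) (x 2)
      + cycle_minor s x \<mu> a b 6 *s \<mu> (x 2) (x 3) + cycle_minor s x \<mu> a b 7 *s \<mu> (x 3) (x 4)
      + cycle_minor s x \<mu> a b 8 *s \<mu> (x 1) (x 4)" for a b
  proof -
    have "\<mu> (x a) (x b) \<in> vec.span (?R ` {5..8})"
      using D bracket_in_derived by blast
    then obtain u where "\<mu> (x a) (x b) = (\<Sum>v\<in>?R ` {5..8}. u v *s v)"
      unfolding vec.span_finite[OF finite_imageI[OF finite_atLeastAtMost]] by blast
    then have u: "\<mu> (x a) (x b) = (\<Sum>r\<in>{5..8}. u (?R r) *s ?R r)"
      using inj_on_subset[OF inj, of "{5..8}"] by (simp add: sum.reindex)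
    define \<beta> where "\<beta> r = (if r \<in> {5..8} then u (?R r) else 0)" for r
    have "\<mu> (x a) (x b) = (\<Sum>r\<in>{1..8}. \<beta> r *s ?R r)"
      unfolding u by (rule sum.mono_neutral_cong_left) (auto simp: \<beta>_def)
    also have "\<dots> = (\<Sum>i\<in>UNIV. \<beta> (s i) *s ?R (s i))"
      by (rule sum.reindex_bij_betw[OF s, symmetric])
    finally have z: "\<mu> (x a) (x b) = (\<Sum>i\<in>UNIV. \<beta> (s i) *s ?A $ i)" by simp
    have minor: "cycle_minor s x \<mu> a b r = \<beta> r * cycle_det s x \<mu>" if "r \<in> {1..8}" for r
    proof -
      have "r \<in> range s" using s that by (simp add: bij_betw_def)
      then obtain k where k: "s k = r" by blast
      have "s i = r \<longleftrightarrow> i = k" for i using s k by (auto simp: bij_betw_def dest: injD)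
      then show ?thesis
        using det_replace_row[OF z, of k] k
        by (simp add: cycle_minor_def cycle_det_def cong del: if_weak_cong)
    qed
    have set: "{5..8 :: nat} = {5, 6, 7, 8}" by auto
    have "\<mu> (x a) (x b) = \<beta> 5 *s ?R 5 + \<beta> 6 *s ?R 6 + \<beta> 7 *s ?R 7 + \<beta> 8 *s ?R 8"
      unfolding u set by (simp add: \<beta>_def add.assoc)
    then show ?thesis
      by (simp add: minor cycle_rows_def vec_eq_iff algebra_simps)
  qed
  let ?p = "cycle_relation s x \<mu> 1 3" and ?q = "cycle_relation s x \<mu> 2 4"
  obtain \<sigma> \<tau> \<sigma>' \<tau>' a b c e where r: "bivector_eq (pencil \<sigma> ?p \<tau> ?q) (wedge a b)"
      "bivector_eq (pencil \<sigma>' ?p \<tau>' ?q) (wedge c e)"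
    and n: "bivector_pairing (wedge a b) (wedge c e) \<noteq> 0"
    by (rule pencil_decomposable_basis[of ?p ?q]) (use disc in \<open>auto simp: pfaffian_discriminant_def\<close>)
  have van: "\<mu> (combine x y) (combine x z) = 0" if "bivector_eq (pencil \<sigma> ?p \<tau> ?q) (wedge y z)"
    for \<sigma> \<tau> y z
  proof -
    have w: "wedge y z 1 2 = pencil \<sigma> ?p \<tau> ?q 1 2" "wedge y z 1 3 = pencil \<sigma> ?p \<tau> ?q 1 3"
      "wedge y z 1 4 = pencil \<sigma> ?p \<tau> ?q 1 4" "wedge y z 2 3 = pencil \<sigma> ?p \<tau> ?q 2 3"
      "wedge y z 2 4 = pencil \<sigma> ?p \<tau> ?q 2 4" "wedge y z 3 4 = pencil \<sigma> ?p \<tau> ?q 3 4"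
      using that unfolding bivector_eq_def by simp_all
    have "\<mu> (combine x y) (combine x z)
      = \<sigma> *s (cycle_det s x \<mu> *s \<mu> (x 1) (x 3)
          - (cycle_minor s x \<mu> 1 3 5 *s \<mu> (x 1) (x 2) + cycle_minor s x \<mu> 1 3 6 *s \<mu> (x 2) (x 3)
            + cycle_minor s x \<mu> 1 3 7 *s \<mu> (x 3) (x 4) + cycle_minor s x \<mu> 1 3 8 *s \<mu> (x 1) (x 4)))
      + \<tau> *s (cycle_det s x \<mu> *s \<mu> (x 2) (x 4)
          - (cycle_minor s x \<mu> 2 4 5 *s \<mu> (x 1) (x 2) + cycle_minor s x \<mu> 2 4 6 *s \<mu> (x 2) (x 3)
            + cycle_minor s x \<mu> 2 4 7 *s \<mu> (x 3) (x 4) + cycle_minor s x \<mu> 2 4 8 *s \<mu> (x 1) (x 4)))"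
      unfolding bracket_combine[OF nil] w
      by (simp add: pencil_def cycle_relation_def vec_eq_iff algebra_simps)
    then show ?thesis
      by (simp only: relation[of 1 3] relation[of 2 4] diff_self vec.scale_zero_right add_0_right)
  qed
  have ab: "\<mu> (combine x a) (combine x b) = 0" "\<mu> (combine x c) (combine x e) = 0"
    using van[OF r(1)] van[OF r(2)] by simp_all
  then have ba: "\<mu> (combine x b) (combine x a) = 0" "\<mu> (combine x e) (combine x c) = 0"
    using nil2_bracketsD(4)[OF nil, of "combine x b" "combine x a"]
      nil2_bracketsD(4)[OF nil, of "combine x e" "combine x c"] by simp_all
  define w where "w i = combine x (if i = 1 then a else if i = 3 then b else if i = 2 then c else e)"
    for i :: nat
  have "vec.span (w ` {1, 2, 3, 4} \<union> derived \<mu>) = UNIV"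
    by (rule combine_spans_modulo[OF spanD n]) (auto simp: w_def)
  then have "presents ({1, 2, 3, 4 :: nat}, {{1, 2}, {2, 3}, {3, 4}, {4, 1}}) w \<mu>"
    by (rule presents_if_spans_modulo_derived[OF nil])
      (auto simp: w_def ab ba nil2_bracketsD(2)[OF nil] doubleton_eq_iff)
  then show ?thesis by (rule exI[of _ w])
qed

lemma four_cycle_open:
  assumes n8: "CARD('n::finite) = 8"
  shows "zariski_open_in nil2_brackets
    (presented_brackets ({1, 2, 3, 4 :: nat}, {{1, 2}, {2, 3}, {3, 4}, {4, 1}}) :: 'n bracket set)"
proof -
  let ?G = "({1, 2, 3, 4 :: nat}, {{1, 2}, {2, 3}, {3, 4}, {4, 1}}) :: nat graph"
  obtain s where s: "bij_betw s (UNIV :: 'n set) {1..8 :: nat}"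
    using finite_same_card_bij[of "UNIV :: 'n set" "{1..8 :: nat}"] n8 by auto
  define F where "F x \<mu> = cycle_det s x \<mu>
    * pfaffian_discriminant (cycle_relation s x \<mu> 1 3) (cycle_relation s x \<mu> 2 4)"
    for x and \<mu> :: "'n bracket"
  have rows: "polynomial_on_bilinear (\<lambda>\<mu>. cycle_rows x \<mu> r $ j)" for x :: "nat \<Rightarrow> complex^'n" and r j
    by (cases "r \<le> 4"; cases "r = 5"; cases "r = 6"; cases "r = 7")
      (simp_all add: cycle_rows_def polynomial_coordinate)
  have det: "polynomial_on_bilinear (\<lambda>\<mu>. cycle_det s x \<mu>)" for x
    unfolding cycle_det_def by (intro polynomial_det) (simp add: rows)
  have minor: "polynomial_on_bilinear (\<lambda>\<mu>. cycle_minor s x \<mu> a b r)" for x a b r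
    unfolding cycle_minor_def
  proof (intro polynomial_det)
    fix i j
    show "polynomial_on_bilinear
      (\<lambda>\<mu>. (\<chi> i. if s i = r then \<mu> (x a) (x b) else cycle_rows x \<mu> (s i)) $ i $ j)"
      by (cases "s i = r") (simp_all add: rows polynomial_coordinate)
  qed
  have relation: "polynomial_on_bilinear (\<lambda>\<mu>. cycle_relation s x \<mu> a b i j)" for x a b i j
  proof -
    have cond: "polynomial_on_bilinear (\<lambda>\<mu>. if c then p \<mu> else q \<mu>)"
      if "polynomial_on_bilinear p" "polynomial_on_bilinear q"
      for c and p q :: "'n bracket \<Rightarrow> complex" using that by (cases c) simp_all
    show ?thesis
      unfolding cycle_relation_def by (intro cond polynomial_uminus det minor polynomial_const)
  qed
  have poly: "polynomial_on_bilinear (F x)" for x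
    unfolding F_def by (intro polynomial_mult det polynomial_pfaffian_discriminant relation)
  have "(\<exists>x. F x \<mu> \<noteq> 0) \<longleftrightarrow> (\<exists>w. presents ?G w \<mu>)" if nil: "\<mu> \<in> nil2_brackets" for \<mu> :: "'n bracket"
  proof
    assume "\<exists>x. F x \<mu> \<noteq> 0"
    then obtain x where "F x \<mu> \<noteq> 0" by (rule exE)
    then show "\<exists>w. presents ?G w \<mu>"
      unfolding F_def by (intro four_cycle_if_discriminant[OF nil n8 s, of x]) simp_all
  next
    assume "\<exists>w. presents ?G w \<mu>"
    then obtain w where w: "presents ?G w \<mu>" by (rule exE)
    have diag: "\<mu> (w 1) (w 3) = 0" "\<mu> (w 2) (w 4) = 0"
      using w by (auto simp: presents_def doubleton_eq_iff)
    let ?R = "cycle_rows w \<mu>"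
    have ran: "range (\<lambda>i. (\<chi> i. ?R (s i)) $ i) = ?R ` {1..8}"
      using s by (simp add: bij_betw_def image_image[of ?R s UNIV, symmetric])
    have "w ` fst ?G \<union> {\<mu> (w x) (w y) | x y. {x, y} \<in> snd ?G} \<subseteq> vec.span (?R ` {1..8})"
    proof -
      have R: "?R r \<in> vec.span (?R ` {1..8})" if "r \<in> {1..8}" for r
        using that by (intro vec.span_base) blast
      have m: "w 1 \<in> vec.span (?R ` {1..8})" "w 2 \<in> vec.span (?R ` {1..8})"
        "w 3 \<in> vec.span (?R ` {1..8})" "w 4 \<in> vec.span (?R ` {1..8})"
        "\<mu> (w 1) (w 2) \<in> vec.span (?R ` {1..8})" "\<mu> (w 2) (w 3) \<in> vec.span (?R ` {1..8})"
        "\<mu> (w 3) (w 4) \<in> vec.span (?R ` {1..8})" "\<mu> (w 1) (w 4) \<in> vec.span (?R ` {1..8})"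
        using R[of 1] R[of 2] R[of 3] R[of 4] R[of 5] R[of 6] R[of 7] R[of 8]
        by (simp_all add: cycle_rows_def)
      have m': "\<mu> (w 2) (w 1) \<in> vec.span (?R ` {1..8})" "\<mu> (w 3) (w 2) \<in> vec.span (?R ` {1..8})"
        "\<mu> (w 4) (w 3) \<in> vec.span (?R ` {1..8})" "\<mu> (w 4) (w 1) \<in> vec.span (?R ` {1..8})"
        using m(5-8) nil2_bracketsD(4)[OF nil] vec.span_neg by metis+
      show ?thesis using m m' by (auto simp: doubleton_eq_iff)
    qed
    then have "vec.span (?R ` {1..8}) = UNIV"
      using span_le[of "w ` fst ?G \<union> {\<mu> (w x) (w y) | x y. {x, y} \<in> snd ?G}" "?R ` {1..8}"] w
      by (simp only: presents_def top.extremum_unique)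
    then have D: "cycle_det s w \<mu> \<noteq> 0"
      unfolding cycle_det_def det_nonzero_iff_rows_span ran .
    have minor0: "cycle_minor s w \<mu> a b r = 0" if "\<mu> (w a) (w b) = 0" "r \<in> {1..8}" for a b r
    proof -
      have "r \<in> range s" using s that(2) by (simp add: bij_betw_def)
      then obtain k where "s k = r" by blast
      then have "row k (\<chi> i. if s i = r then \<mu> (w a) (w b) else ?R (s i)) = 0"
        using that(1) by (simp add: row_def vec_eq_iff)
      then show ?thesis unfolding cycle_minor_def by (rule det_zero_row)
    qed
    have "F w \<mu> = cycle_det s w \<mu> ^ 5"
      by (simp add: F_def pfaffian_discriminant_def bivector_pairing_def cycle_relation_def
          minor0[OF diag(1)] minor0[OF diag(2)] minor0[OF diag(1)[simplified]] power_numeral_reduce)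
    then show "\<exists>x. F x \<mu> \<noteq> 0" using D by (metis power_eq_0_iff)
  qed
  then have "presented_brackets ?G = {\<mu> :: 'n bracket. \<mu> \<in> nil2_brackets \<and> (\<exists>x. F x \<mu> \<noteq> 0)}"
    unfolding presented_brackets_def by blast
  then show ?thesis
    using zariski_open_nonvanishing[of F, OF poly] by simp
qed

section \<open>Deformations inside the graph's own coordinates\<close>

definition graph_tensor ::
  "'v graph \<Rightarrow> (nat \<Rightarrow> 'v) \<Rightarrow> ('n \<Rightarrow> 'v + 'v set) \<Rightarrow> 'n \<Rightarrow> 'n \<Rightarrow> 'n \<Rightarrow> complex" where
  "graph_tensor G v s i j k = basis_bracket G v (s i) (s j) (s k)"

definition vertex_indices :: "('n \<Rightarrow> 'v + 'v set) \<Rightarrow> 'n set" where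
  "vertex_indices s = {i. \<exists>x. s i = Inl x}"

lemma index_memD:
  assumes "bij_betw s UNIV (V <+> A)"
  shows "s i = Inl x \<Longrightarrow> x \<in> V" "s i = Inr e \<Longrightarrow> e \<in> A"
proof -
  have "s i \<in> V <+> A" using assms by (auto simp: bij_betw_def)
  then show "s i = Inl x \<Longrightarrow> x \<in> V" "s i = Inr e \<Longrightarrow> e \<in> A" by auto
qed

lemma graph_tensor_support:
  assumes "graph_tensor G v s i j k \<noteq> 0"
  obtains x y where "s i = Inl x" "s j = Inl y" "{x, y} \<in> snd G" "s k = Inr {x, y}"
  using assms unfolding graph_tensor_def
  by (cases "(G, v, s i, s j, s k)" rule: basis_bracket.cases) (auto split: if_splits)

lemma graph_tensor_skew:
  assumes "bij_betw v {1..card (fst G)} (fst G)"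
  shows "graph_tensor G v s j i k = - graph_tensor G v s i j k"
  unfolding graph_tensor_def by (rule basis_bracket_skew[OF assms])

lemma graph_tensor_alternating:
  assumes "bij_betw v {1..card (fst G)} (fst G)"
  shows "alternating_tensor (vertex_indices s) (graph_tensor G v s)"
  unfolding alternating_tensor_def
proof (intro conjI allI impI)
  show "graph_tensor G v s j i k = - graph_tensor G v s i j k" for i j k
    by (rule graph_tensor_skew[OF assms])
  fix i j k assume "graph_tensor G v s i j k \<noteq> 0"
  then obtain x y where "s i = Inl x" "s j = Inl y" "s k = Inr {x, y}"
    by (rule graph_tensor_support)
  then show "i \<in> vertex_indices s" "j \<in> vertex_indices s" "k \<notin> vertex_indices s"
    by (auto simp: vertex_indices_def)
qed

lemma edge_axis_is_bracket:
  assumes "finite_simple_graph G" "bij_betw v {1..card (fst G)} (fst G)"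
    and s: "bij_betw s (UNIV :: 'n::finite set) (fst G <+> snd G)" and "s k = Inr e"
  obtains x y i j where "e = {x, y}" "s i = Inl x" "s j = Inl y" "x \<in> fst G" "y \<in> fst G"
    "(\<chi> l. graph_tensor G v s i j l) = axis k 1"
proof -
  have e: "e \<in> snd G" by (rule index_memD(2)[OF s assms(4)])
  then obtain x y where xy: "e = {x, y}" "x \<in> fst G" "y \<in> fst G" "x \<noteq> y"
    using finite_simple_graphD(4)[OF assms(1) e] by blast
  obtain x' y' where xy': "e = {x', y'}" "x' \<in> fst G" "y' \<in> fst G" "precedes G v x' y'"
    using precedes_total[OF assms(2) xy(2-4)] xy by (metis insert_commute)
  have "Inl x' \<in> range s" "Inl y' \<in> range s"
    using s xy' by (auto simp: bij_betw_def)
  then obtain i j where ij: "s i = Inl x'" "s j = Inl y'" by (metis imageE)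
  have "s l = s k \<longleftrightarrow> l = k" for l
    using s by (auto simp: bij_betw_def dest: injD)
  then have "(\<chi> l. graph_tensor G v s i j l) = axis k 1"
    using xy' e assms(4) by (auto simp: graph_tensor_def ij vec_eq_iff axis_def)
  then show thesis using that xy' ij by blast
qed

lemma graph_tensor_presented:
  assumes "finite_simple_graph G" "bij_betw v {1..card (fst G)} (fst G)"
    and s: "bij_betw s (UNIV :: 'n::finite set) (fst G <+> snd G)"
  shows "presents G (\<lambda>x. axis (inv s (Inl x)) 1) (tensor_bracket (graph_tensor G v s))"
proof -
  let ?w = "\<lambda>x. axis (inv s (Inl x)) (1 :: complex)" and ?\<mu> = "tensor_bracket (graph_tensor G v s)"
  have inv: "s (inv s (Inl x)) = Inl x" if "x \<in> fst G" for x
    by (rule f_inv_into_f) (use s that in \<open>auto simp: bij_betw_def\<close>)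
  have inv': "inv s (s i) = i" for i
    using s by (simp add: bij_betw_def inv_f_f)
  have 1: "?\<mu> (?w x) (?w y) = 0" if "x \<in> fst G" "y \<in> fst G" "{x, y} \<notin> snd G" for x y
    using that by (simp add: tensor_bracket_axis graph_tensor_def inv vec_eq_iff)
  let ?S = "?w ` fst G \<union> {?\<mu> (?w x) (?w y) | x y. {x, y} \<in> snd G}"
  have "axis i 1 \<in> ?S" for i
  proof (cases "s i")
    case (Inl x)
    then have "x \<in> fst G" by (rule index_memD(1)[OF s])
    moreover have "axis i 1 = ?w x" using Inl inv'[of i] by simp
    ultimately show ?thesis by blast
  next
    case (Inr e)
    then obtain x y k j where e: "e = {x, y}" "s k = Inl x" "s j = Inl y"
      "(\<chi> l. graph_tensor G v s k j l) = axis i 1"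
      by (rule edge_axis_is_bracket[OF assms])
    have "e \<in> snd G" by (rule index_memD(2)[OF s Inr])
    moreover have "axis i 1 = ?\<mu> (?w x) (?w y)"
      using inv'[of k] inv'[of j] e by (simp add: tensor_bracket_axis)
    ultimately show ?thesis using e(1) by blast
  qed
  then have "cart_basis \<subseteq> ?S" by (auto simp: cart_basis_def)
  then have "vec.span ?S = UNIV"
    using vec.span_mono[of cart_basis ?S] by (simp only: span_cart_basis top.extremum_unique)
  then show ?thesis
    unfolding presents_def using 1 by blast
qed

lemma coordinate_indexing:
  assumes "finite_simple_graph G" "CARD('n::finite) = card (fst G) + card (snd G)"
  obtains s where "bij_betw s (UNIV :: 'n set) (fst G <+> snd G)"
proof -
  have "finite (fst G <+> snd G)" "card (fst G <+> snd G) = CARD('n)"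
    using finite_simple_graphD(1,2)[OF assms(1)] assms(2) by (simp_all add: card_Plus)
  then show thesis
    using that finite_same_card_bij[of "UNIV :: 'n set" "fst G <+> snd G"] by auto
qed

lemma card_vertex_indices:
  assumes "finite_simple_graph G" "bij_betw s (UNIV :: 'n::finite set) (fst G <+> snd G)"
  shows "card (vertex_indices s) = card (fst G)" "card (- vertex_indices s) = card (snd G)"
proof -
  have inj: "inj s" and ran: "range s = fst G <+> snd G" using assms(2) by (auto simp: bij_betw_def)
  have "s ` vertex_indices s = Inl ` fst G"
  proof (intro set_eqI iffI)
    fix y assume "y \<in> s ` vertex_indices s"
    then show "y \<in> Inl ` fst G"
      using index_memD(1)[OF assms(2)] by (auto simp: vertex_indices_def)
  next
    fix y :: "'a + 'a set" assume y: "y \<in> Inl ` fst G"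
    then have "y \<in> range s" using ran by auto
    then obtain i where "y = s i" by blast
    then show "y \<in> s ` vertex_indices s" using y unfolding vertex_indices_def by force
  qed
  then show "card (vertex_indices s) = card (fst G)"
    using card_image[OF inj_on_subset[OF inj subset_UNIV], of "vertex_indices s"]
    by (simp add: card_image)
  then have "card (- vertex_indices s) = CARD('n) - card (fst G)"
    by (simp add: Compl_eq_Diff_UNIV card_Diff_subset)
  also have "CARD('n) = card (fst G) + card (snd G)"
    using bij_betw_same_card[OF assms(2)] finite_simple_graphD(1,2)[OF assms(1)]
    by (simp add: card_Plus)
  finally show "card (- vertex_indices s) = card (snd G)" by simp
qed

lemma dim_derived_presented_le:
  fixes \<mu> :: "'n::finite bracket"
  assumes "\<mu> \<in> nil2_brackets" "presents G w \<mu>" "finite_simple_graph G"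
  shows "vec.dim (derived \<mu>) \<le> card (snd G)"
proof -
  let ?E = "frame w \<mu> ` Inr ` snd G"
  have fin: "finite (snd G)" using finite_simple_graphD(2)[OF assms(3)] .
  have "w ` fst G \<union> {\<mu> (w x) (w y) | x y. {x, y} \<in> snd G} \<subseteq> w ` fst G \<union> derived \<mu>"
    using bracket_in_derived by blast
  then have "vec.span (w ` fst G \<union> derived \<mu>) = UNIV"
    using vec.span_mono[of "w ` fst G \<union> {\<mu> (w x) (w y) | x y. {x, y} \<in> snd G}" "w ` fst G \<union> derived \<mu>"]
      assms(2) by (simp only: presents_def top.extremum_unique)
  then have D: "derived \<mu> = vec.span {\<mu> (w a) (w b) | a b. a \<in> fst G \<and> b \<in> fst G}"
    by (rule derived_generated[OF assms(1)])
  have "{\<mu> (w a) (w b) | a b. a \<in> fst G \<and> b \<in> fst G} \<subseteq> vec.span ?E"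
  proof
    fix z assume "z \<in> {\<mu> (w a) (w b) | a b. a \<in> fst G \<and> b \<in> fst G}"
    then obtain a b where ab: "z = \<mu> (w a) (w b)" "a \<in> fst G" "b \<in> fst G" by blast
    show "z \<in> vec.span ?E"
    proof (cases "{a, b} \<in> snd G")
      case True
      then have "frame w \<mu> (Inr {a, b}) \<in> vec.span ?E"
        by (intro vec.span_base imageI)
      moreover have "z = frame w \<mu> (Inr {a, b}) \<or> z = - frame w \<mu> (Inr {a, b})"
        using edge_ends_cases[of a b] ab(1) nil2_bracketsD(4)[OF assms(1), of "w a" "w b"] by auto
      ultimately show ?thesis
        by (elim disjE) (simp_all only: vec.span_neg)
    next
      case False
      then have "z = 0" using ab assms(2) by (simp add: presents_def)
      then show ?thesis by (simp only: vec.span_zero)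
    qed
  qed
  then have "derived \<mu> \<subseteq> vec.span ?E"
    by (rule ord_eq_le_trans[OF D span_le])
  then have "vec.dim (derived \<mu>) \<le> card ?E"
    using fin by (intro vec.dim_le_card) simp_all
  also have "\<dots> \<le> card (snd G)"
    unfolding image_image by (rule card_image_le[OF fin])
  finally show ?thesis .
qed

text \<open>An isolated vertex can be turned into the bracket of two nonadjacent vertices; this makes the
  derived algebra larger.\<close>

lemma isolated_vertex_not_open:
  assumes G: "finite_simple_graph G" "bij_betw v {1..card (fst G)} (fst G)"
    and n: "CARD('n::finite) = card (fst G) + card (snd G)"
    and open_P: "zariski_open_in nil2_brackets (presented_brackets G :: 'n bracket set)"
    and z: "z \<in> fst G" "\<And>y. {z, y} \<notin> snd G"
    and xy: "x \<in> fst G" "y \<in> fst G" "x \<noteq> y" "x \<noteq> z" "y \<noteq> z" "{x, y} \<notin> snd G"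
  shows False
proof -
  obtain s where s: "bij_betw s (UNIV :: 'n set) (fst G <+> snd G)"
    by (rule coordinate_indexing[OF G(1) n])
  have inj: "s i = s j \<longleftrightarrow> i = j" for i j using s by (auto simp: bij_betw_def dest: injD)
  have "Inl x \<in> range s" "Inl y \<in> range s" "Inl z \<in> range s"
    using s xy(1,2) z(1) by (auto simp: bij_betw_def)
  then obtain ix iy iz where i: "s ix = Inl x" "s iy = Inl y" "s iz = Inl z" by (metis imageE)
  have ne: "ix \<noteq> iy" "ix \<noteq> iz" "iy \<noteq> iz" using i xy by auto
  let ?J = "vertex_indices s - {iz}" and ?c = "graph_tensor G v s"
  define c' where "c' a b k = ?c a b k + (if (a, b, k) = (ix, iy, iz) then 1
    else if (a, b, k) = (iy, ix, iz) then -1 else 0)" for a b k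
  have c: "alternating_tensor ?J ?c"
    unfolding alternating_tensor_def
  proof (intro conjI allI impI)
    show "?c j i k = - ?c i j k" for i j k by (rule graph_tensor_skew[OF G(2)])
    fix a b k assume "?c a b k \<noteq> 0"
    then obtain p q where pq: "s a = Inl p" "s b = Inl q" "{p, q} \<in> snd G" "s k = Inr {p, q}"
      by (rule graph_tensor_support)
    then have "p \<noteq> z" "q \<noteq> z" using z(2) by (metis insert_commute)+
    then show "a \<in> ?J" "b \<in> ?J" "k \<notin> ?J"
      using pq i by (auto simp: vertex_indices_def)
  qed
  have c'_alt: "alternating_tensor ?J c'"
    unfolding alternating_tensor_def
  proof (intro conjI allI impI)
    show "c' b a k = - c' a b k" for a b k
      using graph_tensor_skew[OF G(2), of s a b k] ne by (auto simp: c'_def)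
    fix a b k assume "c' a b k \<noteq> 0"
    then consider "?c a b k \<noteq> 0" | "(a, b, k) = (ix, iy, iz)" | "(a, b, k) = (iy, ix, iz)"
      by (auto simp: c'_def split: if_splits)
    then have "a \<in> ?J \<and> b \<in> ?J \<and> k \<notin> ?J"
    proof cases
      case 1 then show ?thesis using c unfolding alternating_tensor_def by blast
    qed (use i ne in \<open>auto simp: vertex_indices_def\<close>)
    then show "a \<in> ?J" "b \<in> ?J" "k \<notin> ?J" by blast+
  qed
  have "tensor_bracket ?c \<in> presented_brackets G"
    unfolding presented_brackets_def
    using graph_tensor_presented[OF G s] tensor_bracket_nil2[OF c] by blast
  then have "finite {t. tensor_bracket (tensor_line ?c c' t) \<notin> presented_brackets G}"
    by (rule zariski_open_line_cofinite[OF open_P c c'_alt])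
  then have "finite (insert 0 {t. tensor_bracket (tensor_line ?c c' t) \<notin> presented_brackets G})"
    by simp
  then obtain t where t: "t \<notin> insert 0 {t. tensor_bracket (tensor_line ?c c' t) \<notin> presented_brackets G}"
    using ex_new_if_finite[OF infinite_UNIV_char_0] by blast
  let ?\<mu> = "tensor_bracket (tensor_line ?c c' t)"
  have "?\<mu> \<in> presented_brackets G" "t \<noteq> 0" using t by auto
  then obtain w where w: "presents G w ?\<mu>" and nil: "?\<mu> \<in> nil2_brackets"
    unfolding presented_brackets_def by blast
  have line: "tensor_line ?c c' t a b k = ?c a b k + t * (if (a, b, k) = (ix, iy, iz) then 1
    else if (a, b, k) = (iy, ix, iz) then -1 else 0)" for a b k
    by (simp add: tensor_line_def c'_def algebra_simps)
  let ?K = "insert iz (- vertex_indices s)"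
  have "axis k 1 \<in> derived ?\<mu>" if k: "k \<in> ?K" for k
  proof (cases "k = iz")
    case True
    have "?c ix iy l = 0" for l using xy(6) i by (auto simp: graph_tensor_def)
    then have "?\<mu> (axis ix 1) (axis iy 1) = t *s axis k 1"
      unfolding tensor_bracket_axis line using True ne by (auto simp: vec_eq_iff axis_def)
    then have "axis k 1 = (1 / t) *s ?\<mu> (axis ix 1) (axis iy 1)"
      using \<open>t \<noteq> 0\<close> by (simp add: vec_eq_iff)
    then show ?thesis
      using bracket_in_derived derived_subspace by (metis vec.subspace_scale)
  next
    case False
    then obtain e where "s k = Inr e" using k by (cases "s k") (auto simp: vertex_indices_def)
    then obtain p q a b where e: "e = {p, q}" "s a = Inl p" "s b = Inl q"
      "(\<chi> l. ?c a b l) = axis k 1" by (rule edge_axis_is_bracket[OF G s])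
    have "e \<in> snd G" by (rule index_memD(2)[OF s \<open>s k = Inr e\<close>])
    then have "\<not> (a = ix \<and> b = iy)" "\<not> (a = iy \<and> b = ix)"
      using e i xy(6) by (auto simp: insert_commute)
    then have "tensor_line ?c c' t a b l = ?c a b l" for l
      unfolding line by auto
    then have "?\<mu> (axis a 1) (axis b 1) = axis k 1"
      using e(4) by (simp add: tensor_bracket_axis)
    then show ?thesis using bracket_in_derived by metis
  qed
  then have sub: "(\<lambda>k. axis k 1) ` ?K \<subseteq> derived ?\<mu>" by blast
  have "vec.independent ((\<lambda>k. axis k (1 :: complex)) ` ?K)"
    using independent_cart_basis by (rule vec.independent_mono) (auto simp: cart_basis_def)
  then have "card ((\<lambda>k. axis k (1 :: complex)) ` ?K) \<le> vec.dim (derived ?\<mu>)"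
    by (rule vec.independent_card_le_dim[OF sub])
  moreover have "inj_on (\<lambda>k. axis k (1 :: complex)) ?K" by (auto simp: inj_on_def axis_eq_axis)
  moreover have "iz \<notin> - vertex_indices s" using i by (auto simp: vertex_indices_def)
  ultimately have "Suc (card (snd G)) \<le> vec.dim (derived ?\<mu>)"
    using card_vertex_indices[OF G(1) s] by (simp add: card_image)
  then show False
    using dim_derived_presented_le[OF nil w G(1)] by simp
qed


section \<open>The band bracket\<close>

text \<open>The window of sums \<open>j + k\<close> starts at \<open>m + 2 - r\<close>, so that at \<open>k = 1\<close> exactly \<open>r\<close> indices \<open>j\<close> are
  left. Its length \<open>2 * r - 1\<close> or more leaves at least \<open>r\<close> of them at \<open>k = m\<close>. In between there is at
  least one index to spare, which makes up for \<open>j = k\<close>; when \<open>r = 1\<close> this needs the length two.\<close>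

lemma band_window:
  fixes m p r k :: nat
  assumes "1 \<le> k" "k \<le> m" "1 \<le> r" "r + 1 \<le> m" "2 * r \<le> p + 1" "2 \<le> p"
  shows "\<exists>T \<subseteq> {1..m} - {k}. card T = r \<and> (\<forall>j\<in>T. m + 2 - r \<le> j + k \<and> j + k < m + 2 - r + p)"
proof -
  define lo where "lo = max 1 (m + 2 - r - k)"
  define hi where "hi = min m (m + 1 - r + p - k)"
  have win: "m + 2 - r \<le> j + k \<and> j + k < m + 2 - r + p" if "j \<in> {lo..hi}" for j
    using that assms by (auto simp: lo_def hi_def)
  have "r \<le> card ({lo..hi} - {k})"
  proof (cases "k \<in> {lo..hi}")
    case True
    then have "card ({lo..hi} - {k}) = hi - lo" by simp
    then show ?thesis
      using True assms by (auto simp: lo_def hi_def max_def min_def split: if_splits)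
  next
    case False
    then have "card ({lo..hi} - {k}) = hi + 1 - lo" by simp
    then show ?thesis
      using False assms by (auto simp: lo_def hi_def max_def min_def split: if_splits)
  qed
  then obtain T where T: "T \<subseteq> {lo..hi} - {k}" "card T = r"
    using obtain_subset_with_card_n by metis
  have "{lo..hi} \<subseteq> {1..m}" by (auto simp: lo_def hi_def)
  then show ?thesis using T win by blast
qed

text \<open>Here \<open>\<kappa>\<close> numbers the coordinates in \<open>J\<close> and \<open>l\<close> those outside of it.\<close>

definition band_tensor :: "'n set \<Rightarrow> ('n \<Rightarrow> nat) \<Rightarrow> ('n \<Rightarrow> nat) \<Rightarrow> nat \<Rightarrow> 'n \<Rightarrow> 'n \<Rightarrow> 'n \<Rightarrow> complex" where
  "band_tensor J \<kappa> l c i j k =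
     (if i \<in> J \<and> j \<in> J \<and> k \<notin> J \<and> \<kappa> i + \<kappa> j = c + l k
      then if \<kappa> i < \<kappa> j then 1 else if \<kappa> j < \<kappa> i then -1 else 0 else 0)"

lemma band_tensor_alternating: "alternating_tensor J (band_tensor J \<kappa> l c)"
  unfolding alternating_tensor_def band_tensor_def by (auto simp: add.commute)

text \<open>Let \<open>k\<close> be the highest index in \<open>x\<close>. The brackets of \<open>x\<close> with the basis vectors of index \<open>j\<close> have
  highest index \<open>j + k\<close>, as long as \<open>j\<close> differs from \<open>k\<close> and \<open>j + k\<close> lies in the window. They are in
  echelon form and hence independent.\<close>

lemma band_bracket_injective:
  assumes \<kappa>: "bij_betw \<kappa> J {1..m}" and l: "bij_betw l (- J) {..<p}"
    and r: "1 \<le> r" "r + 1 \<le> m" "2 * r \<le> p + 1" "2 \<le> p"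
    and x: "\<exists>i\<in>J. x $ i \<noteq> 0"
  shows "\<exists>J' \<subseteq> J. card J' = r \<and>
    (\<forall>y. (\<forall>i. y $ i \<noteq> 0 \<longrightarrow> i \<in> J') \<longrightarrow> tensor_bracket (band_tensor J \<kappa> l (m + 2 - r)) x y = 0 \<longrightarrow> y = 0)"
proof -
  let ?top = "\<lambda>x i. i \<in> J \<and> x $ i \<noteq> 0 \<and> (\<forall>i'\<in>J. x $ i' \<noteq> 0 \<longrightarrow> \<kappa> i' \<le> \<kappa> i)"
  have top: "\<exists>i. ?top x i" if "\<exists>i\<in>J. x $ i \<noteq> 0" for x :: "complex^'a"
  proof -
    have "Max (\<kappa> ` {i \<in> J. x $ i \<noteq> 0}) \<in> \<kappa> ` {i \<in> J. x $ i \<noteq> 0}"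
      using that by (intro Max_in) auto
    then obtain i where "i \<in> J" "x $ i \<noteq> 0" "Max (\<kappa> ` {i \<in> J. x $ i \<noteq> 0}) = \<kappa> i" by auto
    moreover have "\<kappa> i' \<le> Max (\<kappa> ` {i \<in> J. x $ i \<noteq> 0})" if "i' \<in> J" "x $ i' \<noteq> 0" for i'
      using that by (intro Max_ge) auto
    ultimately show ?thesis by metis
  qed
  obtain i0 where i0: "i0 \<in> J" "x $ i0 \<noteq> 0" "\<And>i. i \<in> J \<Longrightarrow> x $ i \<noteq> 0 \<Longrightarrow> \<kappa> i \<le> \<kappa> i0"
    using top[OF x] by blast
  have k: "1 \<le> \<kappa> i0" "\<kappa> i0 \<le> m" using \<kappa> i0(1) by (auto simp: bij_betw_def)
  obtain T where T: "T \<subseteq> {1..m} - {\<kappa> i0}" "card T = r"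
    "\<And>j. j \<in> T \<Longrightarrow> m + 2 - r \<le> j + \<kappa> i0 \<and> j + \<kappa> i0 < m + 2 - r + p"
    using band_window[OF k r] by blast
  let ?J' = "{i \<in> J. \<kappa> i \<in> T}"
  have "\<kappa> ` ?J' = T" using \<kappa> T(1) by (auto simp: bij_betw_def)
  then have card: "card ?J' = r"
    using T(2) \<kappa> card_image[of \<kappa> ?J'] inj_on_subset[of \<kappa> J ?J'] by (auto simp: bij_betw_def)
  have inj: "y = 0" if supp: "\<forall>i. y $ i \<noteq> 0 \<longrightarrow> i \<in> ?J'"
    and zero: "tensor_bracket (band_tensor J \<kappa> l (m + 2 - r)) x y = 0" for y
  proof (rule ccontr)
    assume "y \<noteq> 0"
    then have "\<exists>i\<in>J. y $ i \<noteq> 0" using supp by (auto simp: vec_eq_iff)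
    then obtain j0 where j0: "j0 \<in> J" "y $ j0 \<noteq> 0" "\<And>i. i \<in> J \<Longrightarrow> y $ i \<noteq> 0 \<Longrightarrow> \<kappa> i \<le> \<kappa> j0"
      using top by blast
    have j0T: "\<kappa> j0 \<in> T" using supp j0(2) by blast
    then have "\<kappa> j0 + \<kappa> i0 - (m + 2 - r) \<in> {..<p}" using T(3)[OF j0T] by auto
    then obtain k where k: "k \<notin> J" "l k = \<kappa> j0 + \<kappa> i0 - (m + 2 - r)"
      using l by (metis (no_types, lifting) bij_betw_imp_surj_on ComplD imageE)
    have lk: "m + 2 - r + l k = \<kappa> j0 + \<kappa> i0" using k(2) T(3)[OF j0T] by simp
    \<comment> \<open>In the coordinate \<open>k\<close> only the product of the two top coordinates survives.\<close>
    let ?b = "band_tensor J \<kappa> l (m + 2 - r)"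
    have only: "i = i0 \<and> j = j0" if nz: "?b i j k * x $ i * y $ j \<noteq> 0" for i j
    proof -
      have ij: "i \<in> J" "j \<in> J" "\<kappa> i + \<kappa> j = m + 2 - r + l k"
        using nz by (auto simp: band_tensor_def split: if_splits)
      have "\<kappa> i \<le> \<kappa> i0" "\<kappa> j \<le> \<kappa> j0" using i0(3) j0(3) ij nz by auto
      then have "\<kappa> i = \<kappa> i0" "\<kappa> j = \<kappa> j0" using ij(3) lk by auto
      then show ?thesis
        using \<kappa> ij i0(1) j0(1) by (auto simp: bij_betw_def dest: inj_onD)
    qed
    have row: "(\<Sum>j\<in>UNIV. ?b i j k * x $ i * y $ j) = (if i = i0 then ?b i0 j0 k * x $ i0 * y $ j0 else 0)" for i
    proof (cases "i = i0")
      case True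
      have "(\<Sum>j\<in>UNIV. ?b i j k * x $ i * y $ j)
        = (\<Sum>j\<in>UNIV. if j = j0 then ?b i0 j0 k * x $ i0 * y $ j0 else 0)"
        by (intro sum.cong refl) (use only[of i0] True in auto)
      then show ?thesis using True by simp
    next
      case False
      then have "?b i j k * x $ i * y $ j = 0" for j using only[of i j] by blast
      then show ?thesis using False by (simp only: sum.neutral_const if_False)
    qed
    have "tensor_bracket ?b x y $ k = ?b i0 j0 k * x $ i0 * y $ j0"
      unfolding tensor_bracket_def vec_lambda_beta row by simp
    moreover have "?b i0 j0 k \<noteq> 0"
      using i0(1) j0(1) k(1) lk T(1) j0T by (auto simp: band_tensor_def)
    ultimately show False using zero i0(2) j0(2) by simp
  qed
  show ?thesis
  proof (rule exI[of _ ?J'], intro conjI allI impI)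
    show "?J' \<subseteq> J" by (rule Collect_restrict)
    show "card ?J' = r" by (rule card)
    fix y assume "\<forall>i. y $ i \<noteq> 0 \<longrightarrow> i \<in> ?J'"
      "tensor_bracket (band_tensor J \<kappa> l (m + 2 - r)) x y = 0"
    then show "y = 0" by (rule inj)
  qed
qed

section \<open>Limits of brackets with a vector of small rank\<close>

lemma tensor_bracket_line_limit:
  assumes t: "t \<longlonglongrightarrow> 1" and x: "x \<longlonglongrightarrow> x'" and y: "y \<longlonglongrightarrow> y'"
    and zero: "\<And>n. tensor_bracket (tensor_line c c' (t n)) (x n) (y n) = 0"
  shows "tensor_bracket c' x' y' = 0"
proof -
  have "tensor_bracket c' x' y' $ k = 0" for k
  proof -
    have "(\<lambda>n. \<Sum>i\<in>UNIV. \<Sum>j\<in>UNIV. ((1 - t n) * c i j k + t n * c' i j k) * x n $ i * y n $ j)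
      \<longlonglongrightarrow> (\<Sum>i\<in>UNIV. \<Sum>j\<in>UNIV. ((1 - 1) * c i j k + 1 * c' i j k) * x' $ i * y' $ j)"
      by (intro tendsto_sum tendsto_mult tendsto_add tendsto_diff tendsto_const t tendsto_vec_nth x y)
    moreover have "(\<Sum>i\<in>UNIV. \<Sum>j\<in>UNIV. ((1 - t n) * c i j k + t n * c' i j k) * x n $ i * y n $ j) = 0" for n
      using arg_cong[OF zero[of n], of "\<lambda>z. z $ k"] by (simp add: tensor_bracket_def tensor_line_def)
    ultimately have "(\<lambda>n. 0) \<longlonglongrightarrow> (\<Sum>i\<in>UNIV. \<Sum>j\<in>UNIV. ((1 - 1) * c i j k + 1 * c' i j k) * x' $ i * y' $ j)"
      by simp
    then have "(\<Sum>i\<in>UNIV. \<Sum>j\<in>UNIV. ((1 - 1) * c i j k + 1 * c' i j k) * x' $ i * y' $ j) = 0"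
      by (rule LIMSEQ_unique[OF _ tendsto_const])
    then show ?thesis by (simp add: tensor_bracket_def)
  qed
  then show ?thesis by (simp add: vec_eq_iff)
qed

lemma scaleR_eq_smult: "a *\<^sub>R x = complex_of_real a *s (x :: complex^'n)"
  by (simp add: vec_eq_iff scaleR_conv_of_real[where 'a = complex])

definition unit_supported :: "'n set \<Rightarrow> (complex^'n) set" where
  "unit_supported J = {x. norm x = 1 \<and> (\<forall>i. x $ i \<noteq> 0 \<longrightarrow> i \<in> J)}"

lemma unit_supported_subsequence:
  assumes "\<And>n. x n \<in> unit_supported J"
  obtains x' r where "x' \<in> unit_supported J" "strict_mono (r :: nat \<Rightarrow> nat)" "(x \<circ> r) \<longlonglongrightarrow> x'"
proof -
  have "seq_compact (sphere (0 :: complex^'n) 1)"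
    by (intro compact_imp_seq_compact compact_sphere)
  moreover have "\<forall>n. x n \<in> sphere 0 1"
    using assms by (simp add: unit_supported_def)
  ultimately obtain x' r where xr: "x' \<in> sphere 0 1" "strict_mono (r :: nat \<Rightarrow> nat)" "(x \<circ> r) \<longlonglongrightarrow> x'"
    by (rule seq_compactE)
  have "x' $ i = 0" if "i \<notin> J" for i
  proof -
    have "(\<lambda>n. (x \<circ> r) n $ i) \<longlonglongrightarrow> x' $ i"
      by (intro tendsto_vec_nth xr(3))
    moreover have "(x \<circ> r) n $ i = 0" for n
      using assms that by (auto simp: unit_supported_def)
    ultimately have "(\<lambda>n. 0) \<longlonglongrightarrow> x' $ i" by simp
    then show ?thesis by (rule LIMSEQ_unique[OF _ tendsto_const])
  qed
  then have "x' \<in> unit_supported J"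
    using xr(1) by (auto simp: unit_supported_def)
  then show thesis using that xr(2,3) by blast
qed

text \<open>A vertex \<open>u\<close> with fewer than \<open>r\<close> incident edges has a bracket operator of rank less than \<open>r\<close>.
  Together with the span of the edges it fills more dimensions than there are coordinates outside
  of \<open>J\<close>, so it has a component in \<open>J\<close>.\<close>

lemma presented_small_rank_vector:
  fixes c :: "'n::finite \<Rightarrow> 'n \<Rightarrow> 'n \<Rightarrow> complex"
  assumes alt: "alternating_tensor J c" and w: "presents G w (tensor_bracket c)"
    and G: "finite_simple_graph G" "CARD('n) = card (fst G) + card (snd G)"
    and J: "card (- J) = card (snd G)"
    and u: "u \<in> fst G" "card {e \<in> snd G. u \<in> e} < r"
  shows "\<exists>x \<in> unit_supported J. \<forall>J'. card J' = r \<longrightarrow> (\<exists>y \<in> unit_supported J'. tensor_bracket c x y = 0)"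
proof -
  let ?\<mu> = "tensor_bracket c"
  have nil: "?\<mu> \<in> nil2_brackets" by (rule tensor_bracket_nil2[OF alt])
  note b = bilinear_simps[OF nil2_bracketsD(1)[OF nil]]
  note B = frame_basis[OF nil w G]
  have supp: "i \<in> J \<and> k \<notin> J" if "c i j k \<noteq> 0" for i j k
    using alt that unfolding alternating_tensor_def by blast
  have outside: "?\<mu> y z $ i = 0" if "i \<in> J" for y z i
  proof -
    have "c a b i = 0" for a b using supp[of a b i] that by blast
    then show ?thesis by (simp add: tensor_bracket_def)
  qed
  have inside: "?\<mu> y z = ?\<mu> y' z" if "\<And>i. i \<in> J \<Longrightarrow> y $ i = y' $ i" for y y' z
  proof -
    have "c i j k * y $ i * z $ j = c i j k * y' $ i * z $ j" for i j k
      using that supp[of i j k] by (cases "c i j k = 0") auto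
    then show ?thesis unfolding tensor_bracket_def by (simp only:)
  qed
  have "\<exists>i\<in>J. w u $ i \<noteq> 0"
  proof (rule ccontr)
    assume neg: "\<not> ?thesis"
    let ?U = "insert (Inl u) (Inr ` snd G)"
    have sub: "?U \<subseteq> fst G <+> snd G" using u(1) by auto
    have in_span: "frame w ?\<mu> ` ?U \<subseteq> vec.span ((\<lambda>i. axis i 1) ` (- J))"
    proof
      fix z assume "z \<in> frame w ?\<mu> ` ?U"
      then have z: "z $ i = 0" if "i \<in> J" for i using neg outside that by auto
      have "z = (\<Sum>i\<in>UNIV. z $ i *s axis i 1)" by (simp add: basis_expansion)
      also have "\<dots> = (\<Sum>i\<in>- J. z $ i *s axis i 1)"
        by (rule sum.mono_neutral_right) (use z in auto)
      also have "\<dots> \<in> vec.span ((\<lambda>i. axis i 1) ` (- J))"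
        by (intro vec.span_sum vec.span_scale vec.span_base) auto
      finally show "z \<in> vec.span ((\<lambda>i. axis i 1) ` (- J))" .
    qed
    have "vec.independent (frame w ?\<mu> ` ?U)"
      using B(5) by (rule vec.independent_mono) (rule image_mono[OF sub])
    then have "card (frame w ?\<mu> ` ?U) \<le> card ((\<lambda>i. axis i (1 :: complex)) ` (- J))"
      by (rule conjunct2[OF vec.independent_span_bound[OF finite_imageI[OF finite] _ in_span]])
    also have "\<dots> \<le> card (- J)" by (rule card_image_le) simp
    also have "card (frame w ?\<mu> ` ?U) = card ?U"
      by (rule card_image[OF inj_on_subset[OF B(4) sub]])
    also have "card ?U = Suc (card (snd G))"
      using finite_simple_graphD(2)[OF G(1)] by (subst card_insert_disjoint) (auto simp: card_image)
    finally show False using J by simp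
  qed
  then obtain i0 where i0: "i0 \<in> J" "w u $ i0 \<noteq> 0" by blast
  define x0 where "x0 = (\<chi> i. if i \<in> J then w u $ i else 0)"
  define x where "x = sgn x0"
  have "x0 \<noteq> 0" using i0 by (auto simp: x0_def vec_eq_iff)
  then have "norm x = 1" by (simp add: x_def norm_sgn)
  moreover have x_eq: "x = complex_of_real (inverse (norm x0)) *s x0"
    by (simp only: x_def sgn_div_norm scaleR_eq_smult)
  ultimately have xJ: "x \<in> unit_supported J"
    by (auto simp: unit_supported_def x0_def)
  let ?E = "(\<lambda>e. frame w ?\<mu> (Inr e)) ` {e \<in> snd G. u \<in> e}"
  have img: "?\<mu> (w u) z \<in> vec.span ?E" for z
  proof -
    have "z \<in> vec.span (frame w ?\<mu> ` (fst G <+> snd G))" using B(3) by simp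
    then show ?thesis
    proof (induction rule: vec.span_induct_alt)
      case base then show ?case by (simp add: b vec.span_zero)
    next
      case (step a f z)
      obtain q where q: "q \<in> fst G <+> snd G" "f = frame w ?\<mu> q" using step(1) by blast
      have "?\<mu> (w u) f \<in> vec.span ?E"
      proof (cases q)
        case (Inl y)
        then have y: "y \<in> fst G" "f = w y" using q by auto
        show ?thesis
        proof (cases "{u, y} \<in> snd G")
          case True
          then have "frame w ?\<mu> (Inr {u, y}) \<in> vec.span ?E"
            by (intro vec.span_base) blast
          moreover have "?\<mu> (w u) f = frame w ?\<mu> (Inr {u, y}) \<or> ?\<mu> (w u) f = - frame w ?\<mu> (Inr {u, y})"
            using edge_ends_cases[of u y] y(2) nil2_bracketsD(4)[OF nil, of "w u" "w y"] by auto
          ultimately show ?thesis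
            by (elim disjE) (simp_all only: vec.span_neg)
        next
          case False
          then have "?\<mu> (w u) f = 0" using w u(1) y by (simp add: presents_def)
          then show ?thesis by (simp only: vec.span_zero)
        qed
      next
        case (Inr e)
        then have "?\<mu> (w u) f = 0" using q(2) by (simp add: nil2_bracketsD(5)[OF nil])
        then show ?thesis by (simp only: vec.span_zero)
      qed
      then show ?case using step(2) by (simp add: b vec.span_add vec.span_scale)
    qed
  qed
  have "\<exists>y \<in> unit_supported J'. ?\<mu> x y = 0" if J': "card J' = r" for J'
  proof -
    have fin: "finite {e \<in> snd G. u \<in> e}" using finite_simple_graphD(2)[OF G(1)] by simp
    have "vec.dim (vec.span ?E) \<le> card ?E"
      using vec.dim_le_card'[OF finite_imageI[OF fin]] by simp
    also have "\<dots> \<le> card {e \<in> snd G. u \<in> e}" by (rule card_image_le[OF fin])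
    finally have dim: "vec.dim (vec.span ?E) < card J'" using u(2) J' by simp
    have sub: "(\<lambda>j. ?\<mu> (w u) (axis j 1)) ` J' \<subseteq> vec.span ?E" using img by blast
    obtain a where a: "\<exists>j\<in>J'. a j \<noteq> 0" "(\<Sum>j\<in>J'. a j *s ?\<mu> (w u) (axis j 1)) = 0"
      by (rule family_dependent[OF finite sub dim])
    define y0 where "y0 = (\<chi> i. if i \<in> J' then a i else 0)"
    have "y0 = (\<Sum>j\<in>J'. a j *s axis j 1)"
      by (auto simp: y0_def vec_eq_iff axis_def if_distrib cong: if_cong)
    then have "?\<mu> (w u) y0 = 0"
      using a(2) by (simp add: bilinear_sum[OF nil2_bracketsD(1)[OF nil]] b)
    moreover have "?\<mu> (w u) y0 = ?\<mu> x0 y0" by (rule inside) (simp add: x0_def)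
    ultimately have "?\<mu> x (sgn y0) = 0"
      by (simp add: x_eq sgn_div_norm scaleR_eq_smult b)
    moreover have "y0 \<noteq> 0" using a(1) by (auto simp: y0_def vec_eq_iff)
    then have "sgn y0 \<in> unit_supported J'"
      by (auto simp: unit_supported_def norm_sgn sgn_div_norm y0_def split: if_splits)
    ultimately show ?thesis by blast
  qed
  then show ?thesis using xJ by blast
qed

text \<open>On the line from the graph's bracket to the band bracket almost all points are isomorphic to
  the graph Lie algebra and so have a unit vector of rank less than \<open>r\<close>. By compactness the band
  bracket would have one too, but its operators are injective on suitable coordinate subspaces of
  dimension \<open>r\<close>.\<close>

lemma small_degree_not_open:
  assumes G: "finite_simple_graph G" "bij_betw v {1..card (fst G)} (fst G)"
    and n: "CARD('n::finite) = card (fst G) + card (snd G)"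
    and open_P: "zariski_open_in nil2_brackets (presented_brackets G :: 'n bracket set)"
    and u: "u \<in> fst G" "r = Suc (card {e \<in> snd G. u \<in> e})"
    and r: "r + 1 \<le> card (fst G)" "2 * r \<le> card (snd G) + 1" "2 \<le> card (snd G)"
  shows False
proof -
  obtain s where s: "bij_betw s (UNIV :: 'n set) (fst G <+> snd G)"
    by (rule coordinate_indexing[OF G(1) n])
  let ?J = "vertex_indices s" and ?c = "graph_tensor G v s"
  note cJ = card_vertex_indices[OF G(1) s]
  obtain \<kappa> where \<kappa>: "bij_betw \<kappa> ?J {1..card (fst G)}"
    using finite_same_card_bij[of ?J "{1..card (fst G)}"] cJ by auto
  obtain l where l: "bij_betw l (- ?J) {..<card (snd G)}"
    using finite_same_card_bij[of "- ?J" "{..<card (snd G)}"] cJ by auto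
  let ?b = "band_tensor ?J \<kappa> l (card (fst G) + 2 - r)"
  note c_alt = graph_tensor_alternating[OF G(2), of s]
  have "tensor_bracket ?c \<in> presented_brackets G"
    unfolding presented_brackets_def
    using graph_tensor_presented[OF G s] tensor_bracket_nil2[OF c_alt] by blast
  then have fin: "finite {t. tensor_bracket (tensor_line ?c ?b t) \<notin> presented_brackets G}"
    by (rule zariski_open_line_cofinite[OF open_P c_alt band_tensor_alternating])
  \<comment> \<open>Parameters that tend to the band bracket and eventually avoid the finite exceptional set.\<close>
  define a where "a n = 1 + 1 / (of_nat (Suc n) :: complex)" for n
  have "inj a" by (auto simp: inj_def a_def)
  then have "finite (a -` {t. tensor_bracket (tensor_line ?c ?b t) \<notin> presented_brackets G})"
    by (rule finite_vimageI[OF fin])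
  then have "\<exists>N. \<forall>n \<in> a -` {t. tensor_bracket (tensor_line ?c ?b t) \<notin> presented_brackets G}. n < N"
    by (simp only: finite_nat_set_iff_bounded)
  then obtain N where N: "\<forall>n \<in> a -` {t. tensor_bracket (tensor_line ?c ?b t) \<notin> presented_brackets G}. n < N"
    by (rule exE)
  define t where "t n = a (n + N)" for n
  have "(\<lambda>n. 1 + 1 / (of_nat (Suc n) :: complex)) \<longlonglongrightarrow> 1 + 0"
    by (intro tendsto_add tendsto_const LIMSEQ_Suc lim_1_over_n)
  then have "a \<longlonglongrightarrow> 1" by (simp add: a_def[abs_def])
  then have t1: "t \<longlonglongrightarrow> 1" unfolding t_def by (rule LIMSEQ_ignore_initial_segment)
  have good: "tensor_bracket (tensor_line ?c ?b (t n)) \<in> presented_brackets G" for n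
    using bspec[OF N, of "n + N"] by (auto simp: t_def)
  have "\<exists>x \<in> unit_supported ?J. \<forall>J'. card J' = r \<longrightarrow>
    (\<exists>y \<in> unit_supported J'. tensor_bracket (tensor_line ?c ?b (t n)) x y = 0)" for n
  proof -
    obtain w where "presents G w (tensor_bracket (tensor_line ?c ?b (t n)))"
      using good[of n] unfolding presented_brackets_def by blast
    then show ?thesis
      by (rule presented_small_rank_vector[OF alternating_tensor_line[OF c_alt band_tensor_alternating]
            _ G(1) n cJ(2) u(1)]) (simp add: u(2))
  qed
  then obtain x where x: "\<And>n. x n \<in> unit_supported ?J"
    "\<And>n J'. card J' = r \<Longrightarrow>
      \<exists>y \<in> unit_supported J'. tensor_bracket (tensor_line ?c ?b (t n)) (x n) y = 0"
    by metis
  obtain x' f where x': "x' \<in> unit_supported ?J" "strict_mono f" "(x \<circ> f) \<longlonglongrightarrow> x'"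
    by (rule unit_supported_subsequence[of x, OF x(1)])
  have "x' \<noteq> 0" using x'(1) by (auto simp: unit_supported_def)
  then have "\<exists>i\<in>?J. x' $ i \<noteq> 0"
    using x'(1) by (auto simp: unit_supported_def vec_eq_iff)
  then obtain J' where J': "card J' = r"
    "\<And>y. (\<And>i. y $ i \<noteq> 0 \<Longrightarrow> i \<in> J') \<Longrightarrow> tensor_bracket ?b x' y = 0 \<Longrightarrow> y = 0"
    using band_bracket_injective[OF \<kappa> l _ r, of x'] u(2) by auto
  obtain y where y: "\<And>n. y n \<in> unit_supported J'"
    "\<And>n. tensor_bracket (tensor_line ?c ?b (t n)) (x n) (y n) = 0"
    using x(2)[OF J'(1)] by metis
  have yf: "(y \<circ> f) n \<in> unit_supported J'" for n using y(1) by simp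
  obtain y' g where y': "y' \<in> unit_supported J'" "strict_mono g" "((y \<circ> f) \<circ> g) \<longlonglongrightarrow> y'"
    by (rule unit_supported_subsequence[OF yf])
  have "tensor_bracket ?b x' y' = 0"
  proof (rule tensor_bracket_line_limit[where t = "(t \<circ> f) \<circ> g" and x = "(x \<circ> f) \<circ> g" and y = "(y \<circ> f) \<circ> g"])
    show "((t \<circ> f) \<circ> g) \<longlonglongrightarrow> 1"
      by (intro LIMSEQ_subseq_LIMSEQ t1 x'(2) y'(2))
    show "((x \<circ> f) \<circ> g) \<longlonglongrightarrow> x'"
      by (rule LIMSEQ_subseq_LIMSEQ[OF x'(3) y'(2)])
  qed (use y' y(2) in simp_all)
  then have "y' = 0" using J'(2) y'(1) by (auto simp: unit_supported_def)
  then show False using y'(1) by (simp add: unit_supported_def)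
qed

section \<open>Graph isomorphisms\<close>

lemma finite_simple_graph_edge_subset:
  "finite_simple_graph G \<Longrightarrow> e \<in> snd G \<Longrightarrow> e \<subseteq> fst G"
  using finite_simple_graphD(4) by blast

lemma graph_iso_edge_iff:
  assumes G: "finite_simple_graph G" and f: "bij_betw f (fst G) (fst H)" "(`) f ` snd G = snd H"
    and xy: "x \<in> fst G" "y \<in> fst G"
  shows "{f x, f y} \<in> snd H \<longleftrightarrow> {x, y} \<in> snd G"
proof
  assume "{f x, f y} \<in> snd H"
  then obtain e where e: "e \<in> snd G" "f ` e = {f x, f y}" using f(2) by (metis imageE)
  have "e \<subseteq> fst G" by (rule finite_simple_graph_edge_subset[OF G e(1)])
  moreover have "f ` e = f ` {x, y}" using e(2) by simp
  ultimately have "e = {x, y}"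
    using f(1) xy inj_on_image_eq_iff[of f "fst G" e "{x, y}"] by (simp add: bij_betw_def)
  then show "{x, y} \<in> snd G" using e(1) by simp
next
  assume "{x, y} \<in> snd G"
  then have "f ` {x, y} \<in> snd H" using f(2) by blast
  then show "{f x, f y} \<in> snd H" by simp
qed

lemma presents_cong:
  assumes G: "finite_simple_graph G" and eq: "\<And>x. x \<in> fst G \<Longrightarrow> w x = u x"
  shows "presents G w \<mu> \<longleftrightarrow> presents G u \<mu>"
proof -
  have "\<mu> (w x) (w y) = \<mu> (u x) (u y)" if "{x, y} \<in> snd G" for x y
    using finite_simple_graphD(3)[OF G that] eq by simp
  then have "z = \<mu> (w x) (w y) \<and> {x, y} \<in> snd G \<longleftrightarrow> z = \<mu> (u x) (u y) \<and> {x, y} \<in> snd G" for x y z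
    by auto
  then have "{\<mu> (w x) (w y) | x y. {x, y} \<in> snd G} = {\<mu> (u x) (u y) | x y. {x, y} \<in> snd G}"
    by (simp only:)
  moreover have "w ` fst G = u ` fst G" by (rule image_cong[OF refl eq])
  ultimately show ?thesis
    unfolding presents_def by (simp add: eq)
qed

lemma graph_iso_presents:
  assumes G: "finite_simple_graph G" and H: "finite_simple_graph H"
    and f: "bij_betw f (fst G) (fst H)" "(`) f ` snd G = snd H"
  shows "presents G (w \<circ> f) \<mu> \<longleftrightarrow> presents H w \<mu>"
proof -
  have img: "fst H = f ` fst G" using f(1) by (simp add: bij_betw_def)
  have "{\<mu> ((w \<circ> f) x) ((w \<circ> f) y) | x y. {x, y} \<in> snd G} = {\<mu> (w x) (w y) | x y. {x, y} \<in> snd H}"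
  proof (intro set_eqI iffI)
    fix z assume "z \<in> {\<mu> ((w \<circ> f) x) ((w \<circ> f) y) | x y. {x, y} \<in> snd G}"
    then obtain x y where xy: "z = \<mu> (w (f x)) (w (f y))" "{x, y} \<in> snd G" by auto
    then have "{f x, f y} \<in> snd H"
      using graph_iso_edge_iff[OF G f] finite_simple_graphD(3)[OF G xy(2)] by blast
    then show "z \<in> {\<mu> (w x) (w y) | x y. {x, y} \<in> snd H}" using xy(1) by blast
  next
    fix z assume "z \<in> {\<mu> (w x) (w y) | x y. {x, y} \<in> snd H}"
    then obtain a b where ab: "z = \<mu> (w a) (w b)" "{a, b} \<in> snd H" by blast
    then have "a \<in> f ` fst G" "b \<in> f ` fst G" using finite_simple_graphD(3)[OF H ab(2)] img by auto
    then obtain x y where xy: "a = f x" "b = f y" "x \<in> fst G" "y \<in> fst G" by blast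
    then have "{x, y} \<in> snd G" using graph_iso_edge_iff[OF G f] ab(2) by blast
    then show "z \<in> {\<mu> ((w \<circ> f) x) ((w \<circ> f) y) | x y. {x, y} \<in> snd G}" using ab xy by auto
  qed
  moreover have "(w \<circ> f) ` fst G = w ` fst H" by (simp add: img image_comp)
  moreover have "(\<forall>x\<in>fst G. \<forall>y\<in>fst G. {x, y} \<notin> snd G \<longrightarrow> \<mu> ((w \<circ> f) x) ((w \<circ> f) y) = 0)
    \<longleftrightarrow> (\<forall>x\<in>fst H. \<forall>y\<in>fst H. {x, y} \<notin> snd H \<longrightarrow> \<mu> (w x) (w y) = 0)"
    using graph_iso_edge_iff[OF G f] by (simp add: img)
  ultimately show ?thesis
    by (simp only: presents_def)
qed

lemma graph_iso_transfer:
  assumes G: "finite_simple_graph G" and iso: "graph_iso G H"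
  shows "finite_simple_graph H" "card (fst G) = card (fst H)" "card (snd G) = card (snd H)"
    "presented_brackets G = presented_brackets H"
proof -
  obtain f where f: "bij_betw f (fst G) (fst H)" "(`) f ` snd G = snd H"
    using iso unfolding graph_iso_def by blast
  have inj: "inj_on f (fst G)" and img: "fst H = f ` fst G" using f(1) by (auto simp: bij_betw_def)
  show H: "finite_simple_graph H"
    unfolding finite_simple_graph_def
  proof
    show "finite (fst H)" using finite_simple_graphD(1)[OF G] img by simp
    show "snd H \<subseteq> all_edges (fst H)"
    proof
      fix e assume "e \<in> snd H"
      then obtain e' where "e' \<in> snd G" "e = f ` e'" using f(2) by blast
      then obtain x y where "e' = {x, y}" "x \<in> fst G" "y \<in> fst G" "x \<noteq> y"
        using finite_simple_graphD(4)[OF G] by blast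
      then show "e \<in> all_edges (fst H)"
        using \<open>e = f ` e'\<close> inj img all_edgesI[of "f x" "fst H" "f y"] by (auto dest: inj_onD)
    qed
  qed
  show "card (fst G) = card (fst H)" by (rule bij_betw_same_card[OF f(1)])
  have "inj_on ((`) f) (Pow (fst G))" by (rule inj_on_image_Pow[OF inj])
  then have "inj_on ((`) f) (snd G)"
    by (rule inj_on_subset) (use finite_simple_graph_edge_subset[OF G] in blast)
  then show "card (snd G) = card (snd H)" using f(2) card_image by metis
  have "\<exists>w. presents G w \<mu>" if "presents H w \<mu>" for w :: "_ \<Rightarrow> complex^'c" and \<mu>
    using graph_iso_presents[OF G H f] that by blast
  moreover have "\<exists>w. presents H w \<mu>" if u: "presents G u \<mu>" for u :: "_ \<Rightarrow> complex^'c" and \<mu>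
  proof -
    let ?w = "u \<circ> inv_into (fst G) f"
    have same: "(?w \<circ> f) x = u x" if "x \<in> fst G" for x using inj that by simp
    then have "presents G (?w \<circ> f) \<mu>"
      using u presents_cong[OF G, of "?w \<circ> f" u] by blast
    then show ?thesis using graph_iso_presents[OF G H f] by blast
  qed
  ultimately show "presented_brackets G = (presented_brackets H :: 'c bracket set)"
    unfolding presented_brackets_def by blast
qed

lemma complete_graph_iso:
  assumes "finite V" "V \<noteq> {}"
  shows "\<exists>m\<ge>1. graph_iso (V, all_edges V) (complete_graph m)"
proof -
  obtain f where f: "bij_betw f V {1..card V}"
    using finite_same_card_bij[OF assms(1), of "{1..card V}"] by auto
  then have inj: "inj_on f V" and img: "{1..card V} = f ` V" by (auto simp: bij_betw_def)
  have "(`) f ` all_edges V = all_edges (f ` V)"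
  proof (intro set_eqI iffI)
    fix e assume "e \<in> (`) f ` all_edges V"
    then obtain x y where "e = {f x, f y}" "x \<in> V" "y \<in> V" "x \<noteq> y" by (auto simp: all_edges_def)
    then show "e \<in> all_edges (f ` V)" using inj by (auto intro!: all_edgesI dest: inj_onD)
  next
    fix e assume "e \<in> all_edges (f ` V)"
    then obtain x y where "e = f ` {x, y}" "x \<in> V" "y \<in> V" "x \<noteq> y" by (auto simp: all_edges_def)
    then show "e \<in> (`) f ` all_edges V" by (blast intro: all_edgesI)
  qed
  then have "graph_iso (V, all_edges V) (complete_graph (card V))"
    unfolding graph_iso_def complete_graph_def using f img by auto
  moreover have "card V \<ge> 1" using assms by (simp add: Suc_leI card_gt_0_iff)
  ultimately show ?thesis by blast
qed

section \<open>Degrees\<close>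

abbreviation degree_in :: "'v set set \<Rightarrow> 'v \<Rightarrow> nat" where
  "degree_in A x \<equiv> card {e \<in> A. x \<in> e}"

lemma sum_degrees:
  assumes "finite_simple_graph (V, A)"
  shows "(\<Sum>x\<in>V. degree_in A x) = 2 * card A"
proof (rule sum_multicount)
  show "finite V" "finite A" using finite_simple_graphD(1,2)[OF assms] by simp_all
  have "card {x \<in> V. x \<in> e} = 2" if e: "e \<in> A" for e
  proof -
    obtain x y where "e = {x, y}" "x \<in> V" "y \<in> V" "x \<noteq> y"
      using finite_simple_graphD(4)[OF assms, of e] e by auto
    then have "{x \<in> V. x \<in> e} = {x, y}" by auto
    then show ?thesis using \<open>x \<noteq> y\<close> by simp
  qed
  then show "\<forall>e\<in>A. card {x \<in> V. x \<in> e} = 2" by blast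
qed

lemma edges_at_subset:
  assumes "finite_simple_graph (V, A)" "e \<in> A" "x \<in> e"
  shows "\<exists>y\<in>V - {x}. e = {x, y}"
proof -
  obtain a b where "e = {a, b}" "a \<in> V" "b \<in> V" "a \<noteq> b"
    using finite_simple_graphD(4)[OF assms(1), of e] assms(2) by auto
  then show ?thesis using assms(3) by auto
qed

lemma degree_le:
  assumes G: "finite_simple_graph (V, A)" and xy: "x \<in> V" "y \<in> V" "x \<noteq> y" "{x, y} \<notin> A"
  shows "degree_in A x \<le> card V - 2"
proof -
  have fin: "finite V" using finite_simple_graphD(1)[OF G] by simp
  have "{e \<in> A. x \<in> e} \<subseteq> (\<lambda>z. {x, z}) ` (V - {x, y})"
    using edges_at_subset[OF G] xy(4) by blast
  then have "degree_in A x \<le> card ((\<lambda>z. {x, z}) ` (V - {x, y}))"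
    using fin by (intro card_mono) auto
  also have "\<dots> \<le> card (V - {x, y})" by (rule card_image_le) (use fin in simp)
  also have "\<dots> = card V - 2" using fin xy by (simp add: card_Diff_subset)
  finally show ?thesis .
qed

lemma graph_iso_two_vertices:
  assumes "x \<noteq> y"
  shows "graph_iso ({x, y}, {}) ({1, 2 :: nat}, {})"
  unfolding graph_iso_def using assms
  by (intro exI[of _ "\<lambda>u. if u = x then 1 else 2"]) (auto simp: bij_betw_def inj_on_def)

lemma graph_iso_three_vertices:
  fixes x y z :: 'v
  assumes "x \<noteq> y" "y \<noteq> z" "x \<noteq> z"
  shows "graph_iso ({x, y, z}, {{x, y}}) ({1, 2, 3 :: nat}, {{1, 2}})"
    "graph_iso ({x, y, z}, {{x, y}, {y, z}}) ({1, 2, 3 :: nat}, {{1, 2}, {2, 3}})"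
proof -
  let ?f = "\<lambda>u. if u = x then 1 else if u = y then 2 else 3 :: nat"
  have "bij_betw ?f {x, y, z} {1, 2, 3}" using assms by (auto simp: bij_betw_def inj_on_def)
  moreover have "(`) ?f ` {{x, y}} = {{1, 2}}" "(`) ?f ` {{x, y}, {y, z}} = {{1, 2}, {2, 3}}"
    using assms by auto
  ultimately show "graph_iso ({x, y, z}, {{x, y}}) ({1, 2, 3 :: nat}, {{1, 2}})"
    "graph_iso ({x, y, z}, {{x, y}, {y, z}}) ({1, 2, 3 :: nat}, {{1, 2}, {2, 3}})"
    unfolding graph_iso_def fst_conv snd_conv by blast+
qed

lemma graph_iso_four_vertices:
  fixes a b c d :: 'v
  assumes "a \<noteq> b" "a \<noteq> c" "a \<noteq> d" "b \<noteq> c" "b \<noteq> d" "c \<noteq> d"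
  shows "graph_iso ({a, b, c, d}, {{a, b}, {c, d}}) ({1, 2, 3, 4 :: nat}, {{1, 2}, {3, 4}})"
    "graph_iso ({a, b, c, d}, {{a, b}, {b, c}, {c, d}, {d, a}})
      ({1, 2, 3, 4 :: nat}, {{1, 2}, {2, 3}, {3, 4}, {4, 1}})"
proof -
  let ?f = "\<lambda>u. if u = a then 1 else if u = b then 2 else if u = c then 3 else 4 :: nat"
  have "bij_betw ?f {a, b, c, d} {1, 2, 3, 4}" using assms by (auto simp: bij_betw_def inj_on_def)
  moreover have "(`) ?f ` {{a, b}, {c, d}} = {{1, 2}, {3, 4}}"
    "(`) ?f ` {{a, b}, {b, c}, {c, d}, {d, a}} = {{1, 2}, {2, 3}, {3, 4}, {4, 1}}"
    using assms by auto
  ultimately show "graph_iso ({a, b, c, d}, {{a, b}, {c, d}}) ({1, 2, 3, 4 :: nat}, {{1, 2}, {3, 4}})"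
    "graph_iso ({a, b, c, d}, {{a, b}, {b, c}, {c, d}, {d, a}})
      ({1, 2, 3, 4 :: nat}, {{1, 2}, {2, 3}, {3, 4}, {4, 1}})"
    unfolding graph_iso_def fst_conv snd_conv by blast+
qed

text \<open>If every degree is at least \<open>d\<close> and \<open>card A \<le> 2 d\<close>, then \<open>d * card V \<le> 2 * card A \<le> 4 d\<close>, so
  there are at most four vertices, and with four the graph is regular.\<close>

lemma few_edges_graphs:
  assumes G: "finite_simple_graph (V, A)" and d: "\<And>x. x \<in> V \<Longrightarrow> d \<le> degree_in A x"
    and xy: "x \<in> V" "y \<in> V" "x \<noteq> y" "{x, y} \<notin> A"
    and dx: "d \<le> card V - 2" and A: "card A \<le> 2 * d" "2 \<le> card A"
  shows "graph_iso (V, A) ({1, 2, 3 :: nat}, {{1, 2}, {2, 3}})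
    \<or> graph_iso (V, A) ({1, 2, 3, 4 :: nat}, {{1, 2}, {3, 4}})
    \<or> graph_iso (V, A) ({1, 2, 3, 4 :: nat}, {{1, 2}, {2, 3}, {3, 4}, {4, 1}})"
proof -
  have fin: "finite V" "finite A" using finite_simple_graphD(1,2)[OF G] by simp_all
  have "card V * d \<le> (\<Sum>x\<in>V. degree_in A x)"
    using sum_mono[of V "\<lambda>_. d" "degree_in A"] d by simp
  then have "card V * d \<le> 2 * card A" using sum_degrees[OF G] by simp
  then have 1: "card V * d \<le> 2 * card A" "card V * d \<le> 4 * d" using A(1) by linarith+
  have "0 < d" using A by simp
  then have "card V \<le> 4" using 1(2) mult_le_cancel2[of "card V" d 4] by blast
  moreover have "3 \<le> card V" using dx \<open>0 < d\<close> by simp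
  ultimately consider "card V = 3" | "card V = 4" by linarith
  then show ?thesis
  proof cases
    case 1
    then have "card (V - {x, y}) = 1" using fin xy by (simp add: card_Diff_subset)
    then obtain z where z: "V - {x, y} = {z}" by (auto simp: card_1_singleton_iff)
    then have V: "V = {x, z, y}" and ne: "x \<noteq> z" "z \<noteq> y" using xy by auto
    have "card A = 2" using dx A 1 by simp
    moreover have "A \<subseteq> {{x, z}, {z, y}}"
    proof
      fix e assume "e \<in> A"
      then obtain a b where "e = {a, b}" "a \<in> V" "b \<in> V" "a \<noteq> b"
        using finite_simple_graphD(4)[OF G, of e] by auto
      then show "e \<in> {{x, z}, {z, y}}"
        using V xy(4) \<open>e \<in> A\<close> by (auto simp: insert_commute)
    qed
    moreover have "card {{x, z}, {z, y}} = 2" using ne xy(3) by (simp add: doubleton_eq_iff)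
    ultimately have "A = {{x, z}, {z, y}}" by (intro card_subset_eq) auto
    then show ?thesis using graph_iso_three_vertices(2)[of x z y] ne xy(3) V by simp
  next
    case 2
    have A2: "card A = 2 * d" using 1(1) 2 A(1) by simp
    have reg: "degree_in A u = d" if "u \<in> V" for u
    proof (rule ccontr)
      assume "degree_in A u \<noteq> d"
      then have "d < degree_in A u" using d[OF that] by simp
      then have "(\<Sum>x\<in>V. d) < (\<Sum>x\<in>V. degree_in A x)"
        using d that fin by (intro sum_strict_mono_ex1) auto
      then show False using sum_degrees[OF G] A2 2 by simp
    qed
    have "d = 1 \<or> d = 2" using dx 2 \<open>0 < d\<close> by auto
    then show ?thesis
    proof
      assume "d = 1"
      then have "card A = 2" using A2 by simp
      then have "A \<noteq> {}" by auto
      then obtain e where "e \<in> A" by blast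
      then obtain a b where ab: "{a, b} \<in> A" "a \<in> V" "b \<in> V" "a \<noteq> b"
        using finite_simple_graphD(4)[OF G, of e] by auto
      have "card (V - {a, b}) = 2" using fin ab 2 by (simp add: card_Diff_subset)
      then obtain c e where ce: "V - {a, b} = {c, e}" "c \<noteq> e" by (auto simp: card_2_iff)
      then have V: "V = {a, b, c, e}" and ne: "a \<noteq> c" "a \<noteq> e" "b \<noteq> c" "b \<noteq> e" using ab by auto
      have uniq: "f = {a, b}" if f: "f \<in> A" "a \<in> f \<or> b \<in> f" for f
      proof -
        obtain u where u: "u \<in> {a, b}" "u \<in> f" using f(2) by blast
        then have "degree_in A u = 1" using reg ab \<open>d = 1\<close> by auto
        then obtain h where h: "{e \<in> A. u \<in> e} = {h}" by (auto simp: card_1_singleton_iff)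
        have "f \<in> {e \<in> A. u \<in> e}" "{a, b} \<in> {e \<in> A. u \<in> e}" using u f(1) ab(1) by simp_all
        then show ?thesis unfolding h by simp
      qed
      have "degree_in A c = 1" using reg ce \<open>d = 1\<close> by auto
      then obtain f where "{e \<in> A. c \<in> e} = {f}" by (auto simp: card_1_singleton_iff)
      then have f: "f \<in> A" "c \<in> f" by auto
      then obtain u where u: "u \<in> V - {c}" "f = {c, u}" using edges_at_subset[OF G] by blast
      have "u \<noteq> a" "u \<noteq> b" using uniq[OF f(1)] u ne ab(4) f(2) by auto
      then have "{c, e} \<in> A" using u V f(1) by auto
      moreover have "card {{a, b}, {c, e}} = 2" using ne by (simp add: doubleton_eq_iff)
      ultimately have "{{a, b}, {c, e}} = A"
        using ab(1) \<open>card A = 2\<close> fin by (intro card_subset_eq) auto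
      then show ?thesis
        using graph_iso_four_vertices(1)[of a b c e] ab(4) ne ce(2) V by simp
    next
      assume "d = 2"
      have "card (V - {x, y}) = 2" using fin xy 2 by (simp add: card_Diff_subset)
      then obtain z w where zw: "V - {x, y} = {z, w}" "z \<noteq> w" by (auto simp: card_2_iff)
      then have V: "V = {x, z, y, w}" and ne: "x \<noteq> z" "x \<noteq> w" "y \<noteq> z" "y \<noteq> w" using xy by auto
      have two: "{u, z} \<in> A \<and> {u, w} \<in> A" if u: "u \<in> {x, y}" for u
      proof -
        have "{e \<in> A. u \<in> e} \<subseteq> {{u, z}, {u, w}}"
        proof
          fix e assume e: "e \<in> {e \<in> A. u \<in> e}"
          then obtain t where "t \<in> V - {u}" "e = {u, t}" using edges_at_subset[OF G] by blast
          then show "e \<in> {{u, z}, {u, w}}" using e u V xy(4) by (auto simp: insert_commute)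
        qed
        moreover have "card {e \<in> A. u \<in> e} = 2" using reg u xy \<open>d = 2\<close> by auto
        moreover have "card {{u, z}, {u, w}} = 2" using zw(2) by (simp add: doubleton_eq_iff)
        ultimately have "{e \<in> A. u \<in> e} = {{u, z}, {u, w}}" by (intro card_subset_eq) auto
        then show ?thesis by blast
      qed
      have "card {{x, z}, {z, y}, {y, w}, {w, x}} = 4"
        using ne zw(2) xy(3) by (simp add: doubleton_eq_iff)
      moreover have "{{x, z}, {z, y}, {y, w}, {w, x}} \<subseteq> A"
        using two[of x] two[of y] by (simp add: insert_commute)
      ultimately have "{{x, z}, {z, y}, {y, w}, {w, x}} = A"
        using A2 \<open>d = 2\<close> fin by (intro card_subset_eq) auto
      then show ?thesis
        using graph_iso_four_vertices(2)[of x z y w] ne zw(2) xy(3) V by simp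
    qed
  qed
qed

text \<open>With at most one edge the obstruction is an isolated vertex. With more edges it is a vertex \<open>u\<close> of
  least degree; \<open>Suc (degree_in A u)\<close> is less than \<open>card V\<close> because some two vertices are not
  adjacent.\<close>

lemma open_imp_listed:
  assumes G: "finite_simple_graph (V, A)" and "V \<noteq> {}" and v: "bij_betw v {1..card V} V"
    and n: "CARD('n::finite) = card V + card A"
    and open_P: "zariski_open_in nil2_brackets (presented_brackets (V, A) :: 'n bracket set)"
  shows "(\<exists>m\<ge>1. graph_iso (V, A) (complete_graph m))
         \<or> graph_iso (V, A) ({1, 2 :: nat}, {})
         \<or> graph_iso (V, A) ({1, 2, 3 :: nat}, {{1, 2}})
         \<or> graph_iso (V, A) ({1, 2, 3 :: nat}, {{1, 2}, {2, 3}})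
         \<or> graph_iso (V, A) ({1, 2, 3, 4 :: nat}, {{1, 2}, {3, 4}})
         \<or> graph_iso (V, A) ({1, 2, 3, 4 :: nat}, {{1, 2}, {2, 3}, {3, 4}, {4, 1}})"
proof (cases "A = all_edges V")
  case True
  then show ?thesis
    using complete_graph_iso[of V] finite_simple_graphD(1)[OF G] \<open>V \<noteq> {}\<close> by auto
next
  case False
  have fin: "finite V" "finite A" using finite_simple_graphD(1,2)[OF G] by simp_all
  have "A \<subseteq> all_edges V" using G by (simp add: finite_simple_graph_def)
  then obtain x y where xy: "x \<in> V" "y \<in> V" "x \<noteq> y" "{x, y} \<notin> A"
    using False unfolding all_edges_def by blast
  have v': "bij_betw v {1..card (fst (V, A))} (fst (V, A))" using v by simp
  have n': "CARD('n) = card (fst (V, A)) + card (snd (V, A))" using n by simp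
  have isolated: "False" if z: "z \<in> V" "\<And>y. {z, y} \<notin> A"
    and ab: "a \<in> V" "b \<in> V" "a \<noteq> b" "a \<noteq> z" "b \<noteq> z" "{a, b} \<notin> A" for z a b
    using isolated_vertex_not_open[OF G v' n' open_P, of z a b] z ab by simp
  have "card {x, y} \<le> card V" using xy fin by (intro card_mono) auto
  then have V2: "2 \<le> card V" using xy(3) by simp
  consider "card A = 0" | "card A = 1" | "2 \<le> card A" by linarith
  then show ?thesis
  proof cases
    case 1
    then have "A = {}" using fin by simp
    have "V = {x, y}"
    proof (rule ccontr)
      assume "V \<noteq> {x, y}"
      then obtain z where "z \<in> V" "z \<noteq> x" "z \<noteq> y" using xy by blast
      then show False using isolated[of z x y] xy \<open>A = {}\<close> by auto
    qed
    then show ?thesis using graph_iso_two_vertices[OF xy(3)] \<open>A = {}\<close> by simp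
  next
    case 2
    then obtain e where "A = {e}" by (auto simp: card_1_singleton_iff)
    then obtain a b where ab: "A = {{a, b}}" "a \<in> V" "b \<in> V" "a \<noteq> b"
      using finite_simple_graphD(4)[OF G, of e] by auto
    have "V \<noteq> {a, b}" using xy ab(1) by (auto simp: insert_commute)
    then obtain c where c: "c \<in> V" "c \<noteq> a" "c \<noteq> b" using ab by blast
    have "V = {a, b, c}"
    proof (rule ccontr)
      assume "V \<noteq> {a, b, c}"
      then obtain z where "z \<in> V" "z \<noteq> a" "z \<noteq> b" "z \<noteq> c" using ab c by blast
      then show False
        using isolated[of z a c] ab c by (auto simp: doubleton_eq_iff)
    qed
    then show ?thesis
      using graph_iso_three_vertices(1)[of a b c] ab c by simp
  next
    case 3
    have "Min (degree_in A ` V) \<in> degree_in A ` V"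
      using fin \<open>V \<noteq> {}\<close> by (intro Min_in) simp_all
    then obtain u where u1: "u \<in> V" and min: "Min (degree_in A ` V) = degree_in A u" by blast
    have "degree_in A u \<le> degree_in A x" if "x \<in> V" for x
      unfolding min[symmetric] by (rule Min_le[OF finite_imageI[OF fin(1)] imageI[OF that]])
    note u = u1 this
    let ?d = "degree_in A u"
    have d: "?d \<le> card V - 2" using u(2)[OF xy(1)] degree_le[OF G xy] by simp
    show ?thesis
    proof (cases "2 * Suc ?d \<le> card A + 1")
      case True
      have "Suc ?d + 1 \<le> card V" using d V2 by linarith
      then have False
        using small_degree_not_open[OF G v' n' open_P, of u "Suc ?d"] u(1) True 3 by simp
      then show ?thesis ..
    next
      case False
      then have "card A \<le> 2 * ?d" by simp
      then show ?thesis using few_edges_graphs[OF G u(2) xy d _ 3] by blast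
    qed
  qed
qed

lemma listed_imp_open:
  assumes G: "finite_simple_graph (V, A)" and n: "CARD('n::finite) = card V + card A"
    and listed: "(\<exists>m\<ge>1. graph_iso (V, A) (complete_graph m))
         \<or> graph_iso (V, A) ({1, 2 :: nat}, {})
         \<or> graph_iso (V, A) ({1, 2, 3 :: nat}, {{1, 2}})
         \<or> graph_iso (V, A) ({1, 2, 3 :: nat}, {{1, 2}, {2, 3}})
         \<or> graph_iso (V, A) ({1, 2, 3, 4 :: nat}, {{1, 2}, {3, 4}})
         \<or> graph_iso (V, A) ({1, 2, 3, 4 :: nat}, {{1, 2}, {2, 3}, {3, 4}, {4, 1}})"
  shows "zariski_open_in nil2_brackets (presented_brackets (V, A) :: 'n bracket set)"
proof -
  have transfer: ?thesis
    if iso: "graph_iso (V, A) H" and "CARD('n) = card (fst H) + card (snd H) \<Longrightarrow>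
      zariski_open_in nil2_brackets (presented_brackets H :: 'n bracket set)" for H :: "nat graph"
    using that(2) graph_iso_transfer(2,3)[OF G iso] graph_iso_transfer(4)[OF G iso, where 'c = 'n] n by simp
  from listed show ?thesis
  proof (elim disjE exE conjE)
    fix m assume "graph_iso (V, A) (complete_graph m)"
    then show ?thesis
      by (rule transfer) (simp add: complete_graph_def complete_graph_open)
  next
    assume "graph_iso (V, A) ({1, 2 :: nat}, {})"
    then show ?thesis by (rule transfer) (simp add: two_vertices_open[simplified])
  next
    assume "graph_iso (V, A) ({1, 2, 3 :: nat}, {{1, 2}})"
    then show ?thesis by (rule transfer) (simp add: edge_and_vertex_open[simplified])
  next
    assume "graph_iso (V, A) ({1, 2, 3 :: nat}, {{1, 2}, {2, 3}})"
    then show ?thesis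
      by (rule transfer) (rule path_open, simp add: doubleton_eq_iff)
  next
    assume "graph_iso (V, A) ({1, 2, 3, 4 :: nat}, {{1, 2}, {3, 4}})"
    then show ?thesis
      by (rule transfer) (rule two_disjoint_edges_open, simp add: doubleton_eq_iff)
  next
    assume "graph_iso (V, A) ({1, 2, 3, 4 :: nat}, {{1, 2}, {2, 3}, {3, 4}, {4, 1}})"
    then show ?thesis
      by (rule transfer) (rule four_cycle_open, simp add: doubleton_eq_iff)
  qed
qed

theorem theorem3p5:
  fixes V :: "'v set" and A :: "'v set set" and v :: "nat \<Rightarrow> 'v"
  assumes "finite_simple_graph (V, A)"
    and "V \<noteq> {}"
    and "bij_betw v {1..card V} V"
    and "CARD('n::finite) = card V + card A"
  shows "two_rigid_algebra TYPE('n) (graph_space (V, A)) (graph_bracket (V, A) v) \<longleftrightarrow>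
           (\<exists>m\<ge>1. graph_iso (V, A) (complete_graph m))
         \<or> graph_iso (V, A) ({1, 2 :: nat}, {})
         \<or> graph_iso (V, A) ({1, 2, 3 :: nat}, {{1, 2}})
         \<or> graph_iso (V, A) ({1, 2, 3 :: nat}, {{1, 2}, {2, 3}})
         \<or> graph_iso (V, A) ({1, 2, 3, 4 :: nat}, {{1, 2}, {3, 4}})
         \<or> graph_iso (V, A) ({1, 2, 3, 4 :: nat}, {{1, 2}, {2, 3}, {3, 4}, {4, 1}})"
proof -
  have "two_rigid_algebra TYPE('n) (graph_space (V, A)) (graph_bracket (V, A) v) \<longleftrightarrow>
    zariski_open_in nil2_brackets (presented_brackets (V, A) :: 'n bracket set)"
    by (rule two_rigid_algebra_iff_open) (use assms in simp_all)
  then show ?thesis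
    using open_imp_listed[OF assms] listed_imp_open[OF assms(1,4)] by blast
qed

end
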